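(* Let $\mathbb{K}$ be a commutative ring and $r\geq1$. The normalized chain complex $\bar{N}_*(\mathcal{C})(r)$ of the reduced simplicial bar construction of the commutative operad $\mathcal{C}$ in arity $r$ is isomorphic to the normalized chain complex $N_*(\bar{K}(r))$ of the simplicial set $\bar{K}(r)$ of chains of partitions of $\{1,\dots,r\}$ from the one-block partition to the partition into singletons.
   Context: $\Sigma_*$-modules are sequences $M(r)$, $r\in\mathbb{N}$, of $\mathbb{K}[\Sigma_r]$-modules; $(M\circ N)(n)=\bigoplus_r(M(r)\otimes N^{\otimes r}(n))_{\Sigma_r}$, where $(M\otimes N)(n)=\bigoplus_{J\amalg J'=\{1,\dots,n\}}M(J)\otimes N(J')$, with unit $I$ ($I(1)=\mathbb{K}$, $I(r)=0$ for $r\neq1$); operads are monoids for $\circ$. The commutative operad has $\mathcal{C}(0)=0$ and $\mathcal{C}(r)=\mathbb{K}$ (trivial representation) for $r\geq1$. For an operad $P$ with $P(0)=0$, $P(1)=\mathbb{K}1$ and augmentation $P\to I$, the reduced simplicial bar construction is $\bar{C}_d(P)=P^{\circ d}$ with $d_i$ ($0<i<d$) the product of the $i$-th and $(i+1)$-th factors, $d_0$ and $d_d$ the augmentation of the first and last factors, and degeneracies inserting units; $\bar{N}_*(P)$ is its normalized chain complex. Partitions are ordered by $\lambda\leq\mu$ if $\mu$ refines $\lambda$. $\bar{K}(r)$ is the pointed simplicial set whose non-base-point $n$-simplices are chains $\lambda_0\leq\dots\leq\lambda_n$ of partitions of $\{1,\dots,r\}$ with $\lambda_0$ the one-block partition and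 $\lambda_n$ the partition into singletons; $d_i$ omits $\lambda_i$ (giving the base point if the result no longer has the required end points) and $s_j$ repeats $\lambda_j$. $N_*(\bar{K}(r))$ is its reduced normalized chain complex with coefficients in $\mathbb{K}$ (base point set to $0$). *)

theory Defs
  imports
    "HOL-Algebra.Module"
    "HOL-Algebra.AbelCoset"
    "HOL-Combinatorics.Permutations"
    "HOL-Library.Disjoint_Sets"
begin

section \<open>Linear maps and quotient modules\<close>

definition lin_maps ::
  "('k, 'm) ring_scheme \<Rightarrow> ('k, 'a) module \<Rightarrow> ('k, 'b) module \<Rightarrow> ('a \<Rightarrow> 'b) set" where
  "lin_maps K A B = {f. (\<forall>x\<in>carrier A. f x \<in> carrier B) \<and>
     (\<forall>x\<in>carrier A. \<forall>y\<in>carrier A. f (x \<oplus>\<^bsub>A\<^esub> y) = f x \<oplus>\<^bsub>B\<^esub> f y) \<and>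
     (\<forall>a\<in>carrier K. \<forall>x\<in>carrier A. f (a \<odot>\<^bsub>A\<^esub> x) = a \<odot>\<^bsub>B\<^esub> f x)}"

definition lin_isos ::
  "('k, 'm) ring_scheme \<Rightarrow> ('k, 'a) module \<Rightarrow> ('k, 'b) module \<Rightarrow> ('a \<Rightarrow> 'b) set" where
  "lin_isos K A B = {f \<in> lin_maps K A B. bij_betw f (carrier A) (carrier B)}"

text \<open>The module \<open>A / D\<close>, and the map of quotients \<open>A / C \<rightarrow> B / D\<close> induced by a linear map
  \<open>f : A \<rightarrow> B\<close> with \<open>f C \<subseteq> D\<close>; elements are cosets.\<close>

definition quot_map :: "('k, 'b) module \<Rightarrow> 'b set \<Rightarrow> ('a \<Rightarrow> 'b) \<Rightarrow> 'a set \<Rightarrow> 'b set" where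
  "quot_map B D f S = (\<Union>x\<in>S. D +>\<^bsub>B\<^esub> f x)"

definition quot_mod :: "('k, 'a) module \<Rightarrow> 'a set \<Rightarrow> ('k, 'a set) module" where
  "quot_mod A D = \<lparr>carrier = a_rcosets\<^bsub>A\<^esub> D, monoid.mult = undefined, one = undefined,
     zero = D, add = (\<lambda>S T. S <+>\<^bsub>A\<^esub> T), smult = (\<lambda>a. quot_map A D (\<lambda>x. a \<odot>\<^bsub>A\<^esub> x))\<rparr>"


section \<open>Symmetric sequences of modules\<close>

text \<open>The components of the iterated composites \<open>P \<circ> (P \<circ> \<dots>)\<close> must all live in one type, so
  their elements are taken from a single datatype. \<open>Scal a\<close> is an element of the
  ground ring. In \<open>Comb t\<close> the list \<open>t\<close> represents the formal linear combination of its
  entries; an entry \<open>(a, x, [(J\<^sub>1, y\<^sub>1), \<dots>, (J\<^sub>s, y\<^sub>s)])\<close> stands for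
  \<open>a \<cdot> x \<otimes> (y\<^sub>1 \<otimes> \<dots> \<otimes> y\<^sub>s)\<close> with \<open>x \<in> M(s)\<close> and \<open>y\<^sub>i \<in> N(J\<^sub>i)\<close>.\<close>

datatype 'k elt =
    Scal (unscal: 'k)
  | Comb (uncomb: "('k \<times> 'k elt \<times> (nat set \<times> 'k elt) list) list")

text \<open>The symmetric group on \<open>r\<close> letters is \<open>{w. w permutes {1..r}}\<close>, acting from the left.\<close>

record 'k sigma_mod =
  obj :: "nat \<Rightarrow> ('k, 'k elt) module"
  act :: "nat \<Rightarrow> (nat \<Rightarrow> nat) \<Rightarrow> 'k elt \<Rightarrow> 'k elt"

text \<open>For a finite set \<open>J\<close> of naturals, \<open>N(J)\<close> is \<open>N(card J)\<close>, transported along the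
  order preserving bijection \<open>emb J : {1..card J} \<rightarrow> J\<close>. Under this convention an order
  preserving bijection \<open>J \<rightarrow> J'\<close> induces the identity, and a bijection \<open>w : J \<rightarrow> w ` J\<close>
  acts through the permutation \<open>std_perm w J\<close>.\<close>

definition emb :: "nat set \<Rightarrow> nat \<Rightarrow> nat" where
  "emb J i = sorted_list_of_set J ! (i - 1)"

definition std_perm :: "(nat \<Rightarrow> nat) \<Rightarrow> nat set \<Rightarrow> nat \<Rightarrow> nat" where
  "std_perm w J i = (if i \<in> {1..card J} then card {j \<in> w ` J. j \<le> w (emb J i)} else i)"


section \<open>The composition product\<close>

definition decomp :: "nat \<Rightarrow> nat set list \<Rightarrow> bool" where
  "decomp n Js \<longleftrightarrow> (\<forall>i<length Js. \<forall>j<i. Js ! i \<inter> Js ! j = {}) \<and> \<Union>(set Js) = {1..n}"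

definition tensors ::
  "'k sigma_mod \<Rightarrow> 'k sigma_mod \<Rightarrow> nat \<Rightarrow> ('k elt \<times> (nat set \<times> 'k elt) list) set" where
  "tensors M N n = {(x, ys). decomp n (map fst ys) \<and> x \<in> carrier (obj M (length ys)) \<and>
     (\<forall>(J, y)\<in>set ys. y \<in> carrier (obj N (card J)))}"

definition combs ::
  "('k, 'm) ring_scheme \<Rightarrow> 'k sigma_mod \<Rightarrow> 'k sigma_mod \<Rightarrow> nat \<Rightarrow>
    ('k \<times> 'k elt \<times> (nat set \<times> 'k elt) list) list set" where
  "combs K M N n = {t. \<forall>(a, g)\<in>set t. a \<in> carrier K \<and> g \<in> tensors M N n}"

text \<open>\<open>[y\<^bsub>\<sigma>(1)\<^esub>, \<dots>, y\<^bsub>\<sigma>(s)\<^esub>]\<close>\<close>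

definition perm_factors :: "(nat \<Rightarrow> nat) \<Rightarrow> 'a list \<Rightarrow> 'a list" where
  "perm_factors \<sigma> ys = map (\<lambda>i. ys ! (\<sigma> i - 1)) [1..<Suc (length ys)]"

text \<open>Equality of two combinations in \<open>\<Oplus>\<^sub>s (M(s) \<otimes> N\<^sup>\<otimes>\<^sup>s(n))\<^bsub>\<Sigma>\<^sub>s\<^esub>\<close>: the first seven rules
  describe the free module, the next four multilinearity of the tensor symbol, and
  the last one the passage to coinvariants, \<open>\<sigma> x \<otimes> (y\<^sub>1, \<dots>) = x \<otimes> (y\<^bsub>\<sigma>(1)\<^esub>, \<dots>)\<close>.
  No rule mixes tensors whose lists \<open>ys\<close> have different lengths, or different
  decompositions up to reordering; this gives the two direct sums.\<close>

inductive comb_eq ::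
  "('k, 'm) ring_scheme \<Rightarrow> 'k sigma_mod \<Rightarrow> 'k sigma_mod \<Rightarrow> nat \<Rightarrow>
    ('k \<times> 'k elt \<times> (nat set \<times> 'k elt) list) list \<Rightarrow>
    ('k \<times> 'k elt \<times> (nat set \<times> 'k elt) list) list \<Rightarrow> bool"
  for K :: "('k, 'm) ring_scheme" and M N :: "'k sigma_mod" and n :: nat where
  refl: "t \<in> combs K M N n \<Longrightarrow> comb_eq K M N n t t"
| sym: "comb_eq K M N n t u \<Longrightarrow> comb_eq K M N n u t"
| trans: "comb_eq K M N n t u \<Longrightarrow> comb_eq K M N n u v \<Longrightarrow> comb_eq K M N n t v"
| append: "comb_eq K M N n t t' \<Longrightarrow> comb_eq K M N n u u' \<Longrightarrow> comb_eq K M N n (t @ u) (t' @ u')"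
| commute: "t \<in> combs K M N n \<Longrightarrow> u \<in> combs K M N n \<Longrightarrow> comb_eq K M N n (t @ u) (u @ t)"
| coeff_zero: "g \<in> tensors M N n \<Longrightarrow> comb_eq K M N n [(\<zero>\<^bsub>K\<^esub>, g)] []"
| coeff_add: "a \<in> carrier K \<Longrightarrow> b \<in> carrier K \<Longrightarrow> g \<in> tensors M N n \<Longrightarrow>
    comb_eq K M N n [(a \<oplus>\<^bsub>K\<^esub> b, g)] [(a, g), (b, g)]"
| left_add: "a \<in> carrier K \<Longrightarrow> (x, ys) \<in> tensors M N n \<Longrightarrow> (x', ys) \<in> tensors M N n \<Longrightarrow>
    comb_eq K M N n [(a, x \<oplus>\<^bsub>obj M (length ys)\<^esub> x', ys)] [(a, x, ys), (a, x', ys)]"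
| left_smult: "a \<in> carrier K \<Longrightarrow> c \<in> carrier K \<Longrightarrow> (x, ys) \<in> tensors M N n \<Longrightarrow>
    comb_eq K M N n [(a, c \<odot>\<^bsub>obj M (length ys)\<^esub> x, ys)] [(a \<otimes>\<^bsub>K\<^esub> c, x, ys)]"
| right_add: "a \<in> carrier K \<Longrightarrow>
    (x, us @ (J, y) # vs) \<in> tensors M N n \<Longrightarrow> (x, us @ (J, y') # vs) \<in> tensors M N n \<Longrightarrow>
    comb_eq K M N n [(a, x, us @ (J, y \<oplus>\<^bsub>obj N (card J)\<^esub> y') # vs)]
      [(a, x, us @ (J, y) # vs), (a, x, us @ (J, y') # vs)]"
| right_smult: "a \<in> carrier K \<Longrightarrow> c \<in> carrier K \<Longrightarrow> (x, us @ (J, y) # vs) \<in> tensors M N n \<Longrightarrow>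
    comb_eq K M N n [(a, x, us @ (J, c \<odot>\<^bsub>obj N (card J)\<^esub> y) # vs)]
      [(a \<otimes>\<^bsub>K\<^esub> c, x, us @ (J, y) # vs)]"
| coinvariants: "a \<in> carrier K \<Longrightarrow> (x, ys) \<in> tensors M N n \<Longrightarrow> \<sigma> permutes {1..length ys} \<Longrightarrow>
    comb_eq K M N n [(a, act M (length ys) \<sigma> x, ys)] [(a, x, perm_factors \<sigma> ys)]"

text \<open>A class of combinations is represented by a chosen member, so that it is again an
  element of the type \<open>'k elt\<close>.\<close>

definition comb_class ::
  "('k, 'm) ring_scheme \<Rightarrow> 'k sigma_mod \<Rightarrow> 'k sigma_mod \<Rightarrow> nat \<Rightarrow>
    ('k \<times> 'k elt \<times> (nat set \<times> 'k elt) list) list \<Rightarrow> 'k elt" where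
  "comb_class K M N n t = Comb (SOME u. comb_eq K M N n t u)"

definition comp_obj ::
  "('k, 'm) ring_scheme \<Rightarrow> 'k sigma_mod \<Rightarrow> 'k sigma_mod \<Rightarrow> nat \<Rightarrow> ('k, 'k elt) module" where
  "comp_obj K M N n = \<lparr>carrier = comb_class K M N n ` combs K M N n,
     monoid.mult = undefined, one = undefined,
     zero = comb_class K M N n [],
     add = (\<lambda>u v. comb_class K M N n (uncomb u @ uncomb v)),
     smult = (\<lambda>c u. comb_class K M N n (map (\<lambda>(a, g). (c \<otimes>\<^bsub>K\<^esub> a, g)) (uncomb u)))\<rparr>"

definition pure ::
  "('k, 'm) ring_scheme \<Rightarrow> 'k sigma_mod \<Rightarrow> 'k sigma_mod \<Rightarrow> nat \<Rightarrow>
    'k elt \<Rightarrow> (nat set \<times> 'k elt) list \<Rightarrow> 'k elt" where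
  "pure K M N n x ys = comb_class K M N n [(\<one>\<^bsub>K\<^esub>, x, ys)]"

text \<open>The linear map \<open>(M \<circ> N)(n) \<rightarrow> A\<close> with prescribed values on the pure tensors. These
  span \<open>(M \<circ> N)(n)\<close>, so the map is unique on the carrier whenever it exists.\<close>

definition comp_lift ::
  "('k, 'm) ring_scheme \<Rightarrow> 'k sigma_mod \<Rightarrow> 'k sigma_mod \<Rightarrow> nat \<Rightarrow> ('k, 'k elt) module \<Rightarrow>
    ('k elt \<Rightarrow> (nat set \<times> 'k elt) list \<Rightarrow> 'k elt) \<Rightarrow> 'k elt \<Rightarrow> 'k elt" where
  "comp_lift K M N n A g = (SOME f. f \<in> lin_maps K (comp_obj K M N n) A \<and>
     (\<forall>(x, ys)\<in>tensors M N n. f (pure K M N n x ys) = g x ys))"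

definition comp ::
  "('k, 'm) ring_scheme \<Rightarrow> 'k sigma_mod \<Rightarrow> 'k sigma_mod \<Rightarrow> 'k sigma_mod" where
  "comp K M N = \<lparr>obj = comp_obj K M N,
     act = (\<lambda>n w. comp_lift K M N n (comp_obj K M N n) (\<lambda>x ys. pure K M N n x
       (map (\<lambda>(J, y). (w ` J, act N (card J) (std_perm w J) y)) ys)))\<rparr>"

text \<open>Functoriality \<open>\<phi> \<circ> \<psi> : M \<circ> N \<rightarrow> M' \<circ> N'\<close>.\<close>

definition comp_map ::
  "('k, 'm) ring_scheme \<Rightarrow> 'k sigma_mod \<Rightarrow> 'k sigma_mod \<Rightarrow> 'k sigma_mod \<Rightarrow> 'k sigma_mod \<Rightarrow>
    (nat \<Rightarrow> 'k elt \<Rightarrow> 'k elt) \<Rightarrow> (nat \<Rightarrow> 'k elt \<Rightarrow> 'k elt) \<Rightarrow> nat \<Rightarrow> 'k elt \<Rightarrow> 'k elt" where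
  "comp_map K M N M' N' \<phi> \<psi> n = comp_lift K M N n (comp_obj K M' N' n)
     (\<lambda>x ys. pure K M' N' n (\<phi> (length ys) x) (map (\<lambda>(J, y). (J, \<psi> (card J) y)) ys))"

definition ground_mod :: "('k, 'm) ring_scheme \<Rightarrow> ('k, 'k elt) module" where
  "ground_mod K = \<lparr>carrier = Scal ` carrier K, monoid.mult = undefined, one = undefined,
     zero = Scal \<zero>\<^bsub>K\<^esub>, add = (\<lambda>x y. Scal (unscal x \<oplus>\<^bsub>K\<^esub> unscal y)),
     smult = (\<lambda>a x. Scal (a \<otimes>\<^bsub>K\<^esub> unscal x))\<rparr>"

definition zero_mod :: "('k, 'm) ring_scheme \<Rightarrow> ('k, 'k elt) module" where
  "zero_mod K = \<lparr>carrier = {Scal \<zero>\<^bsub>K\<^esub>}, monoid.mult = undefined, one = undefined,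
     zero = Scal \<zero>\<^bsub>K\<^esub>, add = (\<lambda>x y. Scal \<zero>\<^bsub>K\<^esub>), smult = (\<lambda>a x. Scal \<zero>\<^bsub>K\<^esub>)\<rparr>"

definition unit_mod :: "('k, 'm) ring_scheme \<Rightarrow> 'k sigma_mod" where
  "unit_mod K = \<lparr>obj = (\<lambda>r. if r = 1 then ground_mod K else zero_mod K), act = (\<lambda>r w x. x)\<rparr>"

text \<open>The isomorphism \<open>I \<circ> X \<cong> X\<close> and its inverse. The tensors of \<open>I \<circ> X\<close> whose list of
  factors does not have length one vanish, because \<open>I(s) = 0\<close> for \<open>s \<noteq> 1\<close>.\<close>

definition left_unitor ::
  "('k, 'm) ring_scheme \<Rightarrow> 'k sigma_mod \<Rightarrow> nat \<Rightarrow> 'k elt \<Rightarrow> 'k elt" where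
  "left_unitor K X n = comp_lift K (unit_mod K) X n (obj X n)
     (\<lambda>a ys. if length ys = 1 then unscal a \<odot>\<^bsub>obj X n\<^esub> snd (hd ys) else \<zero>\<^bsub>obj X n\<^esub>)"

definition left_unitor_inv ::
  "('k, 'm) ring_scheme \<Rightarrow> 'k sigma_mod \<Rightarrow> nat \<Rightarrow> 'k elt \<Rightarrow> 'k elt" where
  "left_unitor_inv K X n y = pure K (unit_mod K) X n (Scal \<one>\<^bsub>K\<^esub>) [({1..n}, y)]"


section \<open>Operads and the reduced simplicial bar construction\<close>

text \<open>The data of an augmented operad \<open>P\<close>: product \<open>P \<circ> P \<rightarrow> P\<close>, unit \<open>I \<rightarrow> P\<close> and
  augmentation \<open>P \<rightarrow> I\<close>, all given arity by arity.\<close>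

record 'k operad =
  und :: "'k sigma_mod"
  op_mult :: "nat \<Rightarrow> 'k elt \<Rightarrow> 'k elt"
  op_unit :: "nat \<Rightarrow> 'k elt \<Rightarrow> 'k elt"
  op_aug :: "nat \<Rightarrow> 'k elt \<Rightarrow> 'k elt"

text \<open>The commutative operad; its product is \<open>x \<otimes> (y\<^sub>1 \<otimes> \<dots> \<otimes> y\<^sub>s) \<mapsto> x y\<^sub>1 \<dots> y\<^sub>s\<close>.\<close>

definition com_mod :: "('k, 'm) ring_scheme \<Rightarrow> 'k sigma_mod" where
  "com_mod K = \<lparr>obj = (\<lambda>r. if r = 0 then zero_mod K else ground_mod K), act = (\<lambda>r w x. x)\<rparr>"

definition com_operad :: "('k, 'm) ring_scheme \<Rightarrow> 'k operad" where
  "com_operad K = \<lparr>und = com_mod K,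
     op_mult = (\<lambda>n. comp_lift K (com_mod K) (com_mod K) n (obj (com_mod K) n)
       (\<lambda>x ys. Scal (foldr (\<lambda>(J, y) b. unscal y \<otimes>\<^bsub>K\<^esub> b) ys (unscal x)))),
     op_unit = (\<lambda>n x. x),
     op_aug = (\<lambda>n x. if n = 1 then x else Scal \<zero>\<^bsub>K\<^esub>)\<rparr>"

text \<open>\<open>P\<^bsup>\<circ>d\<^esup> = P \<circ> (P \<circ> (\<dots> \<circ> (P \<circ> I)))\<close>\<close>

primrec comp_power :: "('k, 'm) ring_scheme \<Rightarrow> 'k operad \<Rightarrow> nat \<Rightarrow> 'k sigma_mod" where
  "comp_power K P 0 = unit_mod K"
| "comp_power K P (Suc d) = comp K (und P) (comp_power K P d)"

text \<open>\<open>P \<circ> X \<rightarrow> I \<circ> X \<cong> X\<close> and \<open>X \<cong> I \<circ> X \<rightarrow> P \<circ> X\<close>.\<close>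

definition aug_first ::
  "('k, 'm) ring_scheme \<Rightarrow> 'k operad \<Rightarrow> 'k sigma_mod \<Rightarrow> nat \<Rightarrow> 'k elt \<Rightarrow> 'k elt" where
  "aug_first K P X n =
     left_unitor K X n \<circ> comp_map K (und P) X (unit_mod K) X (op_aug P) (\<lambda>_ y. y) n"

definition unit_first ::
  "('k, 'm) ring_scheme \<Rightarrow> 'k operad \<Rightarrow> 'k sigma_mod \<Rightarrow> nat \<Rightarrow> 'k elt \<Rightarrow> 'k elt" where
  "unit_first K P X n =
     comp_map K (unit_mod K) X (und P) X (op_unit P) (\<lambda>_ y. y) n \<circ> left_unitor_inv K X n"

text \<open>\<open>intervals k [m\<^sub>1, m\<^sub>2, \<dots>]\<close> are consecutive intervals of lengths \<open>m\<^sub>1, m\<^sub>2, \<dots>\<close>, the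
  first one starting at \<open>k + 1\<close>.\<close>

primrec intervals :: "nat \<Rightarrow> nat list \<Rightarrow> nat set list" where
  "intervals k [] = []"
| "intervals k (m # ms) = {k + 1..k + m} # intervals (k + m) ms"

text \<open>The product of the first two factors, \<open>P \<circ> (P \<circ> X) \<cong> (P \<circ> P) \<circ> X \<rightarrow> P \<circ> X\<close>. A list
  \<open>zs\<close> with entries \<open>(J\<^sub>i, p\<^sub>i, qs\<^sub>i)\<close> encodes the elements \<open>y\<^sub>i = p\<^sub>i \<otimes> qs\<^sub>i\<close> of \<open>(P \<circ> X)(J\<^sub>i)\<close>. The
  associativity isomorphism sends \<open>x \<otimes> (y\<^sub>i)\<^sub>i\<close> to \<open>(x \<otimes> (p\<^sub>i)\<^sub>i) \<otimes> (qs\<^sub>1 qs\<^sub>2 \<dots>)\<close>, where the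
  inputs of \<open>p\<^sub>1\<close>, \<open>p\<^sub>2\<close>, \<dots> are numbered consecutively and the index sets of \<open>qs\<^sub>i\<close>, which are
  subsets of \<open>{1..card J\<^sub>i}\<close>, are transported to \<open>J\<^sub>i\<close>. Such elements span
  \<open>(P \<circ> (P \<circ> X))(n)\<close>.\<close>

definition mult_first ::
  "('k, 'm) ring_scheme \<Rightarrow> 'k operad \<Rightarrow> 'k sigma_mod \<Rightarrow> nat \<Rightarrow> 'k elt \<Rightarrow> 'k elt" where
  "mult_first K P X n = (SOME f.
     f \<in> lin_maps K (comp_obj K (und P) (comp K (und P) X) n) (comp_obj K (und P) X n) \<and>
     (\<forall>x zs. x \<in> carrier (obj (und P) (length zs)) \<and> decomp n (map fst zs) \<and>
        (\<forall>(J, p, qs)\<in>set zs. (p, qs) \<in> tensors (und P) X (card J)) \<longrightarrow>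
        (let ms = map (\<lambda>(J, p, qs). length qs) zs; s = sum_list ms in
         f (pure K (und P) (comp K (und P) X) n x
              (map (\<lambda>(J, p, qs). (J, pure K (und P) X (card J) p qs)) zs)) =
         pure K (und P) X n
           (op_mult P s (pure K (und P) (und P) s x
              (zip (intervals 0 ms) (map (\<lambda>(J, p, qs). p) zs))))
           (concat (map (\<lambda>(J, p, qs). map (\<lambda>(L, q). (emb J ` L, q)) qs) zs)))))"

text \<open>Faces and degeneracies in dimension \<open>d\<close>. A face that does not concern the first
  factor is \<open>P \<circ> (-)\<close> of a face of the remaining factors; so the last face is
  \<open>P \<circ> I \<rightarrow> I \<circ> I \<cong> I\<close> in the innermost position.\<close>

fun bar_face ::
  "('k, 'm) ring_scheme \<Rightarrow> 'k operad \<Rightarrow> nat \<Rightarrow> nat \<Rightarrow> nat \<Rightarrow> 'k elt \<Rightarrow> 'k elt" where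
  "bar_face K P 0 i = undefined"
| "bar_face K P (Suc d) 0 = aug_first K P (comp_power K P d)"
| "bar_face K P (Suc 0) (Suc i) = aug_first K P (unit_mod K)"
| "bar_face K P (Suc (Suc d)) (Suc 0) = mult_first K P (comp_power K P d)"
| "bar_face K P (Suc (Suc d)) (Suc (Suc i)) =
     comp_map K (und P) (comp_power K P (Suc d)) (und P) (comp_power K P d)
       (\<lambda>_ x. x) (bar_face K P (Suc d) (Suc i))"

fun bar_degen ::
  "('k, 'm) ring_scheme \<Rightarrow> 'k operad \<Rightarrow> nat \<Rightarrow> nat \<Rightarrow> nat \<Rightarrow> 'k elt \<Rightarrow> 'k elt" where
  "bar_degen K P d 0 = unit_first K P (comp_power K P d)"
| "bar_degen K P 0 (Suc j) = undefined"
| "bar_degen K P (Suc d) (Suc j) =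
     comp_map K (und P) (comp_power K P d) (und P) (comp_power K P (Suc d))
       (\<lambda>_ x. x) (bar_degen K P d j)"


section \<open>Simplicial modules and normalized chain complexes\<close>

text \<open>Simplicial modules and chain complexes carry an action of permutations;
  \<open>sface A n i\<close> and \<open>sdegen A n j\<close> are defined on dimension \<open>n\<close>, and \<open>cdiff C n\<close> maps degree
  \<open>n\<close> to degree \<open>n - 1\<close> for \<open>n \<ge> 1\<close>.\<close>

record ('k, 'a) simp_mod =
  smod :: "nat \<Rightarrow> ('k, 'a) module"
  sface :: "nat \<Rightarrow> nat \<Rightarrow> 'a \<Rightarrow> 'a"
  sdegen :: "nat \<Rightarrow> nat \<Rightarrow> 'a \<Rightarrow> 'a"
  sact :: "nat \<Rightarrow> (nat \<Rightarrow> nat) \<Rightarrow> 'a \<Rightarrow> 'a"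

record ('k, 'a) chain_cpx =
  cmod :: "nat \<Rightarrow> ('k, 'a) module"
  cdiff :: "nat \<Rightarrow> 'a \<Rightarrow> 'a"
  cact :: "nat \<Rightarrow> (nat \<Rightarrow> nat) \<Rightarrow> 'a \<Rightarrow> 'a"

definition alt_sum :: "('k, 'a) simp_mod \<Rightarrow> nat \<Rightarrow> 'a \<Rightarrow> 'a" where
  "alt_sum A n x = (\<Oplus>\<^bsub>smod A (n - 1)\<^esub>i\<in>{0..n}.
     if even i then sface A n i x else \<ominus>\<^bsub>smod A (n - 1)\<^esub> sface A n i x)"

text \<open>The submodule of dimension \<open>n\<close> generated by the degenerate elements.\<close>

definition degenerate :: "('k, 'm) ring_scheme \<Rightarrow> ('k, 'a) simp_mod \<Rightarrow> nat \<Rightarrow> 'a set" where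
  "degenerate K A n = \<Inter>{H. submodule H K (smod A n) \<and>
     (\<forall>m j x. n = Suc m \<and> j \<le> m \<and> x \<in> carrier (smod A m) \<longrightarrow> sdegen A m j x \<in> H)}"

definition normalized ::
  "('k, 'm) ring_scheme \<Rightarrow> ('k, 'a) simp_mod \<Rightarrow> ('k, 'a set) chain_cpx" where
  "normalized K A = \<lparr>cmod = (\<lambda>n. quot_mod (smod A n) (degenerate K A n)),
     cdiff = (\<lambda>n. quot_map (smod A (n - 1)) (degenerate K A (n - 1)) (alt_sum A n)),
     cact = (\<lambda>n w. quot_map (smod A n) (degenerate K A n) (sact A n w))\<rparr>"

text \<open>Isomorphism of chain complexes of \<open>K[\<Sigma>\<^sub>r]\<close>-modules.\<close>

definition chain_cpx_iso ::
  "('k, 'm) ring_scheme \<Rightarrow> nat \<Rightarrow> ('k, 'a) chain_cpx \<Rightarrow> ('k, 'b) chain_cpx \<Rightarrow> bool" where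
  "chain_cpx_iso K r C D \<longleftrightarrow> (\<exists>\<phi>. \<forall>n. \<phi> n \<in> lin_isos K (cmod C n) (cmod D n) \<and>
     (\<forall>x\<in>carrier (cmod C (Suc n)). \<phi> n (cdiff C (Suc n) x) = cdiff D (Suc n) (\<phi> (Suc n) x)) \<and>
     (\<forall>w x. w permutes {1..r} \<and> x \<in> carrier (cmod C n) \<longrightarrow> \<phi> n (cact C n w x) = cact D n w (\<phi> n x)))"

definition bar :: "('k, 'm) ring_scheme \<Rightarrow> 'k operad \<Rightarrow> nat \<Rightarrow> ('k, 'k elt) simp_mod" where
  "bar K P r = \<lparr>smod = (\<lambda>d. obj (comp_power K P d) r),
     sface = (\<lambda>d i. bar_face K P d i r),
     sdegen = (\<lambda>d j. bar_degen K P d j r),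
     sact = (\<lambda>d. act (comp_power K P d) r)\<rparr>"


section \<open>Pointed simplicial sets and the partition poset\<close>

record 'x pointed_sset =
  simplices :: "nat \<Rightarrow> 'x set"
  base :: "nat \<Rightarrow> 'x"
  face :: "nat \<Rightarrow> nat \<Rightarrow> 'x \<Rightarrow> 'x"
  degen :: "nat \<Rightarrow> nat \<Rightarrow> 'x \<Rightarrow> 'x"
  pact :: "nat \<Rightarrow> (nat \<Rightarrow> nat) \<Rightarrow> 'x \<Rightarrow> 'x"

text \<open>\<open>K[X] / K[*]\<close>, realized as the finitely supported functions on the simplices other than
  the base point; \<open>push\<close> is the linear map induced by a pointed map \<open>h\<close>.\<close>

definition reduced_mod ::
  "('k, 'm) ring_scheme \<Rightarrow> 'x pointed_sset \<Rightarrow> nat \<Rightarrow> ('k, 'x \<Rightarrow> 'k) module" where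
  "reduced_mod K X n = \<lparr>carrier = {f. (\<forall>x. f x \<in> carrier K) \<and> finite {x. f x \<noteq> \<zero>\<^bsub>K\<^esub>} \<and>
       (\<forall>x. x \<notin> simplices X n \<or> x = base X n \<longrightarrow> f x = \<zero>\<^bsub>K\<^esub>)},
     monoid.mult = undefined, one = undefined,
     zero = (\<lambda>x. \<zero>\<^bsub>K\<^esub>), add = (\<lambda>f g x. f x \<oplus>\<^bsub>K\<^esub> g x), smult = (\<lambda>a f x. a \<otimes>\<^bsub>K\<^esub> f x)\<rparr>"

definition push ::
  "('k, 'm) ring_scheme \<Rightarrow> 'x \<Rightarrow> ('x \<Rightarrow> 'x) \<Rightarrow> ('x \<Rightarrow> 'k) \<Rightarrow> 'x \<Rightarrow> 'k" where
  "push K b h f y = (if y = b then \<zero>\<^bsub>K\<^esub> else \<Oplus>\<^bsub>K\<^esub>x\<in>{x. f x \<noteq> \<zero>\<^bsub>K\<^esub> \<and> h x = y}. f x)"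

definition reduced_chains ::
  "('k, 'm) ring_scheme \<Rightarrow> 'x pointed_sset \<Rightarrow> ('k, 'x \<Rightarrow> 'k) simp_mod" where
  "reduced_chains K X = \<lparr>smod = reduced_mod K X,
     sface = (\<lambda>n i. push K (base X (n - 1)) (face X n i)),
     sdegen = (\<lambda>n j. push K (base X (Suc n)) (degen X n j)),
     sact = (\<lambda>n w. push K (base X n) (pact X n w))\<rparr>"

text \<open>The chains \<open>\<lambda>\<^sub>0 \<le> \<dots> \<le> \<lambda>\<^sub>n\<close>, where \<open>\<lambda> \<le> \<mu>\<close> means \<open>refines {1..r} \<mu> \<lambda>\<close>.\<close>

definition partition_chains :: "nat \<Rightarrow> nat \<Rightarrow> nat set set list set" where
  "partition_chains r n = {ls. length ls = Suc n \<and> (\<forall>l\<in>set ls. partition_on {1..r} l) \<and>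
     (\<forall>i<n. refines {1..r} (ls ! Suc i) (ls ! i)) \<and>
     ls ! 0 = {{1..r}} \<and> ls ! n = (\<lambda>i. {i}) ` {1..r}}"

text \<open>The base point is \<open>None\<close>.\<close>

definition partition_sset :: "nat \<Rightarrow> nat set set list option pointed_sset" where
  "partition_sset r = \<lparr>
     simplices = (\<lambda>n. insert None (Some ` partition_chains r n)),
     base = (\<lambda>n. None),
     face = (\<lambda>n i c. case c of None \<Rightarrow> None | Some ls \<Rightarrow>
       (let ls' = take i ls @ drop (Suc i) ls in
        if ls' \<in> partition_chains r (n - 1) then Some ls' else None)),
     degen = (\<lambda>n j. map_option (\<lambda>ls. take (Suc j) ls @ drop j ls)),
     pact = (\<lambda>n w. map_option (map (\<lambda>l. (\<lambda>B. w ` B) ` l)))\<rparr>"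

end

theory Submission
  imports Defs
begin

text \<open>For a symmetric sequence \<open>X\<close> whose components have bases indexed by the chains of partitions of
  length \<open>d\<close>, the composite \<open>\<C> \<circ> X\<close> has a basis indexed by the chains of length \<open>d + 1\<close>: a chain
  \<open>\<lambda>\<^sub>0 \<le> \<lambda>\<^sub>1 \<le> \<dots>\<close> amounts to the partition \<open>\<lambda>\<^sub>1\<close> together with a chain on each block \<open>J\<close> of \<open>\<lambda>\<^sub>1\<close>,
  namely the restriction of \<open>\<lambda>\<^sub>1 \<le> \<lambda>\<^sub>2 \<le> \<dots>\<close> to \<open>J\<close>, and the corresponding basis element is
  \<open>1 \<otimes> \<Otimes>\<^sub>J e\<^sub>J\<close>. Iterating gives a basis of \<open>\<C>\<^bsup>\<circ>d\<^esup>\<close>, and restriction to blocks commutes with the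
  simplicial operations and with permutations. Hence every structure map of the bar
  construction sends a basis element to the basis element of the face, degeneracy or translate
  of its chain, or to zero if that is the base point. So the simplicial modules are already
  isomorphic, and so are their normalized complexes.\<close>

section \<open>Linear maps and bases\<close>

text \<open>Two features of the definitions shape the argument. Elements of a composite are classes
  under an inductively generated relation, and they are told apart here by linear maps that respect
  all its rules. Independence is therefore expressed by dual functionals; for a composite these are
  products, over the blocks, of the functionals of the right-hand factor. Moreover, the structure
  maps are choices of a linear map with prescribed values, so nothing is known about them until such
  a map is exhibited. For maps prescribed on pure tensors this is the universal property of the
  composite. The product of the first two factors is prescribed on an overdetermined family of
  two-level tensors; there the map is defined on a basis, and multilinearity gives the other values.
  The vanishing in arity 0 enters twice: on the left it kills tensors without factors, and on the
  right it appears as the absence of chains on the empty set, which removes the decompositions with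
  empty members, the ones that are not partitions.\<close>

lemma lin_mapsI:
  assumes "\<And>x. x \<in> carrier A \<Longrightarrow> f x \<in> carrier B"
    and "\<And>x y. x \<in> carrier A \<Longrightarrow> y \<in> carrier A \<Longrightarrow> f (x \<oplus>\<^bsub>A\<^esub> y) = f x \<oplus>\<^bsub>B\<^esub> f y"
    and "\<And>a x. a \<in> carrier K \<Longrightarrow> x \<in> carrier A \<Longrightarrow> f (a \<odot>\<^bsub>A\<^esub> x) = a \<odot>\<^bsub>B\<^esub> f x"
  shows "f \<in> lin_maps K A B"
  using assms by (auto simp: lin_maps_def)

lemma lin_mapsD:
  assumes "f \<in> lin_maps K A B"
  shows "x \<in> carrier A \<Longrightarrow> f x \<in> carrier B"
    and "x \<in> carrier A \<Longrightarrow> y \<in> carrier A \<Longrightarrow> f (x \<oplus>\<^bsub>A\<^esub> y) = f x \<oplus>\<^bsub>B\<^esub> f y"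
    and "a \<in> carrier K \<Longrightarrow> x \<in> carrier A \<Longrightarrow> f (a \<odot>\<^bsub>A\<^esub> x) = a \<odot>\<^bsub>B\<^esub> f x"
  using assms by (auto simp: lin_maps_def)

lemma lin_maps_comp:
  assumes "f \<in> lin_maps K A B" "g \<in> lin_maps K B C"
  shows "g \<circ> f \<in> lin_maps K A C"
  using assms by (auto simp: lin_maps_def)

lemma lin_maps_id: "(\<lambda>x. x) \<in> lin_maps K A A"
  by (auto simp: lin_maps_def)

lemma lin_maps_zero:
  assumes "module K A" "module K B" "f \<in> lin_maps K A B"
  shows "f \<zero>\<^bsub>A\<^esub> = \<zero>\<^bsub>B\<^esub>"
proof -
  interpret A: module K A by fact
  interpret B: module K B by fact
  have "f \<zero>\<^bsub>A\<^esub> = f (\<zero>\<^bsub>K\<^esub> \<odot>\<^bsub>A\<^esub> \<zero>\<^bsub>A\<^esub>)" by simp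
  also have "\<dots> = \<zero>\<^bsub>K\<^esub> \<odot>\<^bsub>B\<^esub> f \<zero>\<^bsub>A\<^esub>"
    by (rule lin_mapsD(3)[OF assms(3)]) auto
  finally show ?thesis using lin_mapsD(1)[OF assms(3), of "\<zero>\<^bsub>A\<^esub>"] by simp
qed

lemma lin_maps_minus:
  assumes "module K A" "module K B" "f \<in> lin_maps K A B" "x \<in> carrier A"
  shows "f (\<ominus>\<^bsub>A\<^esub> x) = \<ominus>\<^bsub>B\<^esub> f x"
proof -
  interpret A: module K A by fact
  interpret B: module K B by fact
  have "\<ominus>\<^bsub>A\<^esub> x = (\<ominus>\<^bsub>K\<^esub> \<one>\<^bsub>K\<^esub>) \<odot>\<^bsub>A\<^esub> x"
    using assms by (simp add: A.smult_l_minus)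
  also have "f \<dots> = (\<ominus>\<^bsub>K\<^esub> \<one>\<^bsub>K\<^esub>) \<odot>\<^bsub>B\<^esub> f x"
    by (rule lin_mapsD(3)[OF assms(3)]) (use assms in auto)
  also have "\<dots> = \<ominus>\<^bsub>B\<^esub> f x"
    using assms lin_mapsD(1)[OF assms(3,4)] by (simp add: B.smult_l_minus)
  finally show ?thesis .
qed

lemma lin_maps_finsum:
  assumes "module K A" "module K B" "f \<in> lin_maps K A B" "finite I" "g \<in> I \<rightarrow> carrier A"
  shows "f (finsum A g I) = finsum B (f \<circ> g) I"
proof -
  interpret A: module K A by fact
  interpret B: module K B by fact
  show ?thesis using assms(4,5)
  proof (induction I rule: finite_induct)
    case empty
    show ?case by (simp add: lin_maps_zero[OF assms(1-3)])
  next
    case (insert i I)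
    then have g: "g i \<in> carrier A" "g \<in> I \<rightarrow> carrier A" by auto
    then have "f \<circ> g \<in> I \<rightarrow> carrier B" "f (g i) \<in> carrier B"
      by (auto intro!: lin_mapsD(1)[OF assms(3)])
    then have "finsum B (f \<circ> g) (insert i I) = (f \<circ> g) i \<oplus>\<^bsub>B\<^esub> finsum B (f \<circ> g) I"
      using insert by (intro B.finsum_insert) auto
    then show ?case
      using insert g by (simp add: A.finsum_insert lin_mapsD(2)[OF assms(3)] del: o_apply) simp
  qed
qed

section \<open>The ground module and the zero module\<close>

lemma ground_mod_simps [simp]:
  "carrier (ground_mod K) = Scal ` carrier K"
  "\<zero>\<^bsub>ground_mod K\<^esub> = Scal \<zero>\<^bsub>K\<^esub>"
  "x \<oplus>\<^bsub>ground_mod K\<^esub> y = Scal (unscal x \<oplus>\<^bsub>K\<^esub> unscal y)"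
  "a \<odot>\<^bsub>ground_mod K\<^esub> x = Scal (a \<otimes>\<^bsub>K\<^esub> unscal x)"
  by (simp_all add: ground_mod_def)

lemma zero_mod_simps [simp]:
  "carrier (zero_mod K) = {Scal \<zero>\<^bsub>K\<^esub>}"
  "\<zero>\<^bsub>zero_mod K\<^esub> = Scal \<zero>\<^bsub>K\<^esub>"
  "x \<oplus>\<^bsub>zero_mod K\<^esub> y = Scal \<zero>\<^bsub>K\<^esub>"
  "a \<odot>\<^bsub>zero_mod K\<^esub> x = Scal \<zero>\<^bsub>K\<^esub>"
  by (simp_all add: zero_mod_def)

lemma ground_mod_module:
  assumes "cring K" shows "module K (ground_mod K)"
proof -
  interpret cring K by fact
  have "\<exists>y\<in>carrier (ground_mod K). y \<oplus>\<^bsub>ground_mod K\<^esub> x = \<zero>\<^bsub>ground_mod K\<^esub>"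
    if "x \<in> carrier (ground_mod K)" for x
    using that by (intro bexI[of _ "Scal (\<ominus>\<^bsub>K\<^esub> unscal x)"]) (auto simp: l_neg)
  then have "abelian_group (ground_mod K)"
    by (intro abelian_groupI) (auto simp: a_ac)
  then show ?thesis
    by (intro moduleI) (use assms in \<open>auto simp: l_distr r_distr m_assoc\<close>)
qed

lemma zero_mod_module:
  assumes "cring K" shows "module K (zero_mod K)"
proof -
  interpret cring K by fact
  have "abelian_group (zero_mod K)"
    by (intro abelian_groupI) auto
  then show ?thesis
    by (intro moduleI) (use assms in auto)
qed

text \<open>Spanning is stated through submodules, which yields an induction principle, and
  independence through coordinate functionals, which the universal property of a composite can
  produce. Over the zero ring \<open>e\<close> may repeat elements, because there one equals
  zero.\<close>

definition free_basis ::
  "('k, 'm) ring_scheme \<Rightarrow> ('k, 'a) module \<Rightarrow> 'b set \<Rightarrow> ('b \<Rightarrow> 'a) \<Rightarrow> bool" where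
  "free_basis K A B e \<longleftrightarrow> finite B \<and> e ` B \<subseteq> carrier A \<and>
     (\<forall>H. submodule H K A \<and> e ` B \<subseteq> H \<longrightarrow> carrier A \<subseteq> H) \<and>
     (\<forall>b\<in>B. \<exists>\<theta>\<in>lin_maps K A (ground_mod K).
        \<forall>b'\<in>B. \<theta> (e b') = Scal (if b' = b then \<one>\<^bsub>K\<^esub> else \<zero>\<^bsub>K\<^esub>))"

text \<open>Closure under negatives comes from scaling by -1, so inductions have only zero, sums and
  multiples to treat.\<close>

lemma submodule_Collect:
  assumes "module K A" "P \<zero>\<^bsub>A\<^esub>"
    and "\<And>x y. x \<in> carrier A \<Longrightarrow> y \<in> carrier A \<Longrightarrow> P x \<Longrightarrow> P y \<Longrightarrow> P (x \<oplus>\<^bsub>A\<^esub> y)"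
    and "\<And>a x. a \<in> carrier K \<Longrightarrow> x \<in> carrier A \<Longrightarrow> P x \<Longrightarrow> P (a \<odot>\<^bsub>A\<^esub> x)"
  shows "submodule {x \<in> carrier A. P x} K A"
proof -
  interpret A: module K A by fact
  have "P (\<ominus>\<^bsub>A\<^esub> x)" if "x \<in> carrier A" "P x" for x
    using assms(4)[of "\<ominus>\<^bsub>K\<^esub> \<one>\<^bsub>K\<^esub>" x] that by (simp add: A.smult_l_minus)
  then show ?thesis
    by (intro A.submoduleI) (use assms in auto)
qed

lemma free_basis_induct:
  assumes "module K A" "free_basis K A B e" "x \<in> carrier A" "P \<zero>\<^bsub>A\<^esub>"
    and "\<And>x y. x \<in> carrier A \<Longrightarrow> y \<in> carrier A \<Longrightarrow> P x \<Longrightarrow> P y \<Longrightarrow> P (x \<oplus>\<^bsub>A\<^esub> y)"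
    and "\<And>a x. a \<in> carrier K \<Longrightarrow> x \<in> carrier A \<Longrightarrow> P x \<Longrightarrow> P (a \<odot>\<^bsub>A\<^esub> x)"
    and "\<And>b. b \<in> B \<Longrightarrow> P (e b)"
  shows "P x"
proof -
  have "submodule {x \<in> carrier A. P x} K A"
    by (rule submodule_Collect) (use assms in auto)
  moreover have "e ` B \<subseteq> {x \<in> carrier A. P x}"
    using assms by (auto simp: free_basis_def)
  ultimately have "carrier A \<subseteq> {x \<in> carrier A. P x}"
    using assms(2) unfolding free_basis_def by blast
  then show ?thesis using assms(3) by blast
qed

lemma free_basis_ext:
  assumes "module K A" "module K A'" "free_basis K A B e"
    and f: "f \<in> lin_maps K A A'" and g: "g \<in> lin_maps K A A'"
    and "\<And>b. b \<in> B \<Longrightarrow> f (e b) = g (e b)" and "x \<in> carrier A"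
  shows "f x = g x"
  by (rule free_basis_induct[OF assms(1,3,7), where P = "\<lambda>x. f x = g x"])
    (use assms(6) lin_maps_zero[OF assms(1,2) f] lin_maps_zero[OF assms(1,2) g]
      lin_mapsD[OF f] lin_mapsD[OF g] in auto)

text \<open>For a basis the choice is unique on \<open>carrier A\<close>, since a linear map is
  determined by its values on a spanning family.\<close>

definition dual_coord ::
  "('k, 'm) ring_scheme \<Rightarrow> ('k, 'a) module \<Rightarrow> 'b set \<Rightarrow> ('b \<Rightarrow> 'a) \<Rightarrow> 'b \<Rightarrow> 'a \<Rightarrow> 'k elt" where
  "dual_coord K A B e b = (SOME \<theta>. \<theta> \<in> lin_maps K A (ground_mod K) \<and>
        (\<forall>b'\<in>B. \<theta> (e b') = Scal (if b' = b then \<one>\<^bsub>K\<^esub> else \<zero>\<^bsub>K\<^esub>)))"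

lemma dual_coord:
  assumes "free_basis K A B e" "b \<in> B"
  shows "dual_coord K A B e b \<in> lin_maps K A (ground_mod K)"
    and "b' \<in> B \<Longrightarrow> dual_coord K A B e b (e b') = Scal (if b' = b then \<one>\<^bsub>K\<^esub> else \<zero>\<^bsub>K\<^esub>)"
proof -
  have "\<exists>\<theta>. \<theta> \<in> lin_maps K A (ground_mod K) \<and>
        (\<forall>b'\<in>B. \<theta> (e b') = Scal (if b' = b then \<one>\<^bsub>K\<^esub> else \<zero>\<^bsub>K\<^esub>))"
    using assms unfolding free_basis_def by blast
  from someI_ex[OF this, folded dual_coord_def]
  show "dual_coord K A B e b \<in> lin_maps K A (ground_mod K)"
    and "b' \<in> B \<Longrightarrow> dual_coord K A B e b (e b') = Scal (if b' = b then \<one>\<^bsub>K\<^esub> else \<zero>\<^bsub>K\<^esub>)"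
    by blast+
qed

lemma dual_coord_linear:
  assumes "free_basis K A B e" "b \<in> B"
  shows "x \<in> carrier A \<Longrightarrow> unscal (dual_coord K A B e b x) \<in> carrier K"
    and "x \<in> carrier A \<Longrightarrow> y \<in> carrier A \<Longrightarrow> unscal (dual_coord K A B e b (x \<oplus>\<^bsub>A\<^esub> y)) =
      unscal (dual_coord K A B e b x) \<oplus>\<^bsub>K\<^esub> unscal (dual_coord K A B e b y)"
    and "a \<in> carrier K \<Longrightarrow> x \<in> carrier A \<Longrightarrow> unscal (dual_coord K A B e b (a \<odot>\<^bsub>A\<^esub> x)) =
      a \<otimes>\<^bsub>K\<^esub> unscal (dual_coord K A B e b x)"
  using lin_mapsD[OF dual_coord(1)[OF assms]] by (force, auto)

text \<open>The image of \<open>x\<close> is the sum of the \<open>h b\<close> weighted by the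
  coordinates of \<open>x\<close>; finiteness of the basis makes this sum available.\<close>

lemma free_basis_lift:
  assumes "module K A" "module K A'" "free_basis K A B e" "\<And>b. b \<in> B \<Longrightarrow> h b \<in> carrier A'"
  shows "\<exists>f\<in>lin_maps K A A'. \<forall>b\<in>B. f (e b) = h b"
proof -
  interpret A: module K A by fact
  interpret A': module K A' by fact
  define \<theta> where "\<theta> b x = unscal (dual_coord K A B e b x)" for b x
  note lin = dual_coord_linear[OF assms(3), folded \<theta>_def]
  have fin: "finite B" and e: "\<And>b. b \<in> B \<Longrightarrow> e b \<in> carrier A"
    using assms(3) by (auto simp: free_basis_def)
  define f where "f x = finsum A' (\<lambda>b. \<theta> b x \<odot>\<^bsub>A'\<^esub> h b) B" for x
  have cl: "(\<lambda>b. \<theta> b x \<odot>\<^bsub>A'\<^esub> h b) \<in> B \<rightarrow> carrier A'" if "x \<in> carrier A" for x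
    using that assms(4) lin(1) by auto
  have "f \<in> lin_maps K A A'"
  proof (rule lin_mapsI)
    fix x assume x: "x \<in> carrier A"
    then show "f x \<in> carrier A'"
      unfolding f_def using cl by (intro A'.finsum_closed) auto
  next
    fix x y assume xy: "x \<in> carrier A" "y \<in> carrier A"
    have "f (x \<oplus>\<^bsub>A\<^esub> y) = finsum A' (\<lambda>b. \<theta> b x \<odot>\<^bsub>A'\<^esub> h b \<oplus>\<^bsub>A'\<^esub> \<theta> b y \<odot>\<^bsub>A'\<^esub> h b) B"
      unfolding f_def using xy assms(4) lin(1)
      by (intro A'.M.finsum_cong') (auto simp: lin(2) A'.smult_l_distr)
    also have "\<dots> = f x \<oplus>\<^bsub>A'\<^esub> f y"
      unfolding f_def using xy cl by (intro A'.finsum_addf) auto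
    finally show "f (x \<oplus>\<^bsub>A\<^esub> y) = f x \<oplus>\<^bsub>A'\<^esub> f y" .
  next
    fix a x assume ax: "a \<in> carrier K" "x \<in> carrier A"
    have "f (a \<odot>\<^bsub>A\<^esub> x) = finsum A' (\<lambda>b. a \<odot>\<^bsub>A'\<^esub> (\<theta> b x \<odot>\<^bsub>A'\<^esub> h b)) B"
      unfolding f_def using ax assms(4) lin(1)
      by (intro A'.M.finsum_cong') (auto simp: lin(3) A'.smult_assoc1)
    also have "\<dots> = a \<odot>\<^bsub>A'\<^esub> f x"
      unfolding f_def using ax cl fin by (simp add: A'.finsum_smult_ldistr)
    finally show "f (a \<odot>\<^bsub>A\<^esub> x) = a \<odot>\<^bsub>A'\<^esub> f x" .
  qed
  moreover have "f (e b) = h b" if b: "b \<in> B" for b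
  proof -
    \<comment> \<open>The coordinates of \<open>e b\<close> form a delta function, so a single
      summand survives.\<close>
    have "f (e b) = finsum A' (\<lambda>b'. if b = b' then h b' else \<zero>\<^bsub>A'\<^esub>) B"
      unfolding f_def using b assms(4)
      by (intro A'.M.finsum_cong') (auto simp: \<theta>_def dual_coord(2)[OF assms(3)])
    also have "\<dots> = h b"
      by (rule A'.finsum_singleton) (use b fin assms(4) in auto)
    finally show ?thesis .
  qed
  ultimately show ?thesis by blast
qed

text \<open>Both sides are linear in \<open>x\<close> and agree on the basis vectors, which
  generate.\<close>

lemma free_basis_expand:
  assumes "module K A" "free_basis K A B e" "x \<in> carrier A"
  shows "x = finsum A (\<lambda>b. unscal (dual_coord K A B e b x) \<odot>\<^bsub>A\<^esub> e b) B"
proof -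
  interpret A: module K A by fact
  define \<theta> where "\<theta> b x = unscal (dual_coord K A B e b x)" for b x
  note lin = dual_coord_linear[OF assms(2), folded \<theta>_def]
  have fin: "finite B" and e: "\<And>b. b \<in> B \<Longrightarrow> e b \<in> carrier A"
    using assms(2) by (auto simp: free_basis_def)
  define f where "f x = finsum A (\<lambda>b. \<theta> b x \<odot>\<^bsub>A\<^esub> e b) B" for x
  have cl: "(\<lambda>b. \<theta> b x \<odot>\<^bsub>A\<^esub> e b) \<in> B \<rightarrow> carrier A" if "x \<in> carrier A" for x
    using that e lin(1) by auto
  have "x = f x"
  proof (rule free_basis_induct[OF assms, where P = "\<lambda>x. x = f x"])
    have "\<theta> b \<zero>\<^bsub>A\<^esub> = \<zero>\<^bsub>K\<^esub>" if "b \<in> B" for b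
      using lin(3)[OF that, of "\<zero>\<^bsub>K\<^esub>" "\<zero>\<^bsub>A\<^esub>"] lin(1)[OF that, of "\<zero>\<^bsub>A\<^esub>"] by simp
    then show "\<zero>\<^bsub>A\<^esub> = f \<zero>\<^bsub>A\<^esub>"
      unfolding f_def using e by (simp add: A.M.add.finprod_one_eqI)
  next
    fix x y assume xy: "x \<in> carrier A" "y \<in> carrier A" and eq: "x = f x" "y = f y"
    have "f (x \<oplus>\<^bsub>A\<^esub> y) = finsum A (\<lambda>b. \<theta> b x \<odot>\<^bsub>A\<^esub> e b \<oplus>\<^bsub>A\<^esub> \<theta> b y \<odot>\<^bsub>A\<^esub> e b) B"
      unfolding f_def using xy e lin(1)
      by (intro A.M.finsum_cong') (auto simp: lin(2) A.smult_l_distr)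
    also have "\<dots> = f x \<oplus>\<^bsub>A\<^esub> f y"
      unfolding f_def using xy cl by (intro A.finsum_addf) auto
    finally show "x \<oplus>\<^bsub>A\<^esub> y = f (x \<oplus>\<^bsub>A\<^esub> y)" using eq by simp
  next
    fix a x assume ax: "a \<in> carrier K" "x \<in> carrier A" and eq: "x = f x"
    have "f (a \<odot>\<^bsub>A\<^esub> x) = finsum A (\<lambda>b. a \<odot>\<^bsub>A\<^esub> (\<theta> b x \<odot>\<^bsub>A\<^esub> e b)) B"
      unfolding f_def using ax e lin(1)
      by (intro A.M.finsum_cong') (auto simp: lin(3) A.smult_assoc1)
    also have "\<dots> = a \<odot>\<^bsub>A\<^esub> f x"
      unfolding f_def using ax cl fin by (simp add: A.finsum_smult_ldistr)
    finally show "a \<odot>\<^bsub>A\<^esub> x = f (a \<odot>\<^bsub>A\<^esub> x)" using eq by simp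
  next
    fix b assume b: "b \<in> B"
    have "f (e b) = finsum A (\<lambda>b'. if b = b' then e b' else \<zero>\<^bsub>A\<^esub>) B"
      unfolding f_def using b e
      by (intro A.M.finsum_cong') (auto simp: \<theta>_def dual_coord(2)[OF assms(2)])
    also have "\<dots> = e b"
      by (rule A.finsum_singleton) (use b fin e in auto)
    finally show "e b = f (e b)" by simp
  qed
  then show ?thesis by (simp add: f_def \<theta>_def)
qed

section \<open>Free modules on pointed simplicial sets\<close>

text \<open>Extension by zero to \<open>None\<close> and to simplices outside \<open>B\<close> turns
  a coordinate vector into an element of the reduced chain module.\<close>

definition coord_fun ::
  "('k, 'm) ring_scheme \<Rightarrow> ('k, 'a) module \<Rightarrow> 'b set \<Rightarrow> ('b \<Rightarrow> 'a) \<Rightarrow> 'a \<Rightarrow> 'b option \<Rightarrow> 'k" where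
  "coord_fun K A B e x y = (case y of None \<Rightarrow> \<zero>\<^bsub>K\<^esub>
     | Some b \<Rightarrow> if b \<in> B then unscal (dual_coord K A B e b x) else \<zero>\<^bsub>K\<^esub>)"

lemma reduced_mod_simps [simp]:
  "carrier (reduced_mod K X n) = {f. (\<forall>x. f x \<in> carrier K) \<and> finite {x. f x \<noteq> \<zero>\<^bsub>K\<^esub>} \<and>
       (\<forall>x. x \<notin> simplices X n \<or> x = base X n \<longrightarrow> f x = \<zero>\<^bsub>K\<^esub>)}"
  "\<zero>\<^bsub>reduced_mod K X n\<^esub> = (\<lambda>x. \<zero>\<^bsub>K\<^esub>)"
  "f \<oplus>\<^bsub>reduced_mod K X n\<^esub> g = (\<lambda>x. f x \<oplus>\<^bsub>K\<^esub> g x)"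
  "a \<odot>\<^bsub>reduced_mod K X n\<^esub> f = (\<lambda>x. a \<otimes>\<^bsub>K\<^esub> f x)"
  by (simp_all add: reduced_mod_def)

lemma reduced_mod_module:
  fixes K :: "('k, 'm) ring_scheme" and X :: "'x pointed_sset"
  assumes "cring K" shows "module K (reduced_mod K X n)"
proof -
  interpret cring K by fact
  have fin: "finite {x. f x \<oplus>\<^bsub>K\<^esub> g x \<noteq> \<zero>\<^bsub>K\<^esub>}"
    if "finite {x. f x \<noteq> \<zero>\<^bsub>K\<^esub>}" "finite {x. g x \<noteq> \<zero>\<^bsub>K\<^esub>}" for f g :: "'x \<Rightarrow> 'k"
    by (rule finite_subset[OF _ finite_UnI[OF that]]) auto
  have fin': "finite {x. a \<otimes>\<^bsub>K\<^esub> f x \<noteq> \<zero>\<^bsub>K\<^esub>}"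
    if "finite {x. f x \<noteq> \<zero>\<^bsub>K\<^esub>}" "a \<in> carrier K" for f :: "'x \<Rightarrow> 'k" and a
    by (rule finite_subset[OF _ that(1)]) (use that in auto)
  have "\<exists>g\<in>carrier (reduced_mod K X n). g \<oplus>\<^bsub>reduced_mod K X n\<^esub> f = \<zero>\<^bsub>reduced_mod K X n\<^esub>"
    if "f \<in> carrier (reduced_mod K X n)" for f
  proof (intro bexI[of _ "\<lambda>x. \<ominus>\<^bsub>K\<^esub> f x"])
    have "finite {x. \<ominus>\<^bsub>K\<^esub> f x \<noteq> \<zero>\<^bsub>K\<^esub>}"
      by (rule finite_subset[of _ "{x. f x \<noteq> \<zero>\<^bsub>K\<^esub>}"]) (use that in auto)
    then show "(\<lambda>x. \<ominus>\<^bsub>K\<^esub> f x) \<in> carrier (reduced_mod K X n)" using that by auto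
  qed (use that in \<open>auto simp: l_neg\<close>)
  then have "abelian_group (reduced_mod K X n)"
    by (intro abelian_groupI) (auto simp: a_ac fin)
  then show ?thesis
    by (intro moduleI) (use assms in \<open>auto simp: l_distr r_distr m_assoc fin'\<close>)
qed

text \<open>The expansion in coordinates gives injectivity. For surjectivity, \<open>f\<close> is
  the coordinate function of the combination with coefficients \<open>f (Some b)\<close>.\<close>

lemma coord_fun_iso:
  fixes X :: "'b option pointed_sset"
  assumes "module K A" "free_basis K A B e" "simplices X n = insert None (Some ` B)" "base X n = None"
  shows "coord_fun K A B e \<in> lin_isos K A (reduced_mod K X n)"
proof -
  interpret A: module K A by fact
  note lin = dual_coord_linear[OF assms(2)]
  have fin: "finite B" and e: "\<And>b. b \<in> B \<Longrightarrow> e b \<in> carrier A"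
    using assms(2) by (auto simp: free_basis_def)
  have lm: "coord_fun K A B e \<in> lin_maps K A (reduced_mod K X n)"
  proof (rule lin_mapsI)
    fix x assume x: "x \<in> carrier A"
    have "finite {y. coord_fun K A B e x y \<noteq> \<zero>\<^bsub>K\<^esub>}"
      by (rule finite_subset[of _ "Some ` B"])
        (use fin in \<open>auto simp: coord_fun_def split: option.splits if_splits\<close>)
    then show "coord_fun K A B e x \<in> carrier (reduced_mod K X n)"
      using lin(1)[OF _ x] assms(3,4) by (auto simp: coord_fun_def split: option.splits)
  qed (auto simp: coord_fun_def fun_eq_iff lin split: option.splits)
  moreover have "inj_on (coord_fun K A B e) (carrier A)"
  proof (rule inj_onI)
    fix x y assume xy: "x \<in> carrier A" "y \<in> carrier A"
      and eq: "coord_fun K A B e x = coord_fun K A B e y"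
    have "unscal (dual_coord K A B e b x) = unscal (dual_coord K A B e b y)" if "b \<in> B" for b
      using fun_cong[OF eq, of "Some b"] that by (simp add: coord_fun_def)
    then have "finsum A (\<lambda>b. unscal (dual_coord K A B e b x) \<odot>\<^bsub>A\<^esub> e b) B
      = finsum A (\<lambda>b. unscal (dual_coord K A B e b y) \<odot>\<^bsub>A\<^esub> e b) B"
      using lin(1) e xy by (intro A.M.finsum_cong') auto
    then show "x = y"
      using free_basis_expand[OF assms(1,2)] xy by metis
  qed
  moreover have "f \<in> coord_fun K A B e ` carrier A" if f: "f \<in> carrier (reduced_mod K X n)" for f
  proof
    let ?x = "finsum A (\<lambda>b. f (Some b) \<odot>\<^bsub>A\<^esub> e b) B"
    have cl: "(\<lambda>b. f (Some b) \<odot>\<^bsub>A\<^esub> e b) \<in> B \<rightarrow> carrier A" using f e by auto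
    then show x: "?x \<in> carrier A" by (rule A.finsum_closed)
    show "f = coord_fun K A B e ?x"
    proof
      fix y
      show "f y = coord_fun K A B e ?x y"
      proof (cases "\<exists>b\<in>B. y = Some b")
        case False
        then show ?thesis using f assms(3,4) by (auto simp: coord_fun_def split: option.splits)
      next
        case True
        then obtain b where b: "b \<in> B" "y = Some b" by blast
        let ?g = "ground_mod K"
        interpret G: module K ?g by (rule ground_mod_module) (rule A.is_cring)
        have "dual_coord K A B e b ?x = finsum ?g (dual_coord K A B e b \<circ> (\<lambda>b. f (Some b) \<odot>\<^bsub>A\<^esub> e b)) B"
          by (rule lin_maps_finsum[OF assms(1) _ dual_coord(1)[OF assms(2) b(1)] fin cl])
            (rule G.module_axioms)
        also have "\<dots> = finsum ?g (\<lambda>b'. if b = b' then Scal (f (Some b')) else \<zero>\<^bsub>?g\<^esub>) B"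
          using f e b(1)
          by (intro G.M.finsum_cong')
            (auto simp: lin_mapsD(3)[OF dual_coord(1)[OF assms(2) b(1)]] dual_coord(2)[OF assms(2) b(1)])
        also have "\<dots> = Scal (f (Some b))"
          by (rule G.finsum_singleton) (use b fin f in auto)
        finally show ?thesis using b by (simp add: coord_fun_def)
      qed
    qed
  qed
  ultimately show ?thesis
    using lin_mapsD(1)[OF lm] unfolding lin_isos_def bij_betw_def by blast
qed

lemma coord_fun_basis:
  assumes "free_basis K A B e" "b \<in> B"
  shows "coord_fun K A B e (e b) = (\<lambda>y. if y = Some b then \<one>\<^bsub>K\<^esub> else \<zero>\<^bsub>K\<^esub>)"
  by (rule ext) (auto simp: coord_fun_def dual_coord(2)[OF assms(1)] assms(2) split: option.splits)

text \<open>The sum defining \<open>push\<close> ranges over the support of \<open>f\<close>, which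
  varies with \<open>f\<close>. As there are finitely many simplices, it can be taken over a whole
  fibre of \<open>h\<close> instead, where additivity is visible.\<close>

lemma push_linear:
  fixes X :: "'x pointed_sset"
  assumes "cring K" "finite (simplices X n)"
    and h: "\<And>x. x \<in> simplices X n \<Longrightarrow> x \<noteq> base X n \<Longrightarrow> h x \<in> simplices X m"
  shows "push K (base X m) h \<in> lin_maps K (reduced_mod K X n) (reduced_mod K X m)"
proof -
  interpret cring K by fact
  \<comment> \<open>The fibre leaves out the base point, where reduced chains vanish.\<close>
  let ?S = "\<lambda>y. {x \<in> simplices X n. x \<noteq> base X n \<and> h x = y}"
  have push: "push K (base X m) h f y = (if y = base X m then \<zero>\<^bsub>K\<^esub> else finsum K f (?S y))"
    if "f \<in> carrier (reduced_mod K X n)" for f y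
  proof -
    have "finsum K f (?S y) = finsum K f {x. f x \<noteq> \<zero>\<^bsub>K\<^esub> \<and> h x = y}"
      by (rule add.finprod_mono_neutral_cong_right) (use that assms(2) in auto)
    then show ?thesis by (simp add: push_def)
  qed
  have fin: "finite (?S y)" for y using assms(2) by auto
  show ?thesis
  proof (rule lin_mapsI)
    fix f assume f: "f \<in> carrier (reduced_mod K X n)"
    have S: "?S y = {}" if "y \<notin> h ` (simplices X n - {base X n})" for y
      using that by blast
    have "{y. push K (base X m) h f y \<noteq> \<zero>\<^bsub>K\<^esub>} \<subseteq> h ` (simplices X n - {base X n})"
    proof (rule ccontr)
      assume "\<not> ?thesis"
      then obtain y where ne: "push K (base X m) h f y \<noteq> \<zero>\<^bsub>K\<^esub>"
        and y: "y \<notin> h ` (simplices X n - {base X n})"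
        by blast
      have "push K (base X m) h f y = \<zero>\<^bsub>K\<^esub>"
        unfolding push[OF f] S[OF y] by simp
      then show False using ne by blast
    qed
    then have 1: "finite {y. push K (base X m) h f y \<noteq> \<zero>\<^bsub>K\<^esub>}"
      by (rule finite_subset) (use assms(2) in auto)
    have 2: "push K (base X m) h f y \<in> carrier K" for y
      unfolding push[OF f] using f by (auto intro!: finsum_closed)
    have 3: "push K (base X m) h f y = \<zero>\<^bsub>K\<^esub>" if "y \<notin> simplices X m \<or> y = base X m" for y
    proof (cases "y = base X m")
      case False
      then have y: "y \<notin> h ` (simplices X n - {base X n})" using that h by auto
      show ?thesis unfolding push[OF f] S[OF y] by simp
    qed (simp add: push_def)
    show "push K (base X m) h f \<in> carrier (reduced_mod K X m)" using 1 2 3 by simp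
  next
    fix f g assume fg: "f \<in> carrier (reduced_mod K X n)" "g \<in> carrier (reduced_mod K X n)"
    interpret R: module K "reduced_mod K X n" by (rule reduced_mod_module) fact
    have "f \<oplus>\<^bsub>reduced_mod K X n\<^esub> g \<in> carrier (reduced_mod K X n)" using fg by (rule R.a_closed)
    note p = push[OF fg(1)] push[OF fg(2)] push[OF this]
    show "push K (base X m) h (f \<oplus>\<^bsub>reduced_mod K X n\<^esub> g) =
        push K (base X m) h f \<oplus>\<^bsub>reduced_mod K X m\<^esub> push K (base X m) h g"
    proof
      fix y
      have "finsum K (\<lambda>x. f x \<oplus>\<^bsub>K\<^esub> g x) (?S y) = finsum K f (?S y) \<oplus>\<^bsub>K\<^esub> finsum K g (?S y)"
        by (rule finsum_addf) (use fg in auto)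
      then show "push K (base X m) h (f \<oplus>\<^bsub>reduced_mod K X n\<^esub> g) y =
        (push K (base X m) h f \<oplus>\<^bsub>reduced_mod K X m\<^esub> push K (base X m) h g) y"
        unfolding reduced_mod_simps(3) p[unfolded reduced_mod_simps(3)] by simp
    qed
  next
    fix a f assume af: "a \<in> carrier K" "f \<in> carrier (reduced_mod K X n)"
    interpret R: module K "reduced_mod K X n" by (rule reduced_mod_module) fact
    have "a \<odot>\<^bsub>reduced_mod K X n\<^esub> f \<in> carrier (reduced_mod K X n)" using af by (rule R.smult_closed)
    note p = push[OF af(2)] push[OF this]
    show "push K (base X m) h (a \<odot>\<^bsub>reduced_mod K X n\<^esub> f) =
        a \<odot>\<^bsub>reduced_mod K X m\<^esub> push K (base X m) h f"
    proof
      fix y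
      have "finsum K (\<lambda>x. a \<otimes>\<^bsub>K\<^esub> f x) (?S y) = a \<otimes>\<^bsub>K\<^esub> finsum K f (?S y)"
        by (rule finsum_rdistr[symmetric]) (use af fin in auto)
      then show "push K (base X m) h (a \<odot>\<^bsub>reduced_mod K X n\<^esub> f) y =
        (a \<odot>\<^bsub>reduced_mod K X m\<^esub> push K (base X m) h f) y"
        unfolding reduced_mod_simps(4) p[unfolded reduced_mod_simps(4)] using af by simp
    qed
  qed
qed

text \<open>Both composites are linear, so a comparison on basis elements suffices; a simplex sent
  to the base point matches a basis element sent to zero.\<close>

lemma coord_fun_push:
  fixes X :: "'b option pointed_sset"
  assumes A: "module K A" "free_basis K A B e" and A': "module K A'" "free_basis K A' B' e'"
    and f: "f \<in> lin_maps K A A'"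
    and fe: "\<And>b. b \<in> B \<Longrightarrow> f (e b) = (case h (Some b) of None \<Rightarrow> \<zero>\<^bsub>A'\<^esub> | Some b' \<Rightarrow> e' b')"
    and h: "\<And>b b'. b \<in> B \<Longrightarrow> h (Some b) = Some b' \<Longrightarrow> b' \<in> B'"
    and X: "simplices X n = insert None (Some ` B)" "base X n = None"
      "simplices X m = insert None (Some ` B')" "base X m = None"
    and x: "x \<in> carrier A"
  shows "coord_fun K A' B' e' (f x) = push K (base X m) h (coord_fun K A B e x)"
proof -
  interpret A: module K A by fact
  have fin: "finite B" using A(2) by (simp add: free_basis_def)
  have R: "module K (reduced_mod K X m)" by (rule reduced_mod_module) (rule A.is_cring)
  have p: "push K (base X m) h \<in> lin_maps K (reduced_mod K X n) (reduced_mod K X m)"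
  proof (rule push_linear)
    show "h y \<in> simplices X m" if "y \<in> simplices X n" "y \<noteq> base X n" for y
      using that X h by (cases "h y") auto
  qed (use A.is_cring fin X in auto)
  have c: "coord_fun K A B e \<in> lin_maps K A (reduced_mod K X n)"
    using coord_fun_iso[OF A X(1,2)] by (simp add: lin_isos_def)
  have c': "coord_fun K A' B' e' \<in> lin_maps K A' (reduced_mod K X m)"
    using coord_fun_iso[OF A' X(3,4)] by (simp add: lin_isos_def)
  have "(coord_fun K A' B' e' \<circ> f) x = (push K (base X m) h \<circ> coord_fun K A B e) x"
  proof (rule free_basis_ext[OF A(1) R A(2) _ _ _ x])
    fix b assume b: "b \<in> B"
    have "coord_fun K A' B' e' (f (e b)) = (\<lambda>y. if y \<noteq> None \<and> y = h (Some b) then \<one>\<^bsub>K\<^esub> else \<zero>\<^bsub>K\<^esub>)"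
    proof (cases "h (Some b)")
      case None
      then show ?thesis using lin_maps_zero[OF A'(1) R c'] by (auto simp: fe[OF b])
    next
      case (Some b')
      then show ?thesis
        using coord_fun_basis[OF A'(2) h[OF b Some]] by (auto simp: fe[OF b])
    qed
    moreover have "push K (base X m) h (coord_fun K A B e (e b)) y =
      (if y \<noteq> None \<and> y = h (Some b) then \<one>\<^bsub>K\<^esub> else \<zero>\<^bsub>K\<^esub>)" for y
    proof -
      \<comment> \<open>The index set on the left is a support, hence empty over the zero ring;
        enlarging it to contain \<open>Some b\<close> adds only zero and treats all rings
        alike.\<close>
      have "finsum K (coord_fun K A B e (e b)) {x. coord_fun K A B e (e b) x \<noteq> \<zero>\<^bsub>K\<^esub> \<and> h x = y}
        = finsum K (\<lambda>x. if Some b = x then \<one>\<^bsub>K\<^esub> else \<zero>\<^bsub>K\<^esub>) (if h (Some b) = y then {Some b} else {})"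
        by (rule A.R.add.finprod_mono_neutral_cong_left)
          (auto simp: coord_fun_basis[OF A(2) b] split: if_splits)
      also have "\<dots> = (if y = h (Some b) then \<one>\<^bsub>K\<^esub> else \<zero>\<^bsub>K\<^esub>)" by auto
      finally have sum: "finsum K (coord_fun K A B e (e b))
        {x. coord_fun K A B e (e b) x \<noteq> \<zero>\<^bsub>K\<^esub> \<and> h x = y} = \<dots>" .
      show ?thesis unfolding push_def X(4) sum by auto
    qed
    ultimately show "(coord_fun K A' B' e' \<circ> f) (e b) = (push K (base X m) h \<circ> coord_fun K A B e) (e b)"
      by (simp add: fun_eq_iff)
  qed (rule lin_maps_comp[OF f c'], rule lin_maps_comp[OF c p])
  then show ?thesis by simp
qed

section \<open>Isomorphic simplicial modules have isomorphic normalized complexes\<close>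

lemma degenerate_closed:
  assumes "module K (smod A n)"
    and "\<And>m j x. n = Suc m \<Longrightarrow> j \<le> m \<Longrightarrow> x \<in> carrier (smod A m) \<Longrightarrow> sdegen A m j x \<in> carrier (smod A n)"
  shows "degenerate K A n \<subseteq> carrier (smod A n)"
proof -
  interpret module K "smod A n" by fact
  show ?thesis
    unfolding degenerate_def using carrier_is_submodule assms(2) by (intro Inter_lower) auto
qed

lemma submodule_image:
  assumes "module K A" "module K B" "f \<in> lin_maps K A B" "submodule H K A"
  shows "submodule (f ` H) K B"
proof -
  interpret A: module K A by fact
  interpret B: module K B by fact
  note H = A.submoduleE[OF assms(4)]
  note f = lin_mapsD[OF assms(3)]
  have 0: "\<zero>\<^bsub>A\<^esub> \<in> H" using submodule.axioms(1)[OF assms(4)] by (simp add: subgroup_def)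
  show ?thesis
  proof (rule B.submoduleI)
    show "f ` H \<subseteq> carrier B" using H(1) f(1) by auto
    show "\<zero>\<^bsub>B\<^esub> \<in> f ` H" using 0 lin_maps_zero[OF assms(1-3)] by force
    show "\<ominus>\<^bsub>B\<^esub> a \<in> f ` H" if "a \<in> f ` H" for a
      using that H lin_maps_minus[OF assms(1-3)] by (smt (verit) imageE imageI subsetD)
    show "a \<oplus>\<^bsub>B\<^esub> b \<in> f ` H" if "a \<in> f ` H" "b \<in> f ` H" for a b
      using that H f(2) by (smt (verit) imageE imageI subsetD)
    show "a \<odot>\<^bsub>B\<^esub> x \<in> f ` H" if "a \<in> carrier K" "x \<in> f ` H" for a x
      using that H f(3) by (smt (verit) imageE imageI subsetD)
  qed
qed

lemma submodule_vimage:
  assumes "module K A" "module K B" "f \<in> lin_maps K A B" "submodule H K B"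
  shows "submodule {x \<in> carrier A. f x \<in> H} K A"
proof -
  interpret B: module K B by fact
  note H = B.submoduleE[OF assms(4)]
  have "\<zero>\<^bsub>B\<^esub> \<in> H" using submodule.axioms(1)[OF assms(4)] by (simp add: subgroup_def)
  then show ?thesis
    using H lin_mapsD[OF assms(3)] lin_maps_zero[OF assms(1-3)]
    by (intro submodule_Collect[OF assms(1)]) auto
qed

text \<open>Generated submodules are intersections, so the two inclusions come from pulling back and
  from pushing forward the submodules that contain all degenerate elements.\<close>

lemma degenerate_iso:
  assumes modA: "\<And>n. module K (smod A n)" and modB: "\<And>n. module K (smod B n)"
    and iso: "\<And>n. \<phi> n \<in> lin_isos K (smod A n) (smod B n)"
    and deg: "\<And>n j x. x \<in> carrier (smod A n) \<Longrightarrow> j \<le> n \<Longrightarrow> sdegen A n j x \<in> carrier (smod A (Suc n)) \<and>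
        \<phi> (Suc n) (sdegen A n j x) = sdegen B n j (\<phi> n x)"
  shows "\<phi> n ` degenerate K A n = degenerate K B n"
proof -
  have lm: "\<phi> n \<in> lin_maps K (smod A n) (smod B n)" for n using iso by (simp add: lin_isos_def)
  have bij: "bij_betw (\<phi> n) (carrier (smod A n)) (carrier (smod B n))" for n
    using iso by (simp add: lin_isos_def)
  have surj: "\<exists>x\<in>carrier (smod A n). y = \<phi> n x" if "y \<in> carrier (smod B n)" for n y
    using bij[of n] that unfolding bij_betw_def by blast
  have degB: "sdegen B n j y \<in> carrier (smod B (Suc n))" if "y \<in> carrier (smod B n)" "j \<le> n" for n j y
    using surj[OF that(1)] deg[OF _ that(2)] lin_mapsD(1)[OF lm] by metis
  have subA: "degenerate K A n \<subseteq> carrier (smod A n)"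
    by (rule degenerate_closed[OF modA]) (use deg in auto)
  have subB: "degenerate K B n \<subseteq> carrier (smod B n)"
    by (rule degenerate_closed[OF modB]) (use degB in auto)
  show ?thesis
  proof (intro equalityI subsetI)
    fix y assume "y \<in> \<phi> n ` degenerate K A n"
    then obtain x where x: "x \<in> degenerate K A n" "y = \<phi> n x" by blast
    show "y \<in> degenerate K B n"
      unfolding degenerate_def
    proof (intro InterI, elim CollectE conjE)
      fix H assume H: "submodule H K (smod B n)"
        "\<forall>m j x. n = Suc m \<and> j \<le> m \<and> x \<in> carrier (smod B m) \<longrightarrow> sdegen B m j x \<in> H"
      \<comment> \<open>Compatibility with degeneracies makes the preimage of a competing submodule
        on the right a competitor on the left.\<close>
      have "{x \<in> carrier (smod A n). \<phi> n x \<in> H} \<in> {H. submodule H K (smod A n) \<and>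
          (\<forall>m j x. n = Suc m \<and> j \<le> m \<and> x \<in> carrier (smod A m) \<longrightarrow> sdegen A m j x \<in> H)}"
        using submodule_vimage[OF modA modB lm H(1)] H(2) deg lin_mapsD(1)[OF lm] by auto
      then have "x \<in> {x \<in> carrier (smod A n). \<phi> n x \<in> H}"
        using x(1) unfolding degenerate_def by blast
      then show "y \<in> H" using x(2) by simp
    qed
  next
    fix y assume y: "y \<in> degenerate K B n"
    then obtain x where x: "x \<in> carrier (smod A n)" "y = \<phi> n x" using subB surj by blast
    have "x \<in> degenerate K A n"
      unfolding degenerate_def
    proof (intro InterI, elim CollectE conjE)
      fix H assume H: "submodule H K (smod A n)"
        "\<forall>m j x. n = Suc m \<and> j \<le> m \<and> x \<in> carrier (smod A m) \<longrightarrow> sdegen A m j x \<in> H"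
      \<comment> \<open>Surjectivity of \<open>\<phi> m\<close> exhibits each degeneracy on the
        right as the image of one on the left, so the image of \<open>H\<close> is a competitor on
        the right; injectivity of \<open>\<phi> n\<close> then returns from \<open>y\<close> to
        \<open>x\<close>.\<close>
      have "sdegen B m j z \<in> \<phi> n ` H" if m: "n = Suc m" "j \<le> m" "z \<in> carrier (smod B m)" for m j z
      proof -
        obtain u where u: "u \<in> carrier (smod A m)" "z = \<phi> m u" using surj m(3) by blast
        then have "sdegen B m j z = \<phi> n (sdegen A m j u)" using deg m by simp
        then show ?thesis using H(2) m u by blast
      qed
      then have "y \<in> \<phi> n ` H"
        using y submodule_image[OF modA modB lm H(1)] unfolding degenerate_def by blast
      moreover have "H \<subseteq> carrier (smod A n)"
        using module.submoduleE(1)[OF modA H(1)] .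
      ultimately show "x \<in> H"
        using x bij[of n] unfolding bij_betw_def inj_on_def by blast
    qed
    then show "y \<in> \<phi> n ` degenerate K A n" using x(2) by blast
  qed
qed

lemma image_a_r_coset:
  assumes "f \<in> lin_maps K A B" "D \<subseteq> carrier A" "x \<in> carrier A"
  shows "f ` (D +>\<^bsub>A\<^esub> x) = f ` D +>\<^bsub>B\<^esub> f x"
  using assms lin_mapsD(2)[OF assms(1)] unfolding a_r_coset_def' by (force simp: image_iff)

text \<open>\<open>quot_map\<close> is a union over all members of a coset, so images can be taken
  member by member.\<close>

lemma image_quot_map:
  assumes "f \<in> lin_maps K B B'" "D \<subseteq> carrier B" "S \<subseteq> carrier A"
    and "\<And>x. x \<in> carrier A \<Longrightarrow> h x \<in> carrier B"
    and "\<And>x. x \<in> carrier A \<Longrightarrow> f (h x) = h' (g x)"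
  shows "f ` quot_map B D h S = quot_map B' (f ` D) h' (g ` S)"
proof -
  have "f ` (D +>\<^bsub>B\<^esub> h x) = f ` D +>\<^bsub>B'\<^esub> h' (g x)" if "x \<in> S" for x
    using image_a_r_coset[OF assms(1,2)] assms(3-) that by (metis subsetD)
  then show ?thesis by (simp add: quot_map_def image_UN)
qed

text \<open>Cosets are subsets of the carrier, and on these taking images under the bijection
  \<open>f\<close> is injective.\<close>

lemma quot_mod_iso:
  assumes "module K A" "module K B" "f \<in> lin_isos K A B" "D \<subseteq> carrier A"
  shows "(`) f \<in> lin_isos K (quot_mod A D) (quot_mod B (f ` D))"
proof -
  interpret A: module K A by fact
  have lm: "f \<in> lin_maps K A B" and bij: "bij_betw f (carrier A) (carrier B)"
    using assms(3) by (auto simp: lin_isos_def)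
  have sub: "S \<subseteq> carrier A" if "S \<in> a_rcosets\<^bsub>A\<^esub> D" for S
    using that assms(4) A.rcosets_subset_PowG unfolding A_RCOSETS_def' a_r_coset_def' by auto
  have im: "(`) f ` (a_rcosets\<^bsub>A\<^esub> D) = a_rcosets\<^bsub>B\<^esub> (f ` D)"
  proof -
    have "(`) f ` (\<lambda>x. D +>\<^bsub>A\<^esub> x) ` carrier A = (\<lambda>y. f ` D +>\<^bsub>B\<^esub> y) ` f ` carrier A"
      using image_a_r_coset[OF lm assms(4)] by (simp add: image_image cong: image_cong)
    moreover have "f ` carrier A = carrier B" using bij by (simp add: bij_betw_def)
    ultimately show ?thesis unfolding A_RCOSETS_def' by (simp add: UNION_singleton_eq_range)
  qed
  have "(`) f \<in> lin_maps K (quot_mod A D) (quot_mod B (f ` D))"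
  proof (rule lin_mapsI)
    show "f ` S \<in> carrier (quot_mod B (f ` D))" if "S \<in> carrier (quot_mod A D)" for S
      using that im by (auto simp: quot_mod_def)
  next
    fix S T assume "S \<in> carrier (quot_mod A D)" "T \<in> carrier (quot_mod A D)"
    then have "S \<subseteq> carrier A" "T \<subseteq> carrier A" by (auto simp: quot_mod_def dest: sub)
    then have "f (x \<oplus>\<^bsub>A\<^esub> y) = f x \<oplus>\<^bsub>B\<^esub> f y" if "x \<in> S" "y \<in> T" for x y
      using lin_mapsD(2)[OF lm] that by blast
    then show "f ` (S \<oplus>\<^bsub>quot_mod A D\<^esub> T) = f ` S \<oplus>\<^bsub>quot_mod B (f ` D)\<^esub> f ` T"
      by (simp add: quot_mod_def set_add_def' image_UN)
  next
    fix a S assume a: "a \<in> carrier K" and "S \<in> carrier (quot_mod A D)"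
    then have "S \<subseteq> carrier A" by (auto simp: quot_mod_def dest: sub)
    then show "f ` (a \<odot>\<^bsub>quot_mod A D\<^esub> S) = a \<odot>\<^bsub>quot_mod B (f ` D)\<^esub> f ` S"
      using image_quot_map[OF lm assms(4), where A = A and S = S and h = "\<lambda>x. a \<odot>\<^bsub>A\<^esub> x" and h' = "\<lambda>x. a \<odot>\<^bsub>B\<^esub> x"
            and g = f] lin_mapsD(3)[OF lm a] a
      by (simp add: quot_mod_def)
  qed
  moreover have "inj_on ((`) f) (a_rcosets\<^bsub>A\<^esub> D)"
    by (rule inj_on_subset[OF inj_on_image_Pow[OF bij_betw_imp_inj_on[OF bij]]]) (use sub in blast)
  ultimately show ?thesis
    using im by (simp add: lin_isos_def bij_betw_def quot_mod_def)
qed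

lemma alt_sum_transport:
  assumes "module K (smod A n)" "module K (smod B n)"
    and lm: "\<psi> \<in> lin_maps K (smod A n) (smod B n)"
    and "\<And>i. i \<le> Suc n \<Longrightarrow> sface A (Suc n) i x \<in> carrier (smod A n) \<and>
        \<psi> (sface A (Suc n) i x) = sface B (Suc n) i y"
  shows "alt_sum A (Suc n) x \<in> carrier (smod A n)"
    and "\<psi> (alt_sum A (Suc n) x) = alt_sum B (Suc n) y"
proof -
  interpret A: module K "smod A n" by fact
  interpret B: module K "smod B n" by fact
  let ?f = "\<lambda>i. if even i then sface A (Suc n) i x else \<ominus>\<^bsub>smod A n\<^esub> sface A (Suc n) i x"
  have cl: "?f \<in> {0..Suc n} \<rightarrow> carrier (smod A n)" using assms(4) by auto
  then show "alt_sum A (Suc n) x \<in> carrier (smod A n)"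
    unfolding alt_sum_def diff_Suc_1 by (rule A.finsum_closed)
  have "sface B (Suc n) i y \<in> carrier (smod B n)" if "i \<le> Suc n" for i
    using assms(4)[OF that] lin_mapsD(1)[OF lm] by metis
  then have clB: "(\<lambda>i. if even i then sface B (Suc n) i y else \<ominus>\<^bsub>smod B n\<^esub> sface B (Suc n) i y)
      \<in> {0..Suc n} \<rightarrow> carrier (smod B n)" by auto
  have "\<psi> (alt_sum A (Suc n) x) = finsum (smod B n) (\<psi> \<circ> ?f) {0..Suc n}"
    unfolding alt_sum_def diff_Suc_1 by (rule lin_maps_finsum[OF assms(1,2) lm _ cl]) simp
  also have "\<dots> = alt_sum B (Suc n) y"
    unfolding alt_sum_def diff_Suc_1 using assms(4) clB
    by (intro B.M.finsum_cong') (auto simp: lin_maps_minus[OF assms(1,2) lm])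
  finally show "\<psi> (alt_sum A (Suc n) x) = alt_sum B (Suc n) y" .
qed

text \<open>The isomorphism sends a coset to its image. It lands in the right quotient because
  \<open>\<phi>\<close> carries one degenerate submodule onto the other, and it commutes with the
  differentials because the alternating sums of faces correspond.\<close>

lemma normalized_iso:
  assumes modA: "\<And>n. module K (smod A n)" and modB: "\<And>n. module K (smod B n)"
    and iso: "\<And>n. \<phi> n \<in> lin_isos K (smod A n) (smod B n)"
    and face: "\<And>n i x. x \<in> carrier (smod A (Suc n)) \<Longrightarrow> i \<le> Suc n \<Longrightarrow>
        sface A (Suc n) i x \<in> carrier (smod A n) \<and>
        \<phi> n (sface A (Suc n) i x) = sface B (Suc n) i (\<phi> (Suc n) x)"
    and deg: "\<And>n j x. x \<in> carrier (smod A n) \<Longrightarrow> j \<le> n \<Longrightarrow> sdegen A n j x \<in> carrier (smod A (Suc n)) \<and>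
        \<phi> (Suc n) (sdegen A n j x) = sdegen B n j (\<phi> n x)"
    and act: "\<And>n w x. w permutes {1..r} \<Longrightarrow> x \<in> carrier (smod A n) \<Longrightarrow>
        sact A n w x \<in> carrier (smod A n) \<and> \<phi> n (sact A n w x) = sact B n w (\<phi> n x)"
  shows "chain_cpx_iso K r (normalized K A) (normalized K B)"
proof -
  have lm: "\<phi> n \<in> lin_maps K (smod A n) (smod B n)" for n using iso by (simp add: lin_isos_def)
  have sub: "degenerate K A n \<subseteq> carrier (smod A n)" for n
    by (rule degenerate_closed[OF modA]) (use deg in auto)
  have D: "degenerate K B n = \<phi> n ` degenerate K A n" for n
    using degenerate_iso[OF modA modB iso deg] by simp
  have coset: "S \<subseteq> carrier (smod A n)" if "S \<in> carrier (cmod (normalized K A) n)" for S n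
  proof -
    interpret module K "smod A n" by (rule modA)
    show ?thesis
      using that sub[of n] by (auto simp: normalized_def quot_mod_def A_RCOSETS_def' a_r_coset_def')
  qed
  show ?thesis
    unfolding chain_cpx_iso_def
  proof (intro exI[of _ "\<lambda>n. (`) (\<phi> n)"] allI conjI ballI impI)
    fix n
    show "(`) (\<phi> n) \<in> lin_isos K (cmod (normalized K A) n) (cmod (normalized K B) n)"
      using quot_mod_iso[OF modA modB iso sub] by (simp add: normalized_def D)
  next
    fix n S assume "S \<in> carrier (cmod (normalized K A) (Suc n))"
    then have S: "S \<subseteq> carrier (smod A (Suc n))" by (rule coset)
    show "\<phi> n ` cdiff (normalized K A) (Suc n) S = cdiff (normalized K B) (Suc n) (\<phi> (Suc n) ` S)"
      using image_quot_map[OF lm[of n] sub[of n] S, where h = "alt_sum A (Suc n)"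
            and h' = "alt_sum B (Suc n)" and g = "\<phi> (Suc n)"]
        alt_sum_transport[OF modA modB lm[of n]] face
      by (simp add: normalized_def D)
  next
    fix n w S assume *: "w permutes {1..r} \<and> S \<in> carrier (cmod (normalized K A) n)"
    then have S: "S \<subseteq> carrier (smod A n)" by (blast dest: coset)
    show "\<phi> n ` cact (normalized K A) n w S = cact (normalized K B) n w (\<phi> n ` S)"
      using image_quot_map[OF lm[of n] sub[of n] S, where h = "sact A n w"
            and h' = "sact B n w" and g = "\<phi> n"] act *
      by (simp add: normalized_def D)
  qed
qed

section \<open>Restricting chains of partitions to a block\<close>

lemma bij_emb:
  assumes "finite J" shows "bij_betw (emb J) {1..card J} J"
proof -
  have 1: "bij_betw (\<lambda>i. i - 1) {1..card J} {..<card J}"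
    by (rule bij_betwI[of _ _ _ Suc]) auto
  have 2: "bij_betw ((!) (sorted_list_of_set J)) {..<card J} J"
    by (rule bij_betw_nth) (use assms in auto)
  have "(!) (sorted_list_of_set J) \<circ> (\<lambda>i. i - 1) = emb J" by (auto simp: emb_def)
  then show ?thesis using bij_betw_trans[OF 1 2] by simp
qed

lemma emb_in: "finite J \<Longrightarrow> i \<in> {1..card J} \<Longrightarrow> emb J i \<in> J"
  using bij_emb[of J] unfolding bij_betw_def by blast

lemma emb_image: "finite J \<Longrightarrow> emb J ` {1..card J} = J"
  using bij_emb[of J] unfolding bij_betw_def by blast

lemma emb_mono:
  assumes "finite J" "i \<in> {1..card J}" "j \<in> {1..card J}" "i < j" shows "emb J i < emb J j"
  unfolding emb_def using assms
  by (intro sorted_wrt_nth_less[OF strict_sorted_list_of_set]) auto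

lemma emb_interval: "i \<in> {1..n} \<Longrightarrow> emb {1..n} i = i"
proof -
  assume i: "i \<in> {1..n}"
  have "sorted_list_of_set {1..n} = [1..<Suc n]"
    by (metis atLeastLessThanSuc_atLeastAtMost sorted_list_of_set_range)
  then show ?thesis using i by (simp add: emb_def del: upt_Suc)
qed

text \<open>An increasing map sends the sorted list of \<open>L\<close> to the sorted list of its
  image, hence order-preserving enumerations compose.\<close>

lemma emb_emb:
  assumes "finite J" "L \<subseteq> {1..card J}" "i \<in> {1..card L}"
  shows "emb (emb J ` L) i = emb J (emb L i)"
proof -
  have finL: "finite L" using assms(2) by (rule finite_subset) simp
  have inj: "inj_on (emb J) L"
    using bij_betw_imp_inj_on[OF bij_emb[OF assms(1)]] assms(2) by (rule inj_on_subset)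
  have sl: "sorted_list_of_set (emb J ` L) = map (emb J) (sorted_list_of_set L)"
  proof (rule sorted_distinct_set_unique)
    have "sorted_wrt (<) (map (emb J) (sorted_list_of_set L))"
      unfolding sorted_wrt_map
      by (rule sorted_wrt_mono_rel[OF _ strict_sorted_list_of_set])
        (use emb_mono[OF assms(1)] assms(2) finL in \<open>auto simp: subset_iff\<close>)
    then show "sorted (map (emb J) (sorted_list_of_set L))"
      by (simp add: strict_sorted_iff)
  qed (use finL inj in \<open>auto simp: distinct_map\<close>)
  have "emb (emb J ` L) i = map (emb J) (sorted_list_of_set L) ! (i - 1)"
    unfolding emb_def[of "emb J ` L"] sl ..
  also have "\<dots> = emb J (emb L i)"
    using assms(3) by (subst nth_map) (auto simp: emb_def[of L])
  finally show ?thesis .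
qed

lemma card_emb_image:
  assumes "finite J" "L \<subseteq> {1..card J}" shows "card (emb J ` L) = card L"
  using bij_betw_imp_inj_on[OF bij_emb[OF assms(1)]] assms(2)
  by (intro card_image) (rule inj_on_subset)

text \<open>Taking the rank inverts \<open>emb J\<close>; ranks are what the definition of
  \<open>std_perm\<close> counts.\<close>

lemma card_le_emb:
  assumes "finite J" "i \<in> {1..card J}" shows "card {j \<in> J. j \<le> emb J i} = i"
proof -
  have "{j \<in> J. j \<le> emb J i} = emb J ` {1..i}"
  proof (intro equalityI subsetI)
    fix j assume j: "j \<in> {j \<in> J. j \<le> emb J i}"
    then obtain k where k: "k \<in> {1..card J}" "j = emb J k" using emb_image[OF assms(1)] by blast
    have "\<not> i < k" using emb_mono[OF assms(1,2) k(1)] k(2) j by auto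
    then show "j \<in> emb J ` {1..i}" using k by auto
  next
    fix j assume "j \<in> emb J ` {1..i}"
    then obtain k where k: "k \<in> {1..i}" "j = emb J k" by blast
    then have k': "k \<in> {1..card J}" using assms(2) by auto
    have "emb J k \<le> emb J i"
      using emb_mono[OF assms(1) k' assms(2)] k by (cases "k = i") auto
    then show "j \<in> {j \<in> J. j \<le> emb J i}" using k emb_in[OF assms(1) k'] by auto
  qed
  also have "card \<dots> = i"
    using card_emb_image[OF assms(1), of "{1..i}"] assms(2) by auto
  finally show ?thesis .
qed

lemma emb_card_le:
  assumes "finite J" "x \<in> J"
  shows "emb J (card {j \<in> J. j \<le> x}) = x" and "card {j \<in> J. j \<le> x} \<in> {1..card J}"
proof -
  obtain i where i: "i \<in> {1..card J}" "x = emb J i" using emb_image[OF assms(1)] assms(2) by blast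
  then show "emb J (card {j \<in> J. j \<le> x}) = x" "card {j \<in> J. j \<le> x} \<in> {1..card J}"
    using card_le_emb[OF assms(1) i(1)] by auto
qed

text \<open>Because ranks invert the enumeration, the counting formula is just \<open>w\<close> read
  through the enumerations of \<open>J\<close> and of its image; bijectivity follows from that of
  its three ingredients.\<close>

lemma std_perm:
  assumes "finite J" "inj_on w J"
  shows "i \<in> {1..card J} \<Longrightarrow> emb (w ` J) (std_perm w J i) = w (emb J i)"
    and "std_perm w J permutes {1..card J}"
proof -
  have fin: "finite (w ` J)" and card: "card (w ` J) = card J"
    using assms by (auto simp: card_image)
  have *: "emb (w ` J) (std_perm w J i) = w (emb J i) \<and> std_perm w J i \<in> {1..card J}"
    if "i \<in> {1..card J}" for i
    using emb_card_le[OF fin, of "w (emb J i)"] emb_in[OF assms(1) that] that card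
    by (simp add: std_perm_def)
  then show "i \<in> {1..card J} \<Longrightarrow> emb (w ` J) (std_perm w J i) = w (emb J i)" by blast
  have "inj_on (std_perm w J) {1..card J}"
  proof (rule inj_onI)
    fix i j assume ij: "i \<in> {1..card J}" "j \<in> {1..card J}" "std_perm w J i = std_perm w J j"
    then have "w (emb J i) = w (emb J j)" using * by metis
    then have "emb J i = emb J j"
      using assms(2) emb_in[OF assms(1)] ij unfolding inj_on_def by blast
    then show "i = j" using bij_emb[OF assms(1)] ij unfolding bij_betw_def inj_on_def by blast
  qed
  moreover have "std_perm w J ` {1..card J} \<subseteq> {1..card J}" using * by blast
  ultimately have "bij_betw (std_perm w J) {1..card J} {1..card J}"
    by (intro bij_betw_imageI endo_inj_surj) auto
  then show "std_perm w J permutes {1..card J}"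
    by (rule bij_imp_permutes) (auto simp: std_perm_def)
qed

text \<open>The trace of \<open>l\<close> on \<open>J\<close>, transported to \<open>{1..card J}\<close> along \<open>emb J\<close>.\<close>

definition restr_part :: "nat set \<Rightarrow> nat set set \<Rightarrow> nat set set" where
  "restr_part J l = {B. B \<subseteq> {1..card J} \<and> emb J ` B \<in> l}"

text \<open>The head is dropped because, for a block \<open>J\<close> of the second partition, the
  trace of that partition on \<open>J\<close> is again the one-block partition and takes over the
  role of the top.\<close>

definition restr :: "nat set \<Rightarrow> nat set set list \<Rightarrow> nat set set list" where
  "restr J c = map (restr_part J) (tl c)"

lemma restr_part_interval: "l \<subseteq> Pow {1..n} \<Longrightarrow> restr_part {1..n} l = l"
proof -
  assume l: "l \<subseteq> Pow {1..n}"
  have "emb {1..n} ` B = B" if "B \<subseteq> {1..n}" for B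
  proof -
    have "emb {1..n} ` B = (\<lambda>i. i) ` B" using that by (intro image_cong HOL.refl emb_interval) auto
    then show ?thesis by simp
  qed
  then show ?thesis using l by (auto simp: restr_part_def)
qed

text \<open>Enumerations compose, so restriction can be done in stages. This serves the product of
  two factors, where a block inside a block becomes a block of the whole set.\<close>

lemma restr_part_emb:
  assumes "finite J" "L \<subseteq> {1..card J}"
  shows "restr_part (emb J ` L) l = restr_part L (restr_part J l)"
proof -
  have finL: "finite L" using assms(2) by (rule finite_subset) simp
  have "emb (emb J ` L) ` B = emb J ` emb L ` B \<and> emb L ` B \<subseteq> {1..card J}" if "B \<subseteq> {1..card L}" for B
  proof
    show "emb (emb J ` L) ` B = emb J ` emb L ` B"
      unfolding image_image using that by (intro image_cong HOL.refl emb_emb assms) auto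
    show "emb L ` B \<subseteq> {1..card J}" using that emb_in[OF finL] assms(2) by blast
  qed
  then show ?thesis using assms by (auto simp: restr_part_def card_emb_image)
qed

text \<open>Relabelling by \<open>w\<close> becomes relabelling by its standardisation after
  transport. Injectivity on all blocks together with \<open>J\<close> allows a block of
  \<open>l\<close> to be recovered from its image.\<close>

lemma restr_part_act:
  assumes J: "finite J" "inj_on w (\<Union>l \<union> J)" "\<And>B. B \<in> l \<Longrightarrow> B \<inter> J \<noteq> {} \<Longrightarrow> B \<subseteq> J" "{} \<notin> l"
  shows "restr_part (w ` J) ((`) w ` l) = (`) (std_perm w J) ` restr_part J l"
proof -
  have inj: "inj_on w J" using J(2) by (rule inj_on_subset) blast
  have card: "card (w ` J) = card J" using inj by (simp add: card_image)
  note sp = std_perm[OF J(1) inj]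
  have im: "emb (w ` J) ` std_perm w J ` B = w ` emb J ` B" if "B \<subseteq> {1..card J}" for B
    unfolding image_image using that by (intro image_cong HOL.refl sp(1)) auto
  show ?thesis
  proof (intro equalityI subsetI)
    fix B' assume "B' \<in> restr_part (w ` J) ((`) w ` l)"
    then have B': "B' \<subseteq> {1..card J}" "emb (w ` J) ` B' \<in> (`) w ` l"
      by (auto simp: restr_part_def card)
    define B where "B = std_perm w J -` B'"
    have BB: "B' = std_perm w J ` B" unfolding B_def
      using permutes_surj[OF sp(2)] by (simp add: surj_image_vimage_eq)
    have B: "B \<subseteq> {1..card J}"
      using B'(1) permutes_in_image[OF sp(2)] unfolding B_def by blast
    obtain C where C: "C \<in> l" "w ` emb J ` B = w ` C" using B'(2) im[OF B] BB by auto
    have "emb J ` B \<subseteq> J" using B emb_in[OF J(1)] by blast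
    then have "emb J ` B = C"
      using inj_on_image_eq_iff[OF J(2), of "emb J ` B" C] C by blast
    then show "B' \<in> (`) (std_perm w J) ` restr_part J l"
      using B C BB by (auto simp: restr_part_def)
  next
    fix B' assume "B' \<in> (`) (std_perm w J) ` restr_part J l"
    then obtain B where B: "B' = std_perm w J ` B" "B \<subseteq> {1..card J}" "emb J ` B \<in> l"
      by (auto simp: restr_part_def)
    have "B' \<subseteq> {1..card J}" using B(1,2) permutes_in_image[OF sp(2)] by blast
    then show "B' \<in> restr_part (w ` J) ((`) w ` l)"
      using B im[OF B(2)] by (auto simp: restr_part_def card)
  qed
qed

lemma restr_part_vimage:
  assumes "finite J" "B \<in> l" "B \<subseteq> J"
  shows "\<exists>B'\<in>restr_part J l. B = emb J ` B'"
proof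
  let ?B = "{i \<in> {1..card J}. emb J i \<in> B}"
  show "B = emb J ` ?B"
  proof (intro equalityI subsetI)
    fix x assume x: "x \<in> B"
    then obtain i where "i \<in> {1..card J}" "x = emb J i"
      using emb_image[OF assms(1)] assms(3) by blast
    then show "x \<in> emb J ` ?B" using x by blast
  qed auto
  with assms(2) show "?B \<in> restr_part J l" by (auto simp: restr_part_def)
qed

text \<open>Each block lies in some member of \<open>\<pi>\<close> and is therefore transported from
  the trace on that member. So a refinement of \<open>\<pi>\<close> can be rebuilt from its
  traces.\<close>

lemma restr_part_glue:
  assumes "\<And>J. J \<in> \<pi> \<Longrightarrow> finite J" "\<And>B. B \<in> l \<Longrightarrow> \<exists>J\<in>\<pi>. B \<subseteq> J"
  shows "l = (\<Union>J\<in>\<pi>. (`) (emb J) ` restr_part J l)"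
proof (intro equalityI subsetI)
  fix B assume B: "B \<in> l"
  then obtain J where J: "J \<in> \<pi>" "B \<subseteq> J" using assms(2) by blast
  then show "B \<in> (\<Union>J\<in>\<pi>. (`) (emb J) ` restr_part J l)"
    using restr_part_vimage[OF assms(1)[OF J(1)] B J(2)] by blast
qed (auto simp: restr_part_def)

text \<open>Blocks that meet \<open>J\<close> lie in \<open>J\<close>, so the blocks kept by the
  restriction cover it.\<close>

lemma restr_part_partition:
  assumes "partition_on A l" "J \<subseteq> A" "finite J" "\<And>B. B \<in> l \<Longrightarrow> B \<inter> J \<noteq> {} \<Longrightarrow> B \<subseteq> J"
  shows "partition_on {1..card J} (restr_part J l)"
proof (rule partition_onI)
  show "\<Union>(restr_part J l) = {1..card J}"
  proof (intro equalityI subsetI)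
    fix i assume i: "i \<in> {1..card J}"
    then have "emb J i \<in> J" using emb_in[OF assms(3)] by blast
    moreover obtain B where B: "B \<in> l" "emb J i \<in> B"
      using assms(1,2) calculation by (auto simp: partition_on_def)
    ultimately have "B \<subseteq> J" using assms(4) by blast
    then obtain B' where B': "B' \<in> restr_part J l" "B = emb J ` B'"
      using restr_part_vimage[OF assms(3) B(1)] by blast
    obtain k where k: "k \<in> B'" "emb J k = emb J i" using B(2) B'(2) by force
    then have "k = i" using i B'(1) bij_emb[OF assms(3)]
      unfolding bij_betw_def inj_on_def restr_part_def by blast
    then show "i \<in> \<Union>(restr_part J l)" using k B' by blast
  qed (auto simp: restr_part_def)
  show "disjnt p q" if "p \<in> restr_part J l" "q \<in> restr_part J l" "p \<noteq> q" for p q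
  proof -
    have pq: "p \<subseteq> {1..card J}" "q \<subseteq> {1..card J}" "emb J ` p \<in> l" "emb J ` q \<in> l"
      using that by (auto simp: restr_part_def)
    then have "emb J ` p \<noteq> emb J ` q"
      using that(3) inj_on_image_eq_iff[OF bij_betw_imp_inj_on[OF bij_emb[OF assms(3)]]] by blast
    then have "disjnt (emb J ` p) (emb J ` q)"
      using assms(1) pq by (auto simp: partition_on_def pairwise_def)
    then show ?thesis by (auto simp: disjnt_def)
  qed
  show "{} \<notin> restr_part J l"
    using assms(1) by (auto simp: restr_part_def partition_on_def)
qed

section \<open>Chains of partitions from one block to singletons\<close>

lemma partition_on_block:
  assumes "partition_on A P" "p \<in> P" shows "p \<subseteq> A" and "p \<noteq> {}"
  using Union_upper[OF assms(2)] assms(2) partition_onD1[OF assms(1)] partition_onD3[OF assms(1)] by auto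

lemma partition_on_block_eq:
  assumes "partition_on A P" "p \<in> P" "q \<in> P" "p \<inter> q \<noteq> {}" shows "p = q"
  using disjointD[OF partition_onD2[OF assms(1)] assms(2,3)] assms(4) by blast

lemma partition_on_block_disjnt:
  assumes "partition_on A P" "p \<in> P" "q \<in> P" "p \<noteq> q" shows "disjnt p q"
  using partition_on_block_eq[OF assms(1-3)] assms(4) unfolding disjnt_def by blast

lemma partition_on_block_finite: "partition_on {1..n::nat} P \<Longrightarrow> p \<in> P \<Longrightarrow> finite p"
  by (rule finite_subset[OF partition_on_block(1)]) auto

lemma partition_chainsI:
  assumes "length c = Suc d" "\<And>l. l \<in> set c \<Longrightarrow> partition_on {1..n} l"
    and "\<And>i. i < d \<Longrightarrow> refines {1..n} (c ! Suc i) (c ! i)"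
    and "c ! 0 = {{1..n}}" "c ! d = (\<lambda>i. {i}) ` {1..n}"
  shows "c \<in> partition_chains n d"
  using assms by (auto simp: partition_chains_def)

lemma partition_chainsD:
  assumes "c \<in> partition_chains n d"
  shows "length c = Suc d" and "l \<in> set c \<Longrightarrow> partition_on {1..n} l"
    and "i < d \<Longrightarrow> refines {1..n} (c ! Suc i) (c ! i)"
    and "c ! 0 = {{1..n}}" and "c ! d = (\<lambda>i. {i}) ` {1..n}"
    and "i \<le> d \<Longrightarrow> partition_on {1..n} (c ! i)"
  using assms by (auto simp: partition_chains_def)

lemma partition_chains_refines:
  assumes "c \<in> partition_chains n d" "j \<le> d" "i \<le> j"
  shows "refines {1..n} (c ! j) (c ! i)"
  using assms(3,2)
proof (induction j rule: dec_induct)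
  case base
  then show ?case using partition_chainsD(6)[OF assms(1)] by (simp add: refines_refl)
next
  case (step j)
  then show ?case using partition_chainsD(3)[OF assms(1), of j] refines_trans by fastforce
qed

lemma finite_partition_chains: "finite (partition_chains n d)"
proof (rule finite_subset)
  show "partition_chains n d \<subseteq> {c. set c \<subseteq> Pow (Pow {1..n}) \<and> length c = Suc d}"
    by (auto simp: partition_chains_def partition_on_def)
  show "finite {c. set c \<subseteq> Pow (Pow {1..n}) \<and> length c = Suc d}"
    by (rule finite_lists_length_eq) simp
qed

text \<open>A chain would have to start with \<open>{{}}\<close>, which is not a partition of the
  empty set. The indexed families are thus empty in arity 0, in accordance with the vanishing of the
  operad there.\<close>

lemma partition_chains_empty: "partition_chains 0 d = {}"
proof -
  have False if "c \<in> partition_chains 0 d" for c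
    using partition_chainsD(4)[OF that] partition_chainsD(6)[OF that, of 0] by (simp add: partition_on_def)
  then show ?thesis by blast
qed

text \<open>Both end conditions apply to the only entry, and one block coincides with the singletons
  only on a one-element set. This is the arity where the unit module is nonzero.\<close>

lemma partition_chains_0:
  "c \<in> partition_chains n 0 \<longleftrightarrow> n = 1 \<and> c = [{{1}}]"
proof
  assume c: "c \<in> partition_chains n 0"
  then have "{{1..n}} = (\<lambda>i. {i}) ` {1..n}" using partition_chainsD(4,5)[OF c] by simp
  then have "{1..n} \<in> (\<lambda>i. {i}) ` {1..n}" by (metis insertI1)
  then obtain i where "{1..n} = {i}" by blast
  then have "card {1..n} = card {i}" by (simp only:)
  then have n: "n = 1" by simp
  obtain l where "c = [l]" using partition_chainsD(1)[OF c] by (auto simp: length_Suc_conv)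
  then show "n = 1 \<and> c = [{{1}}]" using partition_chainsD(4)[OF c] n by simp
next
  assume "n = 1 \<and> c = [{{1}}]"
  moreover have "partition_on {1::nat} {{1}}" by (simp add: partition_on_def)
  ultimately show "c \<in> partition_chains n 0" by (intro partition_chainsI) auto
qed

lemma block_sub:
  assumes "refines A l \<pi>" "J \<in> \<pi>" "B \<in> l" "B \<inter> J \<noteq> {}" shows "B \<subseteq> J"
proof -
  obtain J' where J': "J' \<in> \<pi>" "B \<subseteq> J'" using assms(1,3) unfolding refines_def by blast
  have "partition_on A \<pi>" using assms(1) by (simp add: refines_def)
  moreover have "J' \<inter> J \<noteq> {}" using J'(2) assms(4) by blast
  ultimately have "J' = J"
    using partition_on_block_eq J'(1) assms(2) by metis
  then show ?thesis using J' by simp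
qed

text \<open>All later partitions refine the second one, so each of their blocks lies inside
  \<open>J\<close> or misses it. Hence traces are partitions, refinement persists, and both ends of
  the chain are restored on \<open>J\<close>.\<close>

lemma restr_chain:
  assumes c: "c \<in> partition_chains n (Suc d)" and J: "J \<in> c ! 1"
  shows "restr J c \<in> partition_chains (card J) d"
proof -
  note D = partition_chainsD[OF c]
  have JA: "J \<subseteq> {1..n}" using partition_on_block(1)[OF D(6) J] by simp
  then have fin: "finite J" using finite_subset by blast
  have ref: "refines {1..n} (c ! Suc i) (c ! 1)" if "i \<le> d" for i
    using partition_chains_refines[OF c, of "Suc i" 1] that by simp
  have nth: "restr J c ! i = restr_part J (c ! Suc i)" if "i \<le> d" for i
    using that D(1) by (simp add: restr_def nth_tl)
  have P: "partition_on {1..card J} (restr_part J (c ! Suc i))" if "i \<le> d" for i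
    by (rule restr_part_partition[OF _ JA fin]) (use D(6)[of "Suc i"] that block_sub[OF ref J] in auto)
  show ?thesis
  proof (rule partition_chainsI)
    show len: "length (restr J c) = Suc d" using D(1) by (simp add: restr_def)
    show "partition_on {1..card J} l" if "l \<in> set (restr J c)" for l
      using that P nth len by (auto simp: in_set_conv_nth)
    show "refines {1..card J} (restr J c ! Suc i) (restr J c ! i)" if "i < d" for i
    proof -
      have "\<exists>Y\<in>restr_part J (c ! Suc i). X \<subseteq> Y" if X: "X \<in> restr_part J (c ! Suc (Suc i))" for X
      proof -
        have X': "X \<subseteq> {1..card J}" "emb J ` X \<in> c ! Suc (Suc i)" using X by (auto simp: restr_part_def)
        then obtain Y where Y: "Y \<in> c ! Suc i" "emb J ` X \<subseteq> Y"
          using D(3)[of "Suc i"] \<open>i < d\<close> by (auto simp: refines_def)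
        \<comment> \<open>A point of \<open>X\<close> shows that the coarser block \<open>Y\<close>
          meets \<open>J\<close>; so \<open>Y\<close> lies in \<open>J\<close> and survives the
          restriction.\<close>
        have "X \<noteq> {}" using partition_on_block(2)[OF P[of "Suc i"] X] \<open>i < d\<close> by simp
        then obtain x where "x \<in> X" by blast
        then have "emb J x \<in> Y \<inter> J" using X'(1) Y(2) emb_in[OF fin] by blast
        then have "Y \<inter> J \<noteq> {}" by blast
        then have "Y \<subseteq> J" using block_sub[OF ref J Y(1)] \<open>i < d\<close> by simp
        then obtain Y' where Y': "Y' \<in> restr_part J (c ! Suc i)" "Y = emb J ` Y'"
          using restr_part_vimage[OF fin Y(1)] by blast
        have "X \<subseteq> Y'"
        proof
          fix x assume x: "x \<in> X"
          then obtain y where y: "y \<in> Y'" "emb J x = emb J y" using Y(2) Y'(2) by blast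
          have "y \<in> {1..card J}" using y(1) Y'(1) by (auto simp: restr_part_def)
          then have "x = y"
            using inj_onD[OF bij_betw_imp_inj_on[OF bij_emb[OF fin]] y(2)] x X'(1) by blast
          then show "x \<in> Y'" using y(1) by simp
        qed
        then show ?thesis using Y'(1) by blast
      qed
      then show ?thesis using P[of i] P[of "Suc i"] that nth[of i] nth[of "Suc i"] by (simp add: refines_def)
    qed
    \<comment> \<open>Since blocks are disjoint and nonempty, \<open>J\<close> is the only block of
      the second partition inside \<open>J\<close>; its trace is the top.\<close>
    have "emb J ` B \<in> c ! 1 \<longleftrightarrow> B = {1..card J}" if B: "B \<subseteq> {1..card J}" for B
    proof
      assume *: "emb J ` B \<in> c ! 1"
      have \<pi>: "partition_on {1..n} (c ! 1)" by (rule D(6)) simp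
      have "emb J ` B \<noteq> {}" using partition_on_block(2)[OF \<pi> *] .
      moreover have "emb J ` B \<subseteq> J" using emb_in[OF fin] B by blast
      ultimately have "emb J ` B = J"
        using partition_on_block_eq[OF \<pi> * J] by blast
      then have "emb J ` B = emb J ` {1..card J}" using emb_image[OF fin] by simp
      then show "B = {1..card J}"
        using inj_on_image_eq_iff[OF bij_betw_imp_inj_on[OF bij_emb[OF fin]] B] by blast
    next
      assume "B = {1..card J}"
      then have "emb J ` B = J" using emb_image[OF fin] by (simp only:)
      then show "emb J ` B \<in> c ! 1" using J by (simp only:)
    qed
    then have "restr_part J (c ! 1) = {{1..card J}}" unfolding restr_part_def by blast
    then show "restr J c ! 0 = {{1..card J}}" using nth[of 0] by simp
    \<comment> \<open>Transport preserves cardinality, so singletons correspond to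
      singletons.\<close>
    have sing: "emb J ` B \<in> (\<lambda>i. {i}) ` {1..n} \<longleftrightarrow> (\<exists>i\<in>{1..card J}. B = {i})" if B: "B \<subseteq> {1..card J}" for B
    proof
      assume "emb J ` B \<in> (\<lambda>i. {i}) ` {1..n}"
      then have "card (emb J ` B) = 1" by auto
      then have "card B = 1" using card_emb_image[OF fin B] by simp
      then obtain i where "B = {i}" by (auto simp: card_1_singleton_iff)
      then show "\<exists>i\<in>{1..card J}. B = {i}" using B by blast
    next
      assume "\<exists>i\<in>{1..card J}. B = {i}"
      then obtain i where i: "i \<in> {1..card J}" "B = {i}" by blast
      then have "emb J i \<in> {1..n}" using emb_in[OF fin] JA by blast
      then show "emb J ` B \<in> (\<lambda>i. {i}) ` {1..n}" using i(2) by simp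
    qed
    have "restr_part J (c ! Suc d) = (\<lambda>i. {i}) ` {1..card J}"
    proof (intro equalityI subsetI)
      fix B assume "B \<in> restr_part J (c ! Suc d)"
      then have "B \<subseteq> {1..card J}" "emb J ` B \<in> c ! Suc d" unfolding restr_part_def by blast+
      then show "B \<in> (\<lambda>i. {i}) ` {1..card J}" using sing unfolding D(5) by blast
    next
      fix B assume B: "B \<in> (\<lambda>i. {i}) ` {1..card J}"
      then have "B \<subseteq> {1..card J}" "\<exists>i\<in>{1..card J}. B = {i}" by blast+
      then have "emb J ` B \<in> c ! Suc d" using sing unfolding D(5) by blast
      then show "B \<in> restr_part J (c ! Suc d)"
        using \<open>B \<subseteq> {1..card J}\<close> unfolding restr_part_def by blast
    qed
    then show "restr J c ! d = (\<lambda>i. {i}) ` {1..card J}" using nth[of d] by simp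
  qed
qed

text \<open>Every partition after the first is the union of its transported traces on the blocks of
  the second, so these blocks and the restricted chains determine it.\<close>

lemma restr_inj:
  assumes c: "c \<in> partition_chains n (Suc d)" and c': "c' \<in> partition_chains n (Suc d)"
    and "c ! 1 = c' ! 1" "\<And>J. J \<in> c ! 1 \<Longrightarrow> restr J c = restr J c'"
  shows "c = c'"
proof (rule nth_equalityI)
  note D = partition_chainsD[OF c] and D' = partition_chainsD[OF c']
  show "length c = length c'" using D(1) D'(1) by simp
  fix i assume i: "i < length c"
  show "c ! i = c' ! i"
  proof (cases i)
    case 0 then show ?thesis using D(4) D'(4) by simp
  next
    case (Suc j)
    have fin: "finite J" if "J \<in> c ! 1" for J
      using partition_on_block_finite[OF D(6) that] by simp
    have ref: "\<exists>J\<in>c ! 1. B \<subseteq> J" if "B \<in> c ! i \<or> B \<in> c' ! i" for B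
      using partition_chains_refines[OF c, of i 1] partition_chains_refines[OF c', of i 1] that i Suc D(1)
        assms(3) unfolding refines_def by (metis One_nat_def Suc_le_mono le0 less_Suc_eq_le)
    have eq: "restr_part J (c ! i) = restr_part J (c' ! i)" if "J \<in> c ! 1" for J
      using arg_cong[OF assms(4)[OF that], of "\<lambda>l. l ! j"] i Suc D(1) D'(1)
      by (simp add: restr_def nth_tl)
    have "c ! i = (\<Union>J\<in>c ! 1. (`) (emb J) ` restr_part J (c ! i))"
      by (rule restr_part_glue) (use fin ref in blast)+
    also have "\<dots> = (\<Union>J\<in>c ! 1. (`) (emb J) ` restr_part J (c' ! i))"
      by (rule SUP_cong[OF HOL.refl]) (simp only: eq)
    also have "\<dots> = c' ! i"
      by (rule restr_part_glue[symmetric]) (use fin ref in blast)+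
    finally show ?thesis .
  qed
qed

text \<open>A local-to-global converse of \<open>restr_chain\<close>: every entry below the top is
  the union of its transported traces, so blockwise conditions suffice. It is used both to construct
  chains and to decide whether a face is still a chain.\<close>

lemma chain_glue:
  assumes len: "length c = Suc (Suc d)" and top: "c ! 0 = {{1..n}}" and n: "n \<ge> 1"
    and \<pi>: "partition_on {1..n} \<pi>"
    and sub: "\<And>i B. i \<le> d \<Longrightarrow> B \<in> c ! Suc i \<Longrightarrow> \<exists>J\<in>\<pi>. B \<subseteq> J"
    and loc: "\<And>J. J \<in> \<pi> \<Longrightarrow> restr J c \<in> partition_chains (card J) d"
  shows "c \<in> partition_chains n (Suc d)" and "c ! 1 = \<pi>"
proof -
  have blk: "J \<subseteq> {1..n} \<and> finite J" if "J \<in> \<pi>" for J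
    using partition_on_block(1)[OF \<pi> that] partition_on_block_finite[OF \<pi> that] by blast
  have nth: "restr J c ! i = restr_part J (c ! Suc i)" if "i \<le> d" for i J
    using that len by (simp add: restr_def nth_tl)
  have glue: "c ! Suc i = (\<Union>J\<in>\<pi>. (`) (emb J) ` (restr J c ! i))" if "i \<le> d" for i
    unfolding nth[OF that] by (rule restr_part_glue) (use blk sub[OF that] in blast)+
  note L = partition_chainsD[OF loc]
  have mem: "emb J ` B \<subseteq> J" if "J \<in> \<pi>" "B \<in> restr J c ! i" "i \<le> d" for J B i
    using partition_on_block(1)[OF L(6)[OF that(1,3)] that(2)] emb_in blk[OF that(1)] by blast
  have P: "partition_on {1..n} (c ! Suc i)" if i: "i \<le> d" for i
  proof (rule partition_onI)
    have "\<Union>(c ! Suc i) = (\<Union>J\<in>\<pi>. emb J ` \<Union>(restr J c ! i))"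
      unfolding glue[OF i] by blast
    also have "\<dots> = (\<Union>J\<in>\<pi>. J)"
    proof (rule SUP_cong[OF HOL.refl])
      fix J assume J: "J \<in> \<pi>"
      have "\<Union>(restr J c ! i) = {1..card J}" using L(6)[OF J i] by (simp add: partition_on_def)
      then show "emb J ` \<Union>(restr J c ! i) = J" using blk[OF J] emb_image by simp
    qed
    finally show "\<Union>(c ! Suc i) = {1..n}" using \<pi> by (simp add: partition_on_def)
  next
    fix p q assume "p \<in> c ! Suc i" "q \<in> c ! Suc i" and ne: "p \<noteq> q"
    then obtain J B J' B' where p: "J \<in> \<pi>" "B \<in> restr J c ! i" "p = emb J ` B"
      and q: "J' \<in> \<pi>" "B' \<in> restr J' c ! i" "q = emb J' ` B'" unfolding glue[OF i] by blast
    show "disjnt p q"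
    proof (cases "J = J'")
      case True
      then have "disjnt B B'" using p q ne partition_on_block_disjnt[OF L(6)[OF p(1) i], of B B'] by blast
      moreover have "B \<subseteq> {1..card J}" "B' \<subseteq> {1..card J}"
        using p q True partition_on_block(1)[OF L(6)[OF p(1) i]] by auto
      ultimately show ?thesis
        using inj_on_image_Int[OF bij_betw_imp_inj_on[OF bij_emb], of J B B'] blk[OF p(1)] p(3) q(3) True
        by (auto simp: disjnt_def)
    next
      case False
      then have "disjnt J J'" using partition_on_block_disjnt[OF \<pi> p(1) q(1)] by blast
      then show ?thesis using mem[OF p(1,2) i] mem[OF q(1,2) i] unfolding p(3) q(3) disjnt_def by blast
    qed
  next
    show "{} \<notin> c ! Suc i"
    proof
      assume "{} \<in> c ! Suc i"
      then obtain J B where J: "J \<in> \<pi>" and "B \<in> restr J c ! i" "{} = emb J ` B"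
        unfolding glue[OF i] by blast
      then show False using partition_on_block(2)[OF L(6)[OF J i]] by blast
    qed
  qed
  have top': "partition_on {1..n} {{1..n}}" using n by (auto simp: partition_on_def)
  show "c ! 1 = \<pi>"
  proof -
    \<comment> \<open>Each restricted chain starts with a single block, so the second entry
      reassembles \<open>\<pi>\<close> itself.\<close>
    have "c ! 1 = (\<Union>J\<in>\<pi>. (`) (emb J) ` {{1..card J}})" using glue[of 0] L(4) by simp
    also have "\<dots> = (\<Union>J\<in>\<pi>. {J})" by (rule SUP_cong[OF HOL.refl]) (simp only: emb_image blk image_insert image_empty)
    finally show ?thesis by simp
  qed
  show "c \<in> partition_chains n (Suc d)"
  proof (rule partition_chainsI)
    show "length c = Suc (Suc d)" by fact
    show "partition_on {1..n} l" if l: "l \<in> set c" for l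
    proof -
      obtain i where "i < Suc (Suc d)" "l = c ! i" using l len by (auto simp: in_set_conv_nth)
      then show ?thesis using P[of "i - 1"] top top' by (cases i) simp_all
    qed
    show "refines {1..n} (c ! Suc i) (c ! i)" if "i < Suc d" for i
    proof (cases i)
      case 0
      then show ?thesis using P[of 0] partition_on_block(1)[OF P[of 0]] top top' by (simp add: refines_def)
    next
      case (Suc k)
      then have k: "k < d" using that by simp
      have "\<exists>Y\<in>c ! Suc k. X \<subseteq> Y" if X: "X \<in> c ! Suc (Suc k)" for X
      proof -
        obtain J B where JB: "J \<in> \<pi>" "B \<in> restr J c ! Suc k" "X = emb J ` B"
          using X k unfolding glue[OF Suc_leI[OF k]] by blast
        then obtain B' where "B' \<in> restr J c ! k" "B \<subseteq> B'"
          using L(3)[OF JB(1) k] unfolding refines_def by blast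
        then show ?thesis using JB k unfolding glue[OF less_imp_le[OF k]] by blast
      qed
      then show ?thesis using P[of k] P[of "Suc k"] k Suc by (simp add: refines_def)
    qed
    show "c ! 0 = {{1..n}}" by fact
    have "c ! Suc d = (\<Union>J\<in>\<pi>. (`) (emb J) ` (\<lambda>i. {i}) ` {1..card J})"
      unfolding glue[OF order_refl] using L(5) by simp
    also have "\<dots> = (\<Union>J\<in>\<pi>. (\<lambda>i. {i}) ` emb J ` {1..card J})" by (simp add: image_image)
    also have "\<dots> = (\<Union>J\<in>\<pi>. (\<lambda>i. {i}) ` J)"
      by (rule SUP_cong[OF HOL.refl]) (simp only: emb_image blk image_insert image_empty)
    also have "\<dots> = (\<lambda>i. {i}) ` \<Union>\<pi>" by blast
    finally show "c ! Suc d = (\<lambda>i. {i}) ` {1..n}" using \<pi> by (simp add: partition_on_def)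
  qed
qed

text \<open>The existence half of the correspondence between chains and partitions equipped with a
  chain on every block; \<open>restr_inj\<close> is the uniqueness half.\<close>

lemma chain_exists:
  assumes n: "n \<ge> 1" and \<pi>: "partition_on {1..n} \<pi>"
    and loc: "\<And>J. J \<in> \<pi> \<Longrightarrow> g J \<in> partition_chains (card J) d"
  shows "\<exists>c\<in>partition_chains n (Suc d). c ! 1 = \<pi> \<and> (\<forall>J\<in>\<pi>. restr J c = g J)"
proof -
  define c where "c = {{1..n}} # map (\<lambda>i. \<Union>J\<in>\<pi>. (`) (emb J) ` (g J ! i)) [0..<Suc d]"
  have len: "length c = Suc (Suc d)" by (simp add: c_def)
  have nth: "c ! Suc i = (\<Union>J\<in>\<pi>. (`) (emb J) ` (g J ! i))" if "i \<le> d" for i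
    using that by (simp add: c_def del: upt_Suc)
  have blk: "J \<subseteq> {1..n} \<and> finite J" if "J \<in> \<pi>" for J
    using partition_on_block(1)[OF \<pi> that] partition_on_block_finite[OF \<pi> that] by blast
  note L = partition_chainsD[OF loc]
  have sub: "B \<subseteq> {1..card J}" "B \<noteq> {}" if "J \<in> \<pi>" "i \<le> d" "B \<in> g J ! i" for J i B
    using partition_on_block[OF L(6)[OF that(1,2)] that(3)] by auto
  have mem: "emb J ` B \<subseteq> J" if "J \<in> \<pi>" "i \<le> d" "B \<in> g J ! i" for J i B
    using sub[OF that] blk[OF that(1)] emb_in by blast
  have restr: "restr J c = g J" if J: "J \<in> \<pi>" for J
  proof (rule nth_equalityI)
    show "length (restr J c) = length (g J)" using L(1)[OF J] len by (simp add: restr_def)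
    fix i assume "i < length (restr J c)"
    then have i: "i \<le> d" using len by (simp add: restr_def)
    have "restr_part J (c ! Suc i) = g J ! i"
    proof (intro equalityI subsetI)
      fix B assume "B \<in> restr_part J (c ! Suc i)"
      then obtain J' B' where B: "B \<subseteq> {1..card J}" "J' \<in> \<pi>" "B' \<in> g J' ! i" "emb J ` B = emb J' ` B'"
        unfolding nth[OF i] by (auto simp: restr_part_def)
      \<comment> \<open>A transported block inside \<open>J\<close> must come from \<open>J\<close>,
        since it is nonempty and the members of \<open>\<pi>\<close> are disjoint. No foreign block
        enters the trace on \<open>J\<close>.\<close>
      have "emb J' ` B' \<subseteq> J'" "emb J ` B \<subseteq> J" "B' \<noteq> {}"
        using mem[OF B(2) i B(3)] sub(2)[OF B(2) i B(3)] B(1) emb_in blk[OF J] by blast+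
      then obtain x where "x \<in> B'" by blast
      then have "emb J' x \<in> J \<inter> J'"
        using B(4) \<open>emb J' ` B' \<subseteq> J'\<close> \<open>emb J ` B \<subseteq> J\<close> by blast
      then have "J \<inter> J' \<noteq> {}" by blast
      then have "J' = J" using partition_on_block_eq[OF \<pi> J B(2)] by simp
      then have "B = B'"
        using B(1,4) sub(1)[OF B(2) i B(3)] blk[OF J]
          inj_on_image_eq_iff[OF bij_betw_imp_inj_on[OF bij_emb], of J B B'] by simp
      then show "B \<in> g J ! i" using B \<open>J' = J\<close> by simp
    next
      fix B assume "B \<in> g J ! i"
      then show "B \<in> restr_part J (c ! Suc i)"
        using sub(1)[OF J i] J unfolding nth[OF i] by (auto simp: restr_part_def)
    qed
    then show "restr J c ! i = g J ! i" using i len by (simp add: restr_def nth_tl)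
  qed
  have sub': "\<exists>J\<in>\<pi>. B \<subseteq> J" if i: "i \<le> d" and B: "B \<in> c ! Suc i" for i B
  proof -
    obtain J B' where "J \<in> \<pi>" "B' \<in> g J ! i" "B = emb J ` B'"
      using B unfolding nth[OF i] by blast
    then show ?thesis using mem[OF _ i] by blast
  qed
  have top: "c ! 0 = {{1..n}}" by (simp add: c_def)
  have loc': "restr J c \<in> partition_chains (card J) d" if "J \<in> \<pi>" for J
    unfolding restr[OF that] by (rule loc[OF that])
  note glue = chain_glue[OF len top n \<pi> sub' loc']
  show ?thesis
    by (intro bexI[of _ c] conjI ballI glue restr)
qed

section \<open>The composition product\<close>

lemma decomp_iff:
  "decomp n Js \<longleftrightarrow> (\<forall>i<length Js. \<forall>j<length Js. i \<noteq> j \<longrightarrow> Js ! i \<inter> Js ! j = {}) \<and> \<Union>(set Js) = {1..n}"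
proof -
  have "Js ! i \<inter> Js ! j = {}" if H: "\<forall>i<length Js. \<forall>j<i. Js ! i \<inter> Js ! j = {}"
    and "i < length Js" "j < length Js" "i \<noteq> j" for i j
  proof (cases "j < i")
    case True
    then show ?thesis using H that(2) by blast
  next
    case False
    then have "Js ! j \<inter> Js ! i = {}" using H that(3,4) by auto
    then show ?thesis by blast
  qed
  moreover have "Js ! i \<inter> Js ! j = {}"
    if H: "\<forall>i<length Js. \<forall>j<length Js. i \<noteq> j \<longrightarrow> Js ! i \<inter> Js ! j = {}"
      and "i < length Js" "j < i" for i j
    using H[rule_format, of i j] that(2,3) by simp
  ultimately show ?thesis unfolding decomp_def by blast
qed

lemma length_perm_factors [simp]: "length (perm_factors \<sigma> ys) = length ys"
  by (simp add: perm_factors_def del: upt_Suc)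

lemma perm_factors_nth:
  "i < length ys \<Longrightarrow> perm_factors \<sigma> ys ! i = ys ! (\<sigma> (Suc i) - 1)"
  by (simp add: perm_factors_def del: upt_Suc)

lemma mset_perm_factors:
  assumes "\<sigma> permutes {1..length ys}" shows "mset (perm_factors \<sigma> ys) = mset ys"
proof -
  have ys: "mset ys = image_mset (\<lambda>i. ys ! (i - 1)) (mset_set {1..length ys})"
  proof -
    have "map (\<lambda>i. ys ! (i - 1)) [1..<Suc (length ys)] = ys"
      by (rule nth_equalityI) (simp_all del: upt_Suc)
    then have "mset ys = mset (map (\<lambda>i. ys ! (i - 1)) [1..<Suc (length ys)])" by simp
    also have "\<dots> = image_mset (\<lambda>i. ys ! (i - 1)) (mset_set {1..length ys})"
      by (simp only: mset_map mset_upt atLeastLessThanSuc_atLeastAtMost)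
    finally show ?thesis .
  qed
  have "mset (perm_factors \<sigma> ys) = image_mset (\<lambda>i. ys ! (\<sigma> i - 1)) (mset_set {1..length ys})"
    by (simp only: perm_factors_def mset_map mset_upt atLeastLessThanSuc_atLeastAtMost)
  also have "\<dots> = image_mset (\<lambda>i. ys ! (i - 1)) (image_mset \<sigma> (mset_set {1..length ys}))"
    by (simp add: multiset.map_comp o_def)
  also have "image_mset \<sigma> (mset_set {1..length ys}) = mset_set {1..length ys}"
    using permutes_image[OF assms] permutes_inj_on[OF assms] by (simp add: image_mset_mset_set)
  finally show ?thesis using ys by simp
qed

text \<open>This makes every reordering of a list accessible to the coinvariance rule, which is
  phrased through permutations of positions.\<close>

lemma perm_factors_ex:
  assumes "mset ys = mset ys'"
  shows "\<exists>\<sigma>. \<sigma> permutes {1..length ys} \<and> ys' = perm_factors \<sigma> ys"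
proof -
  obtain f where f: "f permutes {..<length ys}" "permute_list f ys = ys'"
    using mset_eq_permutation[OF assms[symmetric]] by blast
  \<comment> \<open>List positions start at 0 while the symmetric group permutes
    \<open>{1..n}\<close>, hence the shift by one.\<close>
  define \<sigma> where "\<sigma> i = (if i \<in> {1..length ys} then Suc (f (i - 1)) else i)" for i
  have fin: "f i < length ys" if "i < length ys" for i
    using permutes_in_image[OF f(1), of i] that by simp
  have "inj_on \<sigma> {1..length ys}"
  proof (rule inj_onI)
    fix i j assume "i \<in> {1..length ys}" "j \<in> {1..length ys}" "\<sigma> i = \<sigma> j"
    then show "i = j"
      using injD[OF permutes_inj[OF f(1)], of "i - 1" "j - 1"] by (auto simp: \<sigma>_def)
  qed
  moreover have "\<sigma> ` {1..length ys} \<subseteq> {1..length ys}"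
  proof
    fix k assume "k \<in> \<sigma> ` {1..length ys}"
    then obtain i where i: "i \<in> {1..length ys}" "k = Suc (f (i - 1))" by (auto simp: \<sigma>_def)
    then have "i - 1 < length ys" by auto
    then show "k \<in> {1..length ys}" using fin[of "i - 1"] i(2) by auto
  qed
  ultimately have "bij_betw \<sigma> {1..length ys} {1..length ys}"
    by (intro bij_betw_imageI endo_inj_surj) auto
  then have "\<sigma> permutes {1..length ys}"
    by (rule bij_imp_permutes) (auto simp: \<sigma>_def)
  moreover have "ys' = perm_factors \<sigma> ys"
    using f(2) by (intro nth_equalityI) (auto simp: perm_factors_nth permute_list_def \<sigma>_def)
  ultimately show ?thesis by blast
qed

lemma perm_factors_map: "perm_factors \<sigma> (map f ys) = map f (perm_factors \<sigma> ys)"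
  if "\<sigma> permutes {1..length ys}"
proof (rule nth_equalityI)
  fix i assume "i < length (perm_factors \<sigma> (map f ys))"
  then have i: "i < length ys" by simp
  then have "\<sigma> (Suc i) - 1 < length ys"
    using permutes_in_image[OF that, of "Suc i"] by auto
  then show "perm_factors \<sigma> (map f ys) ! i = map f (perm_factors \<sigma> ys) ! i"
    using i by (simp add: perm_factors_nth)
qed simp

lemma decomp_perm_factors:
  assumes "\<sigma> permutes {1..length Js}" "decomp n Js"
  shows "decomp n (perm_factors \<sigma> Js)"
proof -
  have "set (perm_factors \<sigma> Js) = set Js"
    using mset_perm_factors[OF assms(1)] by (rule mset_eq_setD)
  moreover have "Js ! (\<sigma> (Suc i) - 1) \<inter> Js ! (\<sigma> (Suc j) - 1) = {}"
    if "i < length Js" "j < length Js" "i \<noteq> j" for i j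
  proof -
    have "\<sigma> (Suc i) \<noteq> \<sigma> (Suc j)" using permutes_inj[OF assms(1)] that by (auto dest: injD)
    moreover have "\<sigma> (Suc i) \<in> {1..length Js}" "\<sigma> (Suc j) \<in> {1..length Js}"
      using permutes_in_image[OF assms(1)] that by auto
    ultimately have "\<sigma> (Suc i) - 1 < length Js" "\<sigma> (Suc j) - 1 < length Js" "\<sigma> (Suc i) - 1 \<noteq> \<sigma> (Suc j) - 1"
      by auto
    then show ?thesis using assms(2) unfolding decomp_iff by blast
  qed
  ultimately show ?thesis using assms(2) by (simp add: decomp_iff perm_factors_nth)
qed

section \<open>The module of combinations modulo relations and its universal property\<close>

locale comp_data =
  fixes K :: "('k, 'm) ring_scheme" and M N :: "'k sigma_mod"
  assumes cring_K: "cring K"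
    and mod_M: "\<And>n. module K (obj M n)"
    and mod_N: "\<And>n. module K (obj N n)"
    and act_M: "\<And>n \<sigma> x. \<sigma> permutes {1..n} \<Longrightarrow> x \<in> carrier (obj M n) \<Longrightarrow> act M n \<sigma> x \<in> carrier (obj M n)"
begin

sublocale K: cring K by (rule cring_K)

lemmas closed_M = abelian_groupE(1)[OF module.axioms(2)[OF mod_M]] module.smult_closed[OF mod_M]
lemmas closed_N = abelian_groupE(1)[OF module.axioms(2)[OF mod_N]] module.smult_closed[OF mod_N]

lemma tensors_left: "(x, ys) \<in> tensors M N n \<Longrightarrow> x' \<in> carrier (obj M (length ys)) \<Longrightarrow> (x', ys) \<in> tensors M N n"
  by (auto simp: tensors_def)

lemma tensors_right:
  "(x, us @ (J, y) # vs) \<in> tensors M N n \<Longrightarrow> y' \<in> carrier (obj N (card J)) \<Longrightarrow>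
    (x, us @ (J, y') # vs) \<in> tensors M N n"
  by (auto simp: tensors_def)

lemma tensorsD:
  assumes "(x, ys) \<in> tensors M N n"
  shows "decomp n (map fst ys)" "x \<in> carrier (obj M (length ys))"
    "(J, y) \<in> set ys \<Longrightarrow> y \<in> carrier (obj N (card J))"
  using assms by (auto simp: tensors_def)

lemma tensors_perm:
  assumes "(x, ys) \<in> tensors M N n" "\<sigma> permutes {1..length ys}"
  shows "(x, perm_factors \<sigma> ys) \<in> tensors M N n"
proof -
  have "set (perm_factors \<sigma> ys) = set ys"
    using mset_perm_factors[OF assms(2)] by (rule mset_eq_setD)
  moreover have "decomp n (map fst (perm_factors \<sigma> ys))"
    using decomp_perm_factors[of \<sigma> "map fst ys" n] assms tensorsD(1)[OF assms(1)]
    by (simp add: perm_factors_map)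
  ultimately show ?thesis using assms(1) by (simp add: tensors_def)
qed

lemma combs_simps [simp]:
  "[] \<in> combs K M N n"
  "(a, g) # t \<in> combs K M N n \<longleftrightarrow> a \<in> carrier K \<and> g \<in> tensors M N n \<and> t \<in> combs K M N n"
  "t @ u \<in> combs K M N n \<longleftrightarrow> t \<in> combs K M N n \<and> u \<in> combs K M N n"
  by (auto simp: combs_def)

text \<open>Modules and action are closed, so the sums, multiples and translates formed in the rules
  stay inside \<open>tensors\<close>.\<close>

lemma comb_eq_combs: "comb_eq K M N n t u \<Longrightarrow> t \<in> combs K M N n \<and> u \<in> combs K M N n"
proof (induction rule: comb_eq.induct)
  case (left_add a x ys x')
  then show ?case by (auto intro: tensors_left closed_M dest: tensorsD(2))
next
  case (left_smult a c x ys)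
  then show ?case by (auto intro: tensors_left closed_M dest: tensorsD(2))
next
  case (right_add a x us J y vs y')
  then have "y \<in> carrier (obj N (card J))" "y' \<in> carrier (obj N (card J))"
    by (auto dest: tensorsD(3))
  then show ?case using right_add by (auto intro: tensors_right closed_N)
next
  case (right_smult a c x us J y vs)
  then have "y \<in> carrier (obj N (card J))"
    by (auto dest: tensorsD(3))
  then show ?case using right_smult by (auto intro: tensors_right closed_N)
next
  case (coinvariants a x ys \<sigma>)
  then show ?case
    using tensors_left[OF coinvariants(2) act_M[OF coinvariants(3) tensorsD(2)[OF coinvariants(2)]]]
      tensors_perm[OF coinvariants(2,3)] by simp
qed auto

text \<open>Equivalent combinations satisfy the same predicate and so receive the same chosen
  member; the choices thereby realise the quotient set.\<close>

lemma comb_class_eq_iff: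
  assumes "t \<in> combs K M N n" "u \<in> combs K M N n"
  shows "comb_class K M N n t = comb_class K M N n u \<longleftrightarrow> comb_eq K M N n t u"
proof
  have some: "comb_eq K M N n t (SOME u. comb_eq K M N n t u)" if "t \<in> combs K M N n" for t
    by (rule someI) (rule comb_eq.refl[OF that])
  assume "comb_class K M N n t = comb_class K M N n u"
  then show "comb_eq K M N n t u"
    using some[OF assms(1)] some[OF assms(2)] by (auto simp: comb_class_def intro: comb_eq.sym comb_eq.trans)
next
  assume "comb_eq K M N n t u"
  then have "comb_eq K M N n t v \<longleftrightarrow> comb_eq K M N n u v" for v
    by (blast intro: comb_eq.sym comb_eq.trans)
  then show "comb_class K M N n t = comb_class K M N n u" by (simp add: comb_class_def)
qed

lemma comb_class_eqI: "comb_eq K M N n t u \<Longrightarrow> comb_class K M N n t = comb_class K M N n u"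
  using comb_class_eq_iff comb_eq_combs by blast

lemma uncomb_class: "t \<in> combs K M N n \<Longrightarrow> comb_eq K M N n (uncomb (comb_class K M N n t)) t"
  unfolding comb_class_def by (auto intro!: comb_eq.sym[OF someI] comb_eq.refl)

text \<open>Exchanging neighbouring sublists, applied inside longer lists through
  \<open>append\<close>, generates all reorderings.\<close>

lemma comb_eq_mset:
  "mset t = mset u \<Longrightarrow> t \<in> combs K M N n \<Longrightarrow> comb_eq K M N n t u"
proof (induction t arbitrary: u)
  case Nil
  then show ?case by (auto intro: comb_eq.refl)
next
  case (Cons g t)
  then have "g \<in> set u" by (metis list.set_intros(1) mset_eq_setD)
  then obtain us vs where u: "u = us @ g # vs" by (meson split_list)
  have combs: "[g] \<in> combs K M N n" "t \<in> combs K M N n" using Cons.prems(2) by (cases g, simp)+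
  have eq: "comb_eq K M N n t (us @ vs)" using Cons combs u by simp
  then have uv: "us \<in> combs K M N n" "vs \<in> combs K M N n" using comb_eq_combs by fastforce+
  have "comb_eq K M N n ([g] @ t) ([g] @ (us @ vs))"
    by (rule comb_eq.append[OF comb_eq.refl[OF combs(1)] eq])
  moreover have "comb_eq K M N n (([g] @ us) @ vs) ((us @ [g]) @ vs)"
    by (rule comb_eq.append[OF comb_eq.commute[OF combs(1) uv(1)] comb_eq.refl[OF uv(2)]])
  ultimately show ?case using u comb_eq.trans by fastforce
qed

definition scale :: "'k \<Rightarrow> ('k \<times> 'b) list \<Rightarrow> ('k \<times> 'b) list" where
  "scale c t = map (\<lambda>(a, g). (c \<otimes>\<^bsub>K\<^esub> a, g)) t"

lemma scale_simps [simp]: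
  "scale c [] = []" "scale c ((a, g) # t) = (c \<otimes>\<^bsub>K\<^esub> a, g) # scale c t"
  "scale c (t @ u) = scale c t @ scale c u"
  by (simp_all add: scale_def)

lemma scale_combs: "c \<in> carrier K \<Longrightarrow> t \<in> combs K M N n \<Longrightarrow> scale c t \<in> combs K M N n"
  by (induction t) auto

text \<open>The rules carry arbitrary coefficients or are compatible with multiplication in the
  ring, so they are stable under scaling.\<close>

lemma comb_eq_scale:
  assumes "c \<in> carrier K" shows "comb_eq K M N n t u \<Longrightarrow> comb_eq K M N n (scale c t) (scale c u)"
proof (induction rule: comb_eq.induct)
  case (coeff_add a b g)
  then show ?case using comb_eq.coeff_add[of "c \<otimes>\<^bsub>K\<^esub> a" K "c \<otimes>\<^bsub>K\<^esub> b" g M N n] assms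
    by (simp add: K.r_distr)
next
  case (left_smult a b x ys)
  then show ?case using comb_eq.left_smult[of "c \<otimes>\<^bsub>K\<^esub> a" K b x ys M N n] assms
    by (simp add: K.m_assoc)
next
  case (right_smult a b x us J y vs)
  then show ?case using comb_eq.right_smult[of "c \<otimes>\<^bsub>K\<^esub> a" K b x us J y vs M N n] assms
    by (simp add: K.m_assoc)
next
  case (trans t u v)
  then show ?case by (blast intro: comb_eq.trans)
qed (use assms in \<open>auto intro: comb_eq.intros scale_combs\<close>)

lemma scale_scale:
  "a \<in> carrier K \<Longrightarrow> b \<in> carrier K \<Longrightarrow> t \<in> combs K M N n \<Longrightarrow> scale (a \<otimes>\<^bsub>K\<^esub> b) t = scale a (scale b t)"
  by (induction t) (auto simp: K.m_assoc)

lemma scale_one: "t \<in> combs K M N n \<Longrightarrow> scale \<one>\<^bsub>K\<^esub> t = t"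
  by (induction t) auto

text \<open>The two coefficients are separated term by term, and the interleaved result is then
  reordered.\<close>

lemma scale_add:
  assumes "a \<in> carrier K" "b \<in> carrier K"
  shows "t \<in> combs K M N n \<Longrightarrow> comb_eq K M N n (scale (a \<oplus>\<^bsub>K\<^esub> b) t) (scale a t @ scale b t)"
proof (induction t)
  case Nil
  then show ?case by (simp add: comb_eq.refl)
next
  case (Cons h t)
  obtain c g where h: "h = (c, g)" by (cases h)
  then have cg: "c \<in> carrier K" "g \<in> tensors M N n" "t \<in> combs K M N n" using Cons.prems by auto
  have "comb_eq K M N n ([((a \<oplus>\<^bsub>K\<^esub> b) \<otimes>\<^bsub>K\<^esub> c, g)] @ scale (a \<oplus>\<^bsub>K\<^esub> b) t)
      ([(a \<otimes>\<^bsub>K\<^esub> c, g), (b \<otimes>\<^bsub>K\<^esub> c, g)] @ (scale a t @ scale b t))"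
    using cg assms Cons.IH by (intro comb_eq.append) (auto simp: K.l_distr intro: comb_eq.coeff_add)
  moreover have "comb_eq K M N n ([(a \<otimes>\<^bsub>K\<^esub> c, g), (b \<otimes>\<^bsub>K\<^esub> c, g)] @ (scale a t @ scale b t))
      (((a \<otimes>\<^bsub>K\<^esub> c, g) # scale a t) @ ((b \<otimes>\<^bsub>K\<^esub> c, g) # scale b t))"
    using cg assms by (intro comb_eq_mset) (auto intro: scale_combs)
  ultimately show ?case using h comb_eq.trans by fastforce
qed

lemma scale_zero: "t \<in> combs K M N n \<Longrightarrow> comb_eq K M N n (scale \<zero>\<^bsub>K\<^esub> t) []"
proof (induction t)
  case (Cons h t)
  obtain c g where h: "h = (c, g)" by (cases h)
  then have "comb_eq K M N n ([(\<zero>\<^bsub>K\<^esub>, g)] @ scale \<zero>\<^bsub>K\<^esub> t) ([] @ [])"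
    using Cons by (intro comb_eq.append) (auto intro: comb_eq.coeff_zero)
  then show ?case using h Cons.prems by simp
qed (simp add: comb_eq.refl)

lemma comp_obj_simps:
  "carrier (comp_obj K M N n) = comb_class K M N n ` combs K M N n"
  "\<zero>\<^bsub>comp_obj K M N n\<^esub> = comb_class K M N n []"
  by (simp_all add: comp_obj_def)

lemma comp_obj_add:
  assumes "t \<in> combs K M N n" "u \<in> combs K M N n"
  shows "comb_class K M N n t \<oplus>\<^bsub>comp_obj K M N n\<^esub> comb_class K M N n u = comb_class K M N n (t @ u)"
  using comb_class_eqI[OF comb_eq.append[OF uncomb_class[OF assms(1)] uncomb_class[OF assms(2)]]]
  by (simp add: comp_obj_def)

lemma comp_obj_smult:
  assumes "t \<in> combs K M N n" "c \<in> carrier K"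
  shows "c \<odot>\<^bsub>comp_obj K M N n\<^esub> comb_class K M N n t = comb_class K M N n (scale c t)"
  using comb_class_eqI[OF comb_eq_scale[OF assms(2) uncomb_class[OF assms(1)]]]
  by (simp add: comp_obj_def scale_def)

text \<open>Scaling by -1 provides the additive inverses; the laws are checked on combinations and
  passed to classes.\<close>

lemma comp_obj_module: "module K (comp_obj K M N n)"
proof -
  have neg: "comb_eq K M N n (scale (\<ominus>\<^bsub>K\<^esub> \<one>\<^bsub>K\<^esub>) t @ t) []" if t: "t \<in> combs K M N n" for t
  proof -
    have "comb_eq K M N n (scale (\<ominus>\<^bsub>K\<^esub> \<one>\<^bsub>K\<^esub> \<oplus>\<^bsub>K\<^esub> \<one>\<^bsub>K\<^esub>) t) (scale (\<ominus>\<^bsub>K\<^esub> \<one>\<^bsub>K\<^esub>) t @ scale \<one>\<^bsub>K\<^esub> t)"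
      by (rule scale_add) (use t in auto)
    then show ?thesis
      using scale_zero[OF t] by (auto simp: K.l_neg scale_one[OF t] intro: comb_eq.sym comb_eq.trans)
  qed
  have "abelian_group (comp_obj K M N n)"
  proof (rule abelian_groupI)
    fix x assume "x \<in> carrier (comp_obj K M N n)"
    then obtain t where t: "t \<in> combs K M N n" "x = comb_class K M N n t" by (auto simp: comp_obj_simps)
    have "comb_class K M N n (scale (\<ominus>\<^bsub>K\<^esub> \<one>\<^bsub>K\<^esub>) t) \<in> carrier (comp_obj K M N n)"
      using t by (auto simp: comp_obj_simps intro: scale_combs)
    then show "\<exists>y\<in>carrier (comp_obj K M N n). y \<oplus>\<^bsub>comp_obj K M N n\<^esub> x = \<zero>\<^bsub>comp_obj K M N n\<^esub>"
      using t neg[OF t(1)] by (auto simp: comp_obj_simps comp_obj_add scale_combs intro!: comb_class_eqI)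
  qed (auto simp: comp_obj_simps comp_obj_add intro: comb_class_eqI[OF comb_eq.commute])
  then show ?thesis
    by (intro moduleI cring_K)
      (auto simp: comp_obj_simps comp_obj_add comp_obj_smult scale_combs scale_scale scale_one
        intro: comb_class_eqI[OF scale_add])
qed

lemma pure_closed: "(x, ys) \<in> tensors M N n \<Longrightarrow> pure K M N n x ys \<in> carrier (comp_obj K M N n)"
  by (simp add: pure_def comp_obj_simps)

lemma smult_pure:
  assumes "a \<in> carrier K" "(x, ys) \<in> tensors M N n"
  shows "a \<odot>\<^bsub>comp_obj K M N n\<^esub> pure K M N n x ys = comb_class K M N n [(a, x, ys)]"
  using assms by (simp add: pure_def comp_obj_smult)

lemma pure_left_add:
  assumes "(x, ys) \<in> tensors M N n" "(x', ys) \<in> tensors M N n"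
  shows "pure K M N n (x \<oplus>\<^bsub>obj M (length ys)\<^esub> x') ys =
    pure K M N n x ys \<oplus>\<^bsub>comp_obj K M N n\<^esub> pure K M N n x' ys"
  using comb_class_eqI[OF comb_eq.left_add[OF K.one_closed assms]] assms
  by (simp add: pure_def comp_obj_add)

lemma pure_left_smult:
  assumes "c \<in> carrier K" "(x, ys) \<in> tensors M N n"
  shows "pure K M N n (c \<odot>\<^bsub>obj M (length ys)\<^esub> x) ys = c \<odot>\<^bsub>comp_obj K M N n\<^esub> pure K M N n x ys"
  using comb_class_eqI[OF comb_eq.left_smult[OF K.one_closed assms]] assms
  by (simp add: smult_pure) (simp add: pure_def)

lemma pure_right_add:
  assumes "(x, us @ (J, y) # vs) \<in> tensors M N n" "(x, us @ (J, y') # vs) \<in> tensors M N n"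
  shows "pure K M N n x (us @ (J, y \<oplus>\<^bsub>obj N (card J)\<^esub> y') # vs) =
    pure K M N n x (us @ (J, y) # vs) \<oplus>\<^bsub>comp_obj K M N n\<^esub> pure K M N n x (us @ (J, y') # vs)"
  using comb_class_eqI[OF comb_eq.right_add[OF K.one_closed assms]] assms
  by (simp add: pure_def comp_obj_add)

lemma pure_right_smult:
  assumes "c \<in> carrier K" "(x, us @ (J, y) # vs) \<in> tensors M N n"
  shows "pure K M N n x (us @ (J, c \<odot>\<^bsub>obj N (card J)\<^esub> y) # vs) =
    c \<odot>\<^bsub>comp_obj K M N n\<^esub> pure K M N n x (us @ (J, y) # vs)"
  using comb_class_eqI[OF comb_eq.right_smult[OF K.one_closed assms]] assms
  by (simp add: smult_pure) (simp add: pure_def)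

text \<open>Zero is 0 times any vector, and scalars may be moved out of the tensor.\<close>

lemma pure_left_zero:
  assumes "(x, ys) \<in> tensors M N n"
  shows "pure K M N n \<zero>\<^bsub>obj M (length ys)\<^esub> ys = \<zero>\<^bsub>comp_obj K M N n\<^esub>"
proof -
  have "pure K M N n (\<zero>\<^bsub>K\<^esub> \<odot>\<^bsub>obj M (length ys)\<^esub> x) ys = \<zero>\<^bsub>K\<^esub> \<odot>\<^bsub>comp_obj K M N n\<^esub> pure K M N n x ys"
    by (rule pure_left_smult) (use assms in auto)
  then show ?thesis
    using module.smult_l_null[OF mod_M] module.smult_l_null[OF comp_obj_module]
      tensorsD(2)[OF assms] pure_closed[OF assms] by simp
qed

lemma pure_right_zero:
  assumes "(x, us @ (J, y) # vs) \<in> tensors M N n"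
  shows "pure K M N n x (us @ (J, \<zero>\<^bsub>obj N (card J)\<^esub>) # vs) = \<zero>\<^bsub>comp_obj K M N n\<^esub>"
proof -
  have "pure K M N n x (us @ (J, \<zero>\<^bsub>K\<^esub> \<odot>\<^bsub>obj N (card J)\<^esub> y) # vs) =
      \<zero>\<^bsub>K\<^esub> \<odot>\<^bsub>comp_obj K M N n\<^esub> pure K M N n x (us @ (J, y) # vs)"
    by (rule pure_right_smult) (use assms in auto)
  then show ?thesis
    using module.smult_l_null[OF mod_N] module.smult_l_null[OF comp_obj_module]
      tensorsD(3)[OF assms, of J y] pure_closed[OF assms] by simp
qed

lemma pure_perm:
  assumes "(x, ys) \<in> tensors M N n" "\<sigma> permutes {1..length ys}"
  shows "pure K M N n (act M (length ys) \<sigma> x) ys = pure K M N n x (perm_factors \<sigma> ys)"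
  unfolding pure_def by (rule comb_class_eqI[OF comb_eq.coinvariants[OF K.one_closed assms]])

lemma comp_obj_induct:
  assumes "u \<in> carrier (comp_obj K M N n)" "P \<zero>\<^bsub>comp_obj K M N n\<^esub>"
    and "\<And>u v. u \<in> carrier (comp_obj K M N n) \<Longrightarrow> v \<in> carrier (comp_obj K M N n) \<Longrightarrow>
        P u \<Longrightarrow> P v \<Longrightarrow> P (u \<oplus>\<^bsub>comp_obj K M N n\<^esub> v)"
    and "\<And>a u. a \<in> carrier K \<Longrightarrow> u \<in> carrier (comp_obj K M N n) \<Longrightarrow> P u \<Longrightarrow> P (a \<odot>\<^bsub>comp_obj K M N n\<^esub> u)"
    and "\<And>x ys. (x, ys) \<in> tensors M N n \<Longrightarrow> P (pure K M N n x ys)"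
  shows "P u"
proof -
  obtain t where "t \<in> combs K M N n" "u = comb_class K M N n t" using assms(1) by (auto simp: comp_obj_simps)
  moreover have "P (comb_class K M N n t)" if "t \<in> combs K M N n" for t
    using that
  proof (induction t)
    case Nil
    then show ?case using assms(2) by (simp add: comp_obj_simps)
  next
    case (Cons h t)
    obtain a x ys where h: "h = (a, x, ys)" by (cases h)
    then have *: "a \<in> carrier K" "(x, ys) \<in> tensors M N n" "t \<in> combs K M N n" using Cons.prems by auto
    then have "P (comb_class K M N n [(a, x, ys)])"
      using assms(4)[OF *(1) pure_closed[OF *(2)] assms(5)[OF *(2)]] smult_pure by simp
    then have "P (comb_class K M N n [(a, x, ys)] \<oplus>\<^bsub>comp_obj K M N n\<^esub> comb_class K M N n t)"
      using * Cons.IH by (intro assms(3)) (auto simp: comp_obj_simps)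
    then show ?case using * h by (simp add: comp_obj_add)
  qed
  ultimately show ?thesis by simp
qed

text \<open>The universal property of the composite. The list evaluation \<open>ev\<close> respects
  every rule of the relation: the hypotheses on \<open>g\<close> answer the multilinearity and
  coinvariance rules, the module laws of \<open>A\<close> the others. On a class, the chosen member
  is evaluated.\<close>

lemma comp_lift:
  assumes A: "module K A"
    and closed: "\<And>x ys. (x, ys) \<in> tensors M N n \<Longrightarrow> g x ys \<in> carrier A"
    and l_add: "\<And>x x' ys. (x, ys) \<in> tensors M N n \<Longrightarrow> (x', ys) \<in> tensors M N n \<Longrightarrow>
        g (x \<oplus>\<^bsub>obj M (length ys)\<^esub> x') ys = g x ys \<oplus>\<^bsub>A\<^esub> g x' ys"
    and l_smult: "\<And>c x ys. c \<in> carrier K \<Longrightarrow> (x, ys) \<in> tensors M N n \<Longrightarrow>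
        g (c \<odot>\<^bsub>obj M (length ys)\<^esub> x) ys = c \<odot>\<^bsub>A\<^esub> g x ys"
    and r_add: "\<And>x us J y y' vs. (x, us @ (J, y) # vs) \<in> tensors M N n \<Longrightarrow>
        (x, us @ (J, y') # vs) \<in> tensors M N n \<Longrightarrow>
        g x (us @ (J, y \<oplus>\<^bsub>obj N (card J)\<^esub> y') # vs) = g x (us @ (J, y) # vs) \<oplus>\<^bsub>A\<^esub> g x (us @ (J, y') # vs)"
    and r_smult: "\<And>c x us J y vs. c \<in> carrier K \<Longrightarrow> (x, us @ (J, y) # vs) \<in> tensors M N n \<Longrightarrow>
        g x (us @ (J, c \<odot>\<^bsub>obj N (card J)\<^esub> y) # vs) = c \<odot>\<^bsub>A\<^esub> g x (us @ (J, y) # vs)"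
    and perm: "\<And>x ys \<sigma>. (x, ys) \<in> tensors M N n \<Longrightarrow> \<sigma> permutes {1..length ys} \<Longrightarrow>
        g (act M (length ys) \<sigma> x) ys = g x (perm_factors \<sigma> ys)"
  shows "\<exists>f\<in>lin_maps K (comp_obj K M N n) A. \<forall>(x, ys)\<in>tensors M N n. f (pure K M N n x ys) = g x ys"
proof -
  interpret A: module K A by fact
  define ev where "ev t = foldr (\<lambda>(a, x, ys) s. a \<odot>\<^bsub>A\<^esub> g x ys \<oplus>\<^bsub>A\<^esub> s) t \<zero>\<^bsub>A\<^esub>" for t
  have ev_simps [simp]: "ev [] = \<zero>\<^bsub>A\<^esub>" "ev ((a, x, ys) # t) = a \<odot>\<^bsub>A\<^esub> g x ys \<oplus>\<^bsub>A\<^esub> ev t" for a x ys t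
    by (simp_all add: ev_def)
  have ev_closed [simp]: "ev t \<in> carrier A" if "t \<in> combs K M N n" for t
    using that by (induction t) (auto simp: closed)
  have ev_append: "ev (t @ u) = ev t \<oplus>\<^bsub>A\<^esub> ev u" if "t \<in> combs K M N n" "u \<in> combs K M N n" for t u
    using that by (induction t) (auto simp: A.a_assoc closed)
  have ev_scale: "ev (scale c t) = c \<odot>\<^bsub>A\<^esub> ev t" if "c \<in> carrier K" "t \<in> combs K M N n" for c t
    using that(2) by (induction t) (auto simp: that(1) closed A.smult_r_distr A.smult_assoc1)
  have ev_eq: "ev t = ev u" if "comb_eq K M N n t u" for t u
    using that
  proof (induction rule: comb_eq.induct)
    case (append t t' u u')
    then show ?case using comb_eq_combs by (auto simp: ev_append)
  next
    case (commute t u)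
    then show ?case by (simp add: ev_append A.a_comm)
  next
    case (coeff_zero g)
    then show ?case by (cases g) (simp add: closed)
  next
    case (coeff_add a b g)
    then show ?case by (cases g) (simp add: closed A.smult_l_distr)
  next
    case (left_add a x ys x')
    then show ?case by (simp add: closed l_add A.smult_r_distr)
  next
    case (left_smult a c x ys)
    then show ?case by (simp add: closed l_smult A.smult_assoc1)
  next
    case (right_add a x us J y vs y')
    then show ?case by (simp add: closed r_add A.smult_r_distr)
  next
    case (right_smult a c x us J y vs)
    then show ?case by (simp add: closed r_smult A.smult_assoc1)
  next
    case (coinvariants a x ys \<sigma>)
    then show ?case by (simp add: perm)
  qed simp_all
  define f where "f u = ev (uncomb u)" for u
  have f: "f (comb_class K M N n t) = ev t" if "t \<in> combs K M N n" for t
    using ev_eq[OF uncomb_class[OF that]] by (simp add: f_def)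
  have "f \<in> lin_maps K (comp_obj K M N n) A"
    by (rule lin_mapsI) (auto simp: comp_obj_simps f comp_obj_add comp_obj_smult ev_append ev_scale scale_combs)
  moreover have "f (pure K M N n x ys) = g x ys" if "(x, ys) \<in> tensors M N n" for x ys
    using that by (simp add: pure_def f closed)
  ultimately show ?thesis by blast
qed

text \<open>\<open>comp_lift\<close> is a choice, so its linearity and its values become available
  only through a proof that a suitable map exists.\<close>

lemma comp_lift_spec:
  assumes "\<exists>f\<in>lin_maps K (comp_obj K M N n) A. \<forall>(x, ys)\<in>tensors M N n. f (pure K M N n x ys) = g x ys"
  shows "comp_lift K M N n A g \<in> lin_maps K (comp_obj K M N n) A"
    and "(x, ys) \<in> tensors M N n \<Longrightarrow> comp_lift K M N n A g (pure K M N n x ys) = g x ys"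
proof -
  have "\<exists>f. f \<in> lin_maps K (comp_obj K M N n) A \<and> (\<forall>(x, ys)\<in>tensors M N n. f (pure K M N n x ys) = g x ys)"
    using assms by blast
  from someI_ex[OF this, folded comp_lift_def]
  show "comp_lift K M N n A g \<in> lin_maps K (comp_obj K M N n) A"
    and "(x, ys) \<in> tensors M N n \<Longrightarrow> comp_lift K M N n A g (pure K M N n x ys) = g x ys"
    by auto
qed

end

section \<open>Bases of composites with the commutative operad\<close>

text \<open>A hybrid argument: entries are exchanged for members of \<open>G\<close> one at a time,
  starting at the end of the list. In \<open>step\<close> the entries after the current one already
  lie in \<open>G\<close>, those before it are arbitrary.\<close>

lemma list_replace_induct:
  assumes step: "\<And>us z vs. set vs \<subseteq> G \<Longrightarrow> (\<And>z'. z' \<in> G \<Longrightarrow> P (us @ z' # vs)) \<Longrightarrow> P (us @ z # vs)"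
    and base: "\<And>zs. set zs \<subseteq> G \<Longrightarrow> P zs"
  shows "P zs"
proof -
  have "set vs \<subseteq> G \<longrightarrow> P (us @ vs)" for us vs
  proof (induction us arbitrary: vs rule: rev_induct)
    case Nil
    then show ?case using base by simp
  next
    case (snoc z us)
    then show ?case using step[of vs us z] by simp
  qed
  from this[of "[]" zs] show ?thesis by simp
qed

text \<open>A property compatible with linearity in each factor need only be checked when all
  factors are basis elements; the index sets stay fixed while factors are replaced.\<close>

lemma (in comp_data) tensors_basis_induct:
  assumes basis: "\<And>m. free_basis K (obj N m) (B m) (e m)"
    and T: "(x, ys) \<in> tensors M N n"
    and zero: "\<And>us J y vs. (x, us @ (J, y) # vs) \<in> tensors M N n \<Longrightarrow> P (us @ (J, \<zero>\<^bsub>obj N (card J)\<^esub>) # vs)"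
    and add: "\<And>us J y y' vs. (x, us @ (J, y) # vs) \<in> tensors M N n \<Longrightarrow>
        (x, us @ (J, y') # vs) \<in> tensors M N n \<Longrightarrow> P (us @ (J, y) # vs) \<Longrightarrow> P (us @ (J, y') # vs) \<Longrightarrow>
        P (us @ (J, y \<oplus>\<^bsub>obj N (card J)\<^esub> y') # vs)"
    and smult: "\<And>us J c y vs. c \<in> carrier K \<Longrightarrow> (x, us @ (J, y) # vs) \<in> tensors M N n \<Longrightarrow>
        P (us @ (J, y) # vs) \<Longrightarrow> P (us @ (J, c \<odot>\<^bsub>obj N (card J)\<^esub> y) # vs)"
    and base: "\<And>ys. (x, ys) \<in> tensors M N n \<Longrightarrow>
        (\<And>J y. (J, y) \<in> set ys \<Longrightarrow> \<exists>b\<in>B (card J). y = e (card J) b) \<Longrightarrow> P ys"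
  shows "P ys"
proof -
  let ?G = "{(J, y). \<exists>b\<in>B (card J). y = e (card J) b}"
  have "(x, ys) \<in> tensors M N n \<longrightarrow> P ys"
  proof (rule list_replace_induct[where G = ?G and P = "\<lambda>ys. (x, ys) \<in> tensors M N n \<longrightarrow> P ys"])
    fix us vs :: "(nat set \<times> 'k elt) list" and z :: "nat set \<times> 'k elt"
    assume IH: "\<And>z'. z' \<in> ?G \<Longrightarrow> (x, us @ z' # vs) \<in> tensors M N n \<longrightarrow> P (us @ z' # vs)"
    obtain J y where z: "z = (J, y)" by (cases z)
    show "(x, us @ z # vs) \<in> tensors M N n \<longrightarrow> P (us @ z # vs)"
    proof
      assume "(x, us @ z # vs) \<in> tensors M N n"
      then have T: "(x, us @ (J, y) # vs) \<in> tensors M N n" by (simp add: z)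
      have T': "(x, us @ (J, y') # vs) \<in> tensors M N n" if "y' \<in> carrier (obj N (card J))" for y'
        by (rule tensors_right[OF T that])
      have y: "y \<in> carrier (obj N (card J))" by (rule tensorsD(3)[OF T]) simp
      have "P (us @ (J, y) # vs)"
      proof (rule free_basis_induct[OF mod_N basis y, where P = "\<lambda>y. P (us @ (J, y) # vs)"])
        fix b assume b: "b \<in> B (card J)"
        then have "e (card J) b \<in> carrier (obj N (card J))"
          using basis[of "card J"] by (auto simp: free_basis_def)
        then show "P (us @ (J, e (card J) b) # vs)" using IH[of "(J, e (card J) b)"] T' b by auto
      next
        show "P (us @ (J, \<zero>\<^bsub>obj N (card J)\<^esub>) # vs)" by (rule zero[OF T])
        show "P (us @ (J, y \<oplus>\<^bsub>obj N (card J)\<^esub> y') # vs)"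
          if "y \<in> carrier (obj N (card J))" "y' \<in> carrier (obj N (card J))"
            "P (us @ (J, y) # vs)" "P (us @ (J, y') # vs)" for y y'
          by (rule add[OF T'[OF that(1)] T'[OF that(2)] that(3,4)])
        show "P (us @ (J, a \<odot>\<^bsub>obj N (card J)\<^esub> y) # vs)"
          if "a \<in> carrier K" "y \<in> carrier (obj N (card J))" "P (us @ (J, y) # vs)" for a y
          by (rule smult[OF that(1) T'[OF that(2)] that(3)])
      qed
      then show "P (us @ z # vs)" by (simp add: z)
    qed
  next
    fix zs :: "(nat set \<times> 'k elt) list" assume "set zs \<subseteq> ?G"
    then show "(x, zs) \<in> tensors M N n \<longrightarrow> P zs" by (intro impI base) auto
  qed
  then show ?thesis using T by blast
qed

section \<open>Tensors with the commutative operad on the left\<close>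

lemma obj_com_mod [simp]: "obj (com_mod K) n = (if n = 0 then zero_mod K else ground_mod K)"
  and act_com_mod [simp]: "act (com_mod K) n w x = x"
  and obj_unit_mod [simp]: "obj (unit_mod K) n = (if n = 1 then ground_mod K else zero_mod K)"
  and act_unit_mod [simp]: "act (unit_mod K) n w x = x"
  by (simp_all add: com_mod_def unit_mod_def)

lemma obj_comp [simp]: "obj (comp K M N) = comp_obj K M N"
  by (simp add: comp_def)

lemma comp_data_com:
  "cring K \<Longrightarrow> (\<And>n. module K (obj X n)) \<Longrightarrow> comp_data K (com_mod K) X"
  by (simp add: comp_data_def ground_mod_module zero_mod_module)

lemma comp_data_unit:
  "cring K \<Longrightarrow> (\<And>n. module K (obj X n)) \<Longrightarrow> comp_data K (unit_mod K) X"
  by (simp add: comp_data_def ground_mod_module zero_mod_module)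

text \<open>Blocks of a partition are unordered while tensors are lists. With the commutative operad
  on the left, the order picked here does not affect the tensor, by
  \<open>pure_mset\<close>.\<close>

definition enum_set :: "'a set \<Rightarrow> 'a list" where
  "enum_set A = (SOME xs. distinct xs \<and> set xs = A)"

lemma enum_set: "finite A \<Longrightarrow> distinct (enum_set A) \<and> set (enum_set A) = A"
  unfolding enum_set_def by (rule someI_ex) (metis finite_distinct_list)

definition comp_basis ::
  "('k, 'm) ring_scheme \<Rightarrow> 'k sigma_mod \<Rightarrow> (nat \<Rightarrow> nat set set list \<Rightarrow> 'k elt) \<Rightarrow>
    nat \<Rightarrow> nat set set list \<Rightarrow> 'k elt" where
  "comp_basis K X e n c = pure K (com_mod K) X n (Scal \<one>\<^bsub>K\<^esub>)
     (map (\<lambda>J. (J, e (card J) (restr J c))) (enum_set (c ! 1)))"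

lemma partition_chains_pos: "c \<in> partition_chains n d \<Longrightarrow> n \<ge> 1"
  using partition_chains_empty[of d] by (cases n) auto

locale com_data =
  fixes K :: "('k, 'm) ring_scheme" and X :: "'k sigma_mod"
  assumes cring: "cring K" and mod_X: "\<And>n. module K (obj X n)"
begin

sublocale comp_data K "com_mod K" X
  by (rule comp_data_com[OF cring mod_X])

abbreviation "pureC \<equiv> pure K (com_mod K) X"
abbreviation "tensorsC \<equiv> tensors (com_mod K) X"
abbreviation "objC \<equiv> comp_obj K (com_mod K) X"

text \<open>Without factors, \<open>x\<close> lies in arity 0 of the commutative operad, which is
  zero. This sets the empty list apart in the arguments below.\<close>

lemma scal_left:
  assumes "(x, ys) \<in> tensorsC n"
  shows "unscal x \<in> carrier K" "x = Scal (unscal x)" "ys = [] \<Longrightarrow> x = Scal \<zero>\<^bsub>K\<^esub>"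
  using tensorsD(2)[OF assms] by (auto split: if_splits)

lemma tensors_one:
  assumes "(x, ys) \<in> tensorsC n" "ys \<noteq> []" "a \<in> carrier K" shows "(Scal a, ys) \<in> tensorsC n"
  by (rule tensors_left[OF assms(1)]) (use assms in auto)

lemma pure_scal:
  assumes "(x, ys) \<in> tensorsC n" "a \<in> carrier K"
  shows "pureC n (Scal (a \<otimes>\<^bsub>K\<^esub> unscal x)) ys = a \<odot>\<^bsub>objC n\<^esub> pureC n x ys"
proof -
  have "a \<odot>\<^bsub>obj (com_mod K) (length ys)\<^esub> x = Scal (a \<otimes>\<^bsub>K\<^esub> unscal x)"
    using scal_left[OF assms(1)] assms(2) by auto
  then show ?thesis using pure_left_smult[OF assms(2,1)] by simp
qed

lemma pure_scal_one:
  assumes "(x, ys) \<in> tensorsC n" "ys \<noteq> []"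
  shows "pureC n x ys = unscal x \<odot>\<^bsub>objC n\<^esub> pureC n (Scal \<one>\<^bsub>K\<^esub>) ys"
  using pure_scal[OF tensors_one[OF assms, of "\<one>\<^bsub>K\<^esub>"], of "unscal x"] scal_left[OF assms(1)] by simp

lemma pure_scal_zero:
  assumes "(x, ys) \<in> tensorsC n"
  shows "pureC n (Scal \<zero>\<^bsub>K\<^esub>) ys = \<zero>\<^bsub>objC n\<^esub>"
  using pure_left_zero[OF assms] by (simp split: if_splits)

text \<open>The symmetric groups act trivially on the commutative operad, so coinvariance identifies
  all orders of the factors.\<close>

lemma pure_mset:
  assumes "(x, ys) \<in> tensorsC n" "mset ys = mset ys'"
  shows "(x, ys') \<in> tensorsC n" and "pureC n x ys = pureC n x ys'"
proof -
  obtain \<sigma> where \<sigma>: "\<sigma> permutes {1..length ys}" "ys' = perm_factors \<sigma> ys"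
    using perm_factors_ex[OF assms(2)] by blast
  show "(x, ys') \<in> tensorsC n" using tensors_perm[OF assms(1) \<sigma>(1)] \<sigma>(2) by simp
  show "pureC n x ys = pureC n x ys'" using pure_perm[OF assms(1) \<sigma>(1)] \<sigma>(2) by simp
qed

text \<open>With \<open>v = (\<lambda>J. unscal)\<close> this is the multiplication of the
  commutative operad; with dual coordinates for \<open>v\<close> it gives the dual functionals of a
  composite.\<close>

definition coeff :: "(nat set \<Rightarrow> 'k elt \<Rightarrow> 'k) \<Rightarrow> (nat set \<times> 'k elt) list \<Rightarrow> 'k \<Rightarrow> 'k" where
  "coeff v ys b = foldr (\<lambda>(J, y) b. v J y \<otimes>\<^bsub>K\<^esub> b) ys b"

lemma coeff_simps [simp]:
  "coeff v [] b = b" "coeff v ((J, y) # ys) b = v J y \<otimes>\<^bsub>K\<^esub> coeff v ys b"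
  by (simp_all add: coeff_def)

lemma coeff_closed:
  "(\<And>J y. (J, y) \<in> set ys \<Longrightarrow> v J y \<in> carrier K) \<Longrightarrow> b \<in> carrier K \<Longrightarrow> coeff v ys b \<in> carrier K"
  by (induction ys) auto

lemma coeff_extract:
  assumes "\<And>J y. (J, y) \<in> set (us @ (J', y') # vs) \<Longrightarrow> v J y \<in> carrier K" "b \<in> carrier K"
  shows "coeff v (us @ (J', y') # vs) b = v J' y' \<otimes>\<^bsub>K\<^esub> coeff v (us @ vs) b"
  using assms(1)
proof (induction us)
  case (Cons z us)
  obtain J y where z: "z = (J, y)" by (cases z)
  have "coeff v (us @ vs) b \<in> carrier K" using Cons.prems assms(2) by (intro coeff_closed) auto
  moreover have "v J y \<in> carrier K" "v J' y' \<in> carrier K" using Cons.prems z by auto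
  moreover have "coeff v (us @ (J', y') # vs) b = v J' y' \<otimes>\<^bsub>K\<^esub> coeff v (us @ vs) b"
    using Cons by auto
  ultimately show ?case using z by (simp add: K.m_lcomm)
qed simp

lemma coeff_mset:
  "mset ys = mset ys' \<Longrightarrow> (\<And>J y. (J, y) \<in> set ys \<Longrightarrow> v J y \<in> carrier K) \<Longrightarrow> b \<in> carrier K \<Longrightarrow>
    coeff v ys b = coeff v ys' b"
proof (induction ys arbitrary: ys')
  case (Cons z ys)
  obtain J y where z: "z = (J, y)" by (cases z)
  have "z \<in> set ys'" using Cons.prems(1) by (metis list.set_intros(1) mset_eq_setD)
  then obtain us vs where ys': "ys' = us @ z # vs" by (meson split_list)
  have eq: "mset ys = mset (us @ vs)" using Cons.prems(1) ys' by simp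
  have set: "set (z # ys) = set ys'" using Cons.prems(1) by (rule mset_eq_setD)
  have vc: "v J' y' \<in> carrier K" if "(J', y') \<in> set ys'" for J' y'
    by (rule Cons.prems(2)) (use that set in blast)
  have "coeff v ys' b = v J y \<otimes>\<^bsub>K\<^esub> coeff v (us @ vs) b"
    unfolding ys' z by (rule coeff_extract[OF vc Cons.prems(3)]) (simp add: ys' z)
  moreover have "coeff v ys b = coeff v (us @ vs) b"
    by (rule Cons.IH[OF eq]) (use Cons.prems in auto)
  ultimately show ?case using z by simp
qed simp

lemma coeff_eq_one:
  "(\<And>J y. (J, y) \<in> set ys \<Longrightarrow> v J y = \<one>\<^bsub>K\<^esub>) \<Longrightarrow> coeff v ys \<one>\<^bsub>K\<^esub> = \<one>\<^bsub>K\<^esub>"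
  by (induction ys) auto

lemma coeff_eq_zero:
  assumes "(J, y) \<in> set ys" "v J y = \<zero>\<^bsub>K\<^esub>"
    "\<And>J y. (J, y) \<in> set ys \<Longrightarrow> v J y \<in> carrier K" "b \<in> carrier K"
  shows "coeff v ys b = \<zero>\<^bsub>K\<^esub>"
proof -
  obtain us vs where ys: "ys = us @ (J, y) # vs" using assms(1) by (meson split_list)
  have "coeff v ys b = v J y \<otimes>\<^bsub>K\<^esub> coeff v (us @ vs) b"
    unfolding ys by (rule coeff_extract) (use assms ys in auto)
  moreover have "coeff v (us @ vs) b \<in> carrier K" by (rule coeff_closed) (use assms ys in auto)
  ultimately show ?thesis using assms(2) by simp
qed

text \<open>A product of functionals, one for each factor, is multilinear and independent of the
  order, so it descends to the composite. The condition \<open>Q\<close> sees only the set of index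
  sets, which no relation changes, and allows a functional to be supported on a single
  decomposition.\<close>

lemma coeff_lift:
  assumes v_closed: "\<And>J y. y \<in> carrier (obj X (card J)) \<Longrightarrow> v J y \<in> carrier K"
    and v_add: "\<And>J y y'. y \<in> carrier (obj X (card J)) \<Longrightarrow> y' \<in> carrier (obj X (card J)) \<Longrightarrow>
      v J (y \<oplus>\<^bsub>obj X (card J)\<^esub> y') = v J y \<oplus>\<^bsub>K\<^esub> v J y'"
    and v_smult: "\<And>J a y. a \<in> carrier K \<Longrightarrow> y \<in> carrier (obj X (card J)) \<Longrightarrow>
      v J (a \<odot>\<^bsub>obj X (card J)\<^esub> y) = a \<otimes>\<^bsub>K\<^esub> v J y"
  shows "\<exists>\<theta>\<in>lin_maps K (objC n) (ground_mod K). \<forall>(x, ys)\<in>tensorsC n. \<theta> (pureC n x ys) =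
    Scal (if Q (fst ` set ys) then coeff v ys (unscal x) else \<zero>\<^bsub>K\<^esub>)"
proof -
  define g where "g x ys = Scal (if Q (fst ` set ys) then coeff v ys (unscal x) else \<zero>\<^bsub>K\<^esub>)"
    for x :: "'k elt" and ys
  have vs: "v J y \<in> carrier K" if "(x, ys) \<in> tensorsC n" "(J, y) \<in> set ys" for x ys J y
    by (rule v_closed[OF tensorsD(3)[OF that]])
  have co: "coeff v ys b \<in> carrier K" if "(x, ys) \<in> tensorsC n" "b \<in> carrier K" for x ys b
    by (rule coeff_closed) (use vs[OF that(1)] that in auto)
  have coeff_l_add: "coeff v ys (a \<oplus>\<^bsub>K\<^esub> b) = coeff v ys a \<oplus>\<^bsub>K\<^esub> coeff v ys b"
    if "\<And>J y. (J, y) \<in> set ys \<Longrightarrow> v J y \<in> carrier K" "a \<in> carrier K" "b \<in> carrier K" for ys a b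
    using that by (induction ys) (auto simp: K.r_distr coeff_closed)
  have coeff_l_smult: "coeff v ys (a \<otimes>\<^bsub>K\<^esub> b) = a \<otimes>\<^bsub>K\<^esub> coeff v ys b"
    if "\<And>J y. (J, y) \<in> set ys \<Longrightarrow> v J y \<in> carrier K" "a \<in> carrier K" "b \<in> carrier K" for ys a b
    using that by (induction ys) (auto simp: K.m_lcomm coeff_closed)
  \<comment> \<open>Linearity in one factor is read off after its scalar has been moved to the front
    of the product.\<close>
  have ex: "coeff v (us @ (J, y) # vs) (unscal x) = v J y \<otimes>\<^bsub>K\<^esub> coeff v (us @ vs) (unscal x)"
    "coeff v (us @ vs) (unscal x) \<in> carrier K" "y \<in> carrier (obj X (card J))"
    if T: "(x, us @ (J, y) # vs) \<in> tensorsC n" for x us J y vs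
  proof -
    have "\<And>J' y'. (J', y') \<in> set (us @ (J, y) # vs) \<Longrightarrow> v J' y' \<in> carrier K" using vs[OF T] by blast
    then show "coeff v (us @ (J, y) # vs) (unscal x) = v J y \<otimes>\<^bsub>K\<^esub> coeff v (us @ vs) (unscal x)"
      "coeff v (us @ vs) (unscal x) \<in> carrier K"
      using scal_left(1)[OF T] by (auto intro!: coeff_extract coeff_closed)
    show "y \<in> carrier (obj X (card J))" by (rule tensorsD(3)[OF T]) simp
  qed
  have "\<exists>\<theta>\<in>lin_maps K (objC n) (ground_mod K). \<forall>(x, ys)\<in>tensorsC n. \<theta> (pureC n x ys) = g x ys"
  proof (rule comp_lift[OF ground_mod_module[OF cring]])
    fix x ys assume T: "(x, ys) \<in> tensorsC n"
    then show "g x ys \<in> carrier (ground_mod K)" using co[OF T] scal_left(1)[OF T] by (simp add: g_def)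
    fix \<sigma> assume \<sigma>: "\<sigma> permutes {1..length ys}"
    have "mset (perm_factors \<sigma> ys) = mset ys" by (rule mset_perm_factors[OF \<sigma>])
    then have "coeff v (perm_factors \<sigma> ys) (unscal x) = coeff v ys (unscal x)"
      "set (perm_factors \<sigma> ys) = set ys"
      using coeff_mset[of ys "perm_factors \<sigma> ys" v "unscal x"] vs[OF T] scal_left(1)[OF T]
      by (auto dest: mset_eq_setD)
    then show "g (act (com_mod K) (length ys) \<sigma> x) ys = g x (perm_factors \<sigma> ys)" by (simp add: g_def)
  next
    fix x x' ys assume T: "(x, ys) \<in> tensorsC n" "(x', ys) \<in> tensorsC n"
    have "unscal (x \<oplus>\<^bsub>obj (com_mod K) (length ys)\<^esub> x') = unscal x \<oplus>\<^bsub>K\<^esub> unscal x'"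
      using scal_left[OF T(1)] scal_left[OF T(2)] by (cases "ys = []") auto
    then show "g (x \<oplus>\<^bsub>obj (com_mod K) (length ys)\<^esub> x') ys = g x ys \<oplus>\<^bsub>ground_mod K\<^esub> g x' ys"
      using scal_left(1)[OF T(1)] scal_left(1)[OF T(2)] vs[OF T(1)] co[OF T(1)]
      by (simp add: g_def coeff_l_add del: obj_com_mod)
  next
    fix a x ys assume a: "a \<in> carrier K" and T: "(x, ys) \<in> tensorsC n"
    have "unscal (a \<odot>\<^bsub>obj (com_mod K) (length ys)\<^esub> x) = a \<otimes>\<^bsub>K\<^esub> unscal x"
      using scal_left[OF T] a by (cases "ys = []") auto
    then show "g (a \<odot>\<^bsub>obj (com_mod K) (length ys)\<^esub> x) ys = a \<odot>\<^bsub>ground_mod K\<^esub> g x ys"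
      using scal_left(1)[OF T] vs[OF T] a by (simp add: g_def coeff_l_smult del: obj_com_mod)
  next
    fix x us J y y' vs assume T: "(x, us @ (J, y) # vs) \<in> tensorsC n" "(x, us @ (J, y') # vs) \<in> tensorsC n"
    note E = ex[OF T(1)] ex[OF T(2)]
    have T': "(x, us @ (J, y \<oplus>\<^bsub>obj X (card J)\<^esub> y') # vs) \<in> tensorsC n"
      by (rule tensors_right[OF T(1)]) (use E closed_N in auto)
    show "g x (us @ (J, y \<oplus>\<^bsub>obj X (card J)\<^esub> y') # vs) =
        g x (us @ (J, y) # vs) \<oplus>\<^bsub>ground_mod K\<^esub> g x (us @ (J, y') # vs)"
      unfolding g_def ex(1)[OF T'] E(1,4) using E by (simp add: v_add v_closed K.l_distr)
  next
    fix a x us J y vs assume a: "a \<in> carrier K" and T: "(x, us @ (J, y) # vs) \<in> tensorsC n"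
    note E = ex[OF T]
    have T': "(x, us @ (J, a \<odot>\<^bsub>obj X (card J)\<^esub> y) # vs) \<in> tensorsC n"
      by (rule tensors_right[OF T]) (use E a closed_N in auto)
    show "g x (us @ (J, a \<odot>\<^bsub>obj X (card J)\<^esub> y) # vs) = a \<odot>\<^bsub>ground_mod K\<^esub> g x (us @ (J, y) # vs)"
      unfolding g_def ex(1)[OF T'] E(1) using E a by (simp add: v_smult v_closed K.m_assoc)
  qed
  then show ?thesis by (simp add: g_def)
qed

end

text \<open>\<open>X\<close> stands for a power of the commutative operad; the assumption is what
  the induction carries from \<open>d\<close> to \<open>Suc d\<close>.\<close>

locale com_comp = com_data K X
  for K :: "('k, 'm) ring_scheme" and X :: "'k sigma_mod" +
  fixes d :: nat and e :: "nat \<Rightarrow> nat set set list \<Rightarrow> 'k elt"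
  assumes basis: "\<And>n. free_basis K (obj X n) (partition_chains n d) (e n)"
begin

lemma e_closed: "c \<in> partition_chains n d \<Longrightarrow> e n c \<in> carrier (obj X n)"
  using basis[of n] by (auto simp: free_basis_def)

lemma decomp_enum:
  assumes "partition_on {1..n} \<pi>" "distinct Js" "set Js = \<pi>" shows "decomp n Js"
  unfolding decomp_iff
proof (intro conjI allI impI)
  fix i j assume ij: "i < length Js" "j < length Js" "i \<noteq> j"
  then have "Js ! i \<noteq> Js ! j" using assms(2) by (simp add: nth_eq_iff_index_eq)
  then show "Js ! i \<inter> Js ! j = {}"
    using partition_on_block_disjnt[OF assms(1), of "Js ! i" "Js ! j"] ij assms(3) by (auto simp: disjnt_def)
next
  show "\<Union>(set Js) = {1..n}" using partition_onD1[OF assms(1)] assms(3) by simp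
qed

text \<open>Every listing of the blocks with their restricted basis elements gives the same vector,
  so later computations are free of the particular order used in \<open>comp_basis\<close>.\<close>

lemma chain_tensor:
  assumes c: "c \<in> partition_chains n (Suc d)"
    and ys: "distinct (map fst ys)" "fst ` set ys = c ! 1"
      "\<And>J y. (J, y) \<in> set ys \<Longrightarrow> y = e (card J) (restr J c)"
  shows "(Scal \<one>\<^bsub>K\<^esub>, ys) \<in> tensorsC n" and "pureC n (Scal \<one>\<^bsub>K\<^esub>) ys = comp_basis K X e n c"
proof -
  have P: "partition_on {1..n} (c ! 1)" by (rule partition_chainsD(6)[OF c]) simp
  have "finite (c ! 1)" using ys(2) by (metis finite_imageI finite_set)
  then have en: "distinct (enum_set (c ! 1))" "set (enum_set (c ! 1)) = c ! 1"
    using enum_set by auto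
  have "ys \<noteq> []"
  proof
    assume "ys = []"
    then have "{1..n} = {}" using ys(2) partition_onD1[OF P] by simp
    then show False using partition_chains_pos[OF c] by simp
  qed
  moreover have "decomp n (map fst ys)" by (rule decomp_enum[OF P ys(1)]) (use ys(2) in simp)
  moreover have "y \<in> carrier (obj X (card J))" if "(J, y) \<in> set ys" for J y
  proof -
    have "J \<in> c ! 1" using ys(2) that by force
    then show ?thesis using ys(3)[OF that] e_closed[OF restr_chain[OF c]] by simp
  qed
  ultimately show T: "(Scal \<one>\<^bsub>K\<^esub>, ys) \<in> tensorsC n" by (auto simp: tensors_def)
  define h where "h J = (J, e (card J) (restr J c))" for J
  have "map h (map fst ys) = ys"
    unfolding map_map by (rule map_idI) (use ys(3) in \<open>auto simp: h_def\<close>)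
  then have "mset ys = mset (map h (map fst ys))" by simp
  also have "mset (map fst ys) = mset (enum_set (c ! 1))"
    by (rule set_eq_iff_mset_eq_distinct[THEN iffD1, OF ys(1) en(1)]) (simp only: set_map ys(2) en(2))
  then have "mset (map h (map fst ys)) = mset (map h (enum_set (c ! 1)))"
    by (simp only: mset_map[of h])
  finally have "mset ys = mset (map (\<lambda>J. (J, e (card J) (restr J c))) (enum_set (c ! 1)))"
    unfolding h_def .
  then show "pureC n (Scal \<one>\<^bsub>K\<^esub>) ys = comp_basis K X e n c"
    unfolding comp_basis_def by (rule pure_mset(2)[OF T])
qed

lemma basis_chain:
  assumes c: "c \<in> partition_chains n (Suc d)"
  defines "ys \<equiv> map (\<lambda>J. (J, e (card J) (restr J c))) (enum_set (c ! 1))"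
  shows "(Scal \<one>\<^bsub>K\<^esub>, ys) \<in> tensorsC n" and "comp_basis K X e n c = pureC n (Scal \<one>\<^bsub>K\<^esub>) ys"
    and "distinct (map fst ys)" and "fst ` set ys = c ! 1"
    and "(J, y) \<in> set ys \<longleftrightarrow> J \<in> c ! 1 \<and> y = e (card J) (restr J c)"
proof -
  have P: "partition_on {1..n} (c ! 1)" by (rule partition_chainsD(6)[OF c]) simp
  then have "finite (c ! 1)" by (rule finite_elements[rotated]) simp
  then have en: "distinct (enum_set (c ! 1))" "set (enum_set (c ! 1)) = c ! 1"
    using enum_set by auto
  have m: "map fst ys = enum_set (c ! 1)" by (simp add: ys_def o_def)
  show d: "distinct (map fst ys)" using en m by simp
  show f: "fst ` set ys = c ! 1" using en(2) m by (metis set_map)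
  show iff: "(J, y) \<in> set ys \<longleftrightarrow> J \<in> c ! 1 \<and> y = e (card J) (restr J c)" for J y
    using en by (auto simp: ys_def)
  show "(Scal \<one>\<^bsub>K\<^esub>, ys) \<in> tensorsC n" by (rule chain_tensor[OF c d f]) (simp add: iff)
  show "comp_basis K X e n c = pureC n (Scal \<one>\<^bsub>K\<^esub>) ys" by (simp add: comp_basis_def ys_def)
qed

text \<open>\<open>decomp\<close> admits empty members, which may be repeated; once they are
  excluded, disjointness forces distinctness.\<close>

lemma distinct_blocks:
  assumes "decomp n Js" "{} \<notin> set Js" shows "distinct Js"
proof -
  have "Js ! i \<noteq> Js ! j" if "i < length Js" "j < length Js" "i \<noteq> j" for i j
  proof -
    have "Js ! i \<noteq> {}" using assms(2) that(1) by (metis nth_mem)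
    moreover have "Js ! i \<inter> Js ! j = {}" using assms(1) that by (simp add: decomp_iff)
    ultimately show ?thesis by auto
  qed
  then show ?thesis by (simp add: distinct_conv_nth)
qed

lemma partition_on_blocks:
  assumes "decomp n Js" "{} \<notin> set Js" shows "partition_on {1..n} (set Js)"
proof (rule partition_onI)
  show "\<Union>(set Js) = {1..n}" using assms(1) by (simp add: decomp_iff)
  show "disjnt p q" if "p \<in> set Js" "q \<in> set Js" "p \<noteq> q" for p q
  proof -
    obtain i j where "i < length Js" "p = Js ! i" "j < length Js" "q = Js ! j"
      using \<open>p \<in> set Js\<close> \<open>q \<in> set Js\<close> by (metis in_set_conv_nth)
    then show ?thesis using assms(1) \<open>p \<noteq> q\<close> unfolding decomp_iff disjnt_def by metis
  qed
qed (rule assms(2))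

text \<open>Chains exist only on nonempty sets, so the presence of \<open>g J\<close> for every
  index set makes the decomposition a partition, and the chains can be glued.\<close>

lemma tensor_chain_glue:
  assumes T: "(x, ys) \<in> tensorsC n" and ne: "ys \<noteq> []"
    and g: "\<And>J. J \<in> fst ` set ys \<Longrightarrow> g J \<in> partition_chains (card J) d"
  shows "\<exists>c\<in>partition_chains n (Suc d). distinct (map fst ys) \<and> fst ` set ys = c ! 1 \<and>
    (\<forall>J\<in>fst ` set ys. restr J c = g J)"
proof -
  have D: "decomp n (map fst ys)" by (rule tensorsD(1)[OF T])
  have J: "J \<noteq> {}" if "J \<in> fst ` set ys" for J
    using partition_chains_pos[OF g[OF that]] by auto
  then have ne': "{} \<notin> set (map fst ys)" by auto
  have \<pi>: "partition_on {1..n} (fst ` set ys)"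
    using partition_on_blocks[OF D ne'] by simp
  have n: "n \<ge> 1"
  proof (rule ccontr)
    assume "\<not> n \<ge> 1"
    then have "\<Union>(fst ` set ys) = {}" using partition_onD1[OF \<pi>] by simp
    moreover obtain z where z: "z \<in> set ys" using ne by (cases ys) auto
    ultimately have "fst z = {}" by auto
    then show False using J[of "fst z"] z by simp
  qed
  show ?thesis
  proof -
    obtain c where "c \<in> partition_chains n (Suc d)" "c ! 1 = fst ` set ys" "\<forall>J\<in>fst ` set ys. restr J c = g J"
      using bexE[OF chain_exists[OF n \<pi> g]] by metis
    then show ?thesis using distinct_blocks[OF D ne'] by (intro bexI[of _ c]) simp_all
  qed
qed

lemma tensor_chain:
  assumes T: "(x, ys) \<in> tensorsC n" and ne: "ys \<noteq> []"
    and b: "\<And>J y. (J, y) \<in> set ys \<Longrightarrow> \<exists>b\<in>partition_chains (card J) d. y = e (card J) b"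
  shows "\<exists>c\<in>partition_chains n (Suc d). distinct (map fst ys) \<and> fst ` set ys = c ! 1 \<and>
    (\<forall>(J, y)\<in>set ys. y = e (card J) (restr J c))"
proof -
  \<comment> \<open>One chain is chosen for each index set, with its basis element occurring as a
    factor there. Distinctness of the index sets shows afterwards that no other factor
    occurs.\<close>
  define g where "g J = (SOME b. b \<in> partition_chains (card J) d \<and> (\<exists>y. (J, y) \<in> set ys \<and> y = e (card J) b))"
    for J
  have g: "g J \<in> partition_chains (card J) d \<and> (\<exists>y. (J, y) \<in> set ys \<and> y = e (card J) (g J))"
    if J: "J \<in> fst ` set ys" for J
    unfolding g_def
  proof (rule someI_ex)
    obtain y where "(J, y) \<in> set ys" using J by force
    then show "\<exists>b. b \<in> partition_chains (card J) d \<and> (\<exists>y. (J, y) \<in> set ys \<and> y = e (card J) b)"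
      using b by blast
  qed
  have "\<exists>c\<in>partition_chains n (Suc d). distinct (map fst ys) \<and> fst ` set ys = c ! 1 \<and>
    (\<forall>J\<in>fst ` set ys. restr J c = g J)"
    by (rule tensor_chain_glue[OF T ne]) (use g in simp)
  then obtain c where c: "c \<in> partition_chains n (Suc d)" "distinct (map fst ys)" "fst ` set ys = c ! 1"
    "\<And>J. J \<in> fst ` set ys \<Longrightarrow> restr J c = g J"
    by (elim bexE conjE) simp
  have "y = e (card J) (restr J c)" if y: "(J, y) \<in> set ys" for J y
  proof -
    have J: "J \<in> fst ` set ys" using y by force
    then obtain y' where y': "(J, y') \<in> set ys" "y' = e (card J) (g J)" using g[OF J] by blast
    have "y' = y" by (rule eq_key_imp_eq_value[OF c(2) y'(1) y])
    then show ?thesis using c(4)[OF J] y'(2) by simp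
  qed
  then show ?thesis by (intro bexI[OF _ c(1)] conjI c(2,3)) auto
qed

text \<open>Multilinearity reduces a pure tensor to one whose factors are basis elements, and such a
  tensor is the basis element of a glued chain.\<close>

lemma comp_basis_span:
  assumes H: "submodule H K (objC n)" and sub: "comp_basis K X e n ` partition_chains n (Suc d) \<subseteq> H"
  shows "carrier (objC n) \<subseteq> H"
proof
  interpret C: module K "objC n" by (rule comp_obj_module)
  note HE = C.submoduleE[OF H]
  have 0: "\<zero>\<^bsub>objC n\<^esub> \<in> H" using submodule.axioms(1)[OF H] by (simp add: subgroup_def)
  fix u assume "u \<in> carrier (objC n)"
  then show "u \<in> H"
  proof (rule comp_obj_induct)
    fix x ys assume T: "(x, ys) \<in> tensorsC n"
    show "pureC n x ys \<in> H"
    proof (cases "ys = []")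
      case True
      then show ?thesis using pure_scal_zero[OF T] scal_left(3)[OF T] 0 by simp
    next
      case False
      have T1: "(Scal \<one>\<^bsub>K\<^esub>, ys) \<in> tensorsC n" by (rule tensors_one[OF T False]) simp
      have "ys \<noteq> [] \<longrightarrow> pureC n (Scal \<one>\<^bsub>K\<^esub>) ys \<in> H"
      proof (rule tensors_basis_induct[OF basis T1, where P = "\<lambda>ys. ys \<noteq> [] \<longrightarrow> pureC n (Scal \<one>\<^bsub>K\<^esub>) ys \<in> H"])
        fix ys assume T: "(Scal \<one>\<^bsub>K\<^esub>, ys) \<in> tensorsC n"
          and b: "\<And>J y. (J, y) \<in> set ys \<Longrightarrow> \<exists>b\<in>partition_chains (card J) d. y = e (card J) b"
        show "ys \<noteq> [] \<longrightarrow> pureC n (Scal \<one>\<^bsub>K\<^esub>) ys \<in> H"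
        proof
          assume "ys \<noteq> []"
          from tensor_chain[OF T this b] obtain c where c: "c \<in> partition_chains n (Suc d)"
            "distinct (map fst ys)" "fst ` set ys = c ! 1" "\<forall>(J, y)\<in>set ys. y = e (card J) (restr J c)"
            by blast
          then have "pureC n (Scal \<one>\<^bsub>K\<^esub>) ys = comp_basis K X e n c"
            by (intro chain_tensor(2)) auto
          then show "pureC n (Scal \<one>\<^bsub>K\<^esub>) ys \<in> H" using sub c(1) by blast
        qed
      qed (use HE 0 in \<open>simp_all add: pure_right_zero pure_right_add pure_right_smult\<close>)
      then have "pureC n (Scal \<one>\<^bsub>K\<^esub>) ys \<in> H" using False by blast
      then show ?thesis
        using pure_scal_one[OF T False] HE scal_left(1)[OF T] by simp
    qed
  qed (use HE 0 in auto)
qed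

text \<open>The functional of \<open>c\<close> multiplies the dual coordinates of the restrictions
  of \<open>c\<close> and vanishes on other decompositions. A different chain with the same second
  partition differs in some restriction, which contributes a factor zero.\<close>

lemma comp_basis_dual:
  assumes c: "c \<in> partition_chains n (Suc d)"
  shows "\<exists>\<theta>\<in>lin_maps K (objC n) (ground_mod K). \<forall>c'\<in>partition_chains n (Suc d).
    \<theta> (comp_basis K X e n c') = Scal (if c' = c then \<one>\<^bsub>K\<^esub> else \<zero>\<^bsub>K\<^esub>)"
proof -
  \<comment> \<open>Away from the blocks of \<open>c ! 1\<close> there is no dual coordinate to use;
    the value zero keeps \<open>v\<close> linear for every \<open>J\<close>.\<close>
  define v where "v J y = (if J \<in> c ! 1 then
    unscal (dual_coord K (obj X (card J)) (partition_chains (card J) d) (e (card J)) (restr J c) y)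
    else \<zero>\<^bsub>K\<^esub>)" for J y
  note lin = dual_coord_linear[OF basis restr_chain[OF c]]
  have v_closed: "v J y \<in> carrier K" if "y \<in> carrier (obj X (card J))" for J y
    using lin(1)[OF _ that] by (simp add: v_def)
  have v_add: "v J (y \<oplus>\<^bsub>obj X (card J)\<^esub> y') = v J y \<oplus>\<^bsub>K\<^esub> v J y'"
    if "y \<in> carrier (obj X (card J))" "y' \<in> carrier (obj X (card J))" for J y y'
    using lin(2)[OF _ that] by (simp add: v_def)
  have v_smult: "v J (a \<odot>\<^bsub>obj X (card J)\<^esub> y) = a \<otimes>\<^bsub>K\<^esub> v J y"
    if "a \<in> carrier K" "y \<in> carrier (obj X (card J))" for J a y
    using lin(3)[OF _ that] that by (simp add: v_def)
  define g where "g x ys = Scal (if fst ` set ys = c ! 1 then coeff v ys (unscal x) else \<zero>\<^bsub>K\<^esub>)"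
    for x :: "'k elt" and ys
  have vs: "v J y \<in> carrier K" if "(x, ys) \<in> tensorsC n" "(J, y) \<in> set ys" for x ys J y
    by (rule v_closed[OF tensorsD(3)[OF that]])
  have "\<exists>\<theta>\<in>lin_maps K (objC n) (ground_mod K). \<forall>(x, ys)\<in>tensorsC n. \<theta> (pureC n x ys) = g x ys"
    unfolding g_def by (rule coeff_lift[OF v_closed v_add v_smult])
  then obtain \<theta> where \<theta>: "\<theta> \<in> lin_maps K (objC n) (ground_mod K)"
    "\<And>x ys. (x, ys) \<in> tensorsC n \<Longrightarrow> \<theta> (pureC n x ys) = g x ys" by blast
  have "\<theta> (comp_basis K X e n c') = Scal (if c' = c then \<one>\<^bsub>K\<^esub> else \<zero>\<^bsub>K\<^esub>)"
    if c': "c' \<in> partition_chains n (Suc d)" for c'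
  proof -
    define ys where "ys = map (\<lambda>J. (J, e (card J) (restr J c'))) (enum_set (c' ! 1))"
    note B = basis_chain[OF c', folded ys_def]
    have eq: "\<theta> (comp_basis K X e n c') = g (Scal \<one>\<^bsub>K\<^esub>) ys" using B(1,2) \<theta>(2) by simp
    show ?thesis
    proof (cases "c' ! 1 = c ! 1")
      case False
      then show ?thesis using eq B(4) by (auto simp: g_def)
    next
      case True
      have v: "v J y = (if restr J c' = restr J c then \<one>\<^bsub>K\<^esub> else \<zero>\<^bsub>K\<^esub>)" if "(J, y) \<in> set ys" for J y
      proof -
        have J: "J \<in> c ! 1" "J \<in> c' ! 1" "y = e (card J) (restr J c')" using that B(5) True by auto
        show ?thesis
          using dual_coord(2)[OF basis restr_chain[OF c J(1)] restr_chain[OF c' J(2)]] J by (simp add: v_def)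
      qed
      have "coeff v ys \<one>\<^bsub>K\<^esub> = (if c' = c then \<one>\<^bsub>K\<^esub> else \<zero>\<^bsub>K\<^esub>)"
      proof (cases "c' = c")
        case True
        then show ?thesis using v by (simp add: coeff_eq_one)
      next
        case False
        then obtain J where J: "J \<in> c' ! 1" "restr J c' \<noteq> restr J c"
          using restr_inj[OF c' c True] by blast
        then have mem: "(J, e (card J) (restr J c')) \<in> set ys" using B(5) by blast
        have "coeff v ys \<one>\<^bsub>K\<^esub> = \<zero>\<^bsub>K\<^esub>"
          by (rule coeff_eq_zero[OF mem]) (use v[OF mem] J(2) vs[OF B(1)] in auto)
        then show ?thesis using False by simp
      qed
      then show ?thesis using eq B(4) True by (simp add: g_def)
    qed
  qed
  then show ?thesis using \<theta>(1) by blast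
qed

lemma comp_basis: "free_basis K (objC n) (partition_chains n (Suc d)) (comp_basis K X e n)"
proof -
  have "comp_basis K X e n c \<in> carrier (objC n)" if "c \<in> partition_chains n (Suc d)" for c
    using basis_chain(1,2)[OF that] pure_closed by simp
  then show ?thesis
    unfolding free_basis_def
    by (intro conjI allI impI ballI finite_partition_chains comp_basis_dual)
      (auto dest: comp_basis_span)
qed

lemma com_comp_Suc: "com_comp K (comp K (com_mod K) X) (Suc d) (comp_basis K X e)"
  using cring comp_obj_module comp_basis by (simp add: com_comp_def com_data_def com_comp_axioms_def)

end

section \<open>Structure maps on bases\<close>

text \<open>Linearity of \<open>\<phi>\<close> and \<open>\<psi>\<close> makes the prescribed values
  multilinear, and equivariance of \<open>\<phi>\<close> makes them respect coinvariants; so the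
  choice in \<open>comp_map\<close> has its intended values.\<close>

lemma comp_map:
  assumes "comp_data K M N" "comp_data K M' N'"
    and \<phi>: "\<And>n. \<phi> n \<in> lin_maps K (obj M n) (obj M' n)"
    and \<psi>: "\<And>n. \<psi> n \<in> lin_maps K (obj N n) (obj N' n)"
    and \<phi>_act: "\<And>n \<sigma> x. \<sigma> permutes {1..n} \<Longrightarrow> x \<in> carrier (obj M n) \<Longrightarrow>
      \<phi> n (act M n \<sigma> x) = act M' n \<sigma> (\<phi> n x)"
  shows "comp_map K M N M' N' \<phi> \<psi> n \<in> lin_maps K (comp_obj K M N n) (comp_obj K M' N' n)"
    and "(x, ys) \<in> tensors M N n \<Longrightarrow> comp_map K M N M' N' \<phi> \<psi> n (pure K M N n x ys) =
      pure K M' N' n (\<phi> (length ys) x) (map (\<lambda>(J, y). (J, \<psi> (card J) y)) ys)"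
    and "(x, ys) \<in> tensors M N n \<Longrightarrow>
      (\<phi> (length ys) x, map (\<lambda>(J, y). (J, \<psi> (card J) y)) ys) \<in> tensors M' N' n"
proof -
  interpret D: comp_data K M N by fact
  interpret D': comp_data K M' N' by fact
  define m where "m = map (\<lambda>(J, y). (J :: nat set, \<psi> (card J) y))"
  have m_simps: "m (us @ (J, y) # vs) = m us @ (J, \<psi> (card J) y) # m vs" "length (m ys) = length ys"
    for us J y vs ys by (simp_all add: m_def)
  have T': "(\<phi> (length ys) x, m ys) \<in> tensors M' N' n" if T: "(x, ys) \<in> tensors M N n" for x ys
  proof -
    have "map fst (m ys) = map fst ys" by (auto simp: m_def)
    then have "decomp n (map fst (m ys))" using D.tensorsD(1)[OF T] by simp
    moreover have "\<psi> (card J) y \<in> carrier (obj N' (card J))" if "(J, y) \<in> set ys" for J y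
      by (rule lin_mapsD(1)[OF \<psi> D.tensorsD(3)[OF T that]])
    moreover have "\<phi> (length ys) x \<in> carrier (obj M' (length ys))"
      by (rule lin_mapsD(1)[OF \<phi> D.tensorsD(2)[OF T]])
    moreover have "length (m ys) = length ys" by (simp add: m_def)
    ultimately have "decomp n (map fst (m ys))" "\<phi> (length ys) x \<in> carrier (obj M' (length (m ys)))"
      "\<forall>(J, y)\<in>set (m ys). y \<in> carrier (obj N' (card J))" by (auto simp: m_def)
    then show ?thesis by (simp only: tensors_def mem_Collect_eq case_prod_conv)
  qed
  have "\<exists>f\<in>lin_maps K (comp_obj K M N n) (comp_obj K M' N' n). \<forall>(x, ys)\<in>tensors M N n.
      f (pure K M N n x ys) = pure K M' N' n (\<phi> (length ys) x) (m ys)"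
  proof (rule D.comp_lift[OF D'.comp_obj_module])
    fix x ys assume T: "(x, ys) \<in> tensors M N n"
    show "pure K M' N' n (\<phi> (length ys) x) (m ys) \<in> carrier (comp_obj K M' N' n)"
      by (rule D'.pure_closed[OF T'[OF T]])
  next
    fix x x' ys assume T: "(x, ys) \<in> tensors M N n" "(x', ys) \<in> tensors M N n"
    show "pure K M' N' n (\<phi> (length ys) (x \<oplus>\<^bsub>obj M (length ys)\<^esub> x')) (m ys) =
      pure K M' N' n (\<phi> (length ys) x) (m ys) \<oplus>\<^bsub>comp_obj K M' N' n\<^esub> pure K M' N' n (\<phi> (length ys) x') (m ys)"
      using D'.pure_left_add[OF T'[OF T(1)] T'[OF T(2)]]
        lin_mapsD(2)[OF \<phi> D.tensorsD(2)[OF T(1)] D.tensorsD(2)[OF T(2)]] by (simp add: m_simps)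
  next
    fix c x ys assume c: "c \<in> carrier K" and T: "(x, ys) \<in> tensors M N n"
    show "pure K M' N' n (\<phi> (length ys) (c \<odot>\<^bsub>obj M (length ys)\<^esub> x)) (m ys) =
      c \<odot>\<^bsub>comp_obj K M' N' n\<^esub> pure K M' N' n (\<phi> (length ys) x) (m ys)"
      using D'.pure_left_smult[OF c T'[OF T]] lin_mapsD(3)[OF \<phi> c D.tensorsD(2)[OF T]] by (simp add: m_simps)
  next
    fix x us J y y' vs assume T: "(x, us @ (J, y) # vs) \<in> tensors M N n" "(x, us @ (J, y') # vs) \<in> tensors M N n"
    have "y \<in> carrier (obj N (card J))" "y' \<in> carrier (obj N (card J))"
      using D.tensorsD(3)[OF T(1), of J y] D.tensorsD(3)[OF T(2), of J y'] by auto
    then show "pure K M' N' n (\<phi> (length (us @ (J, y \<oplus>\<^bsub>obj N (card J)\<^esub> y') # vs)) x) (m (us @ (J, y \<oplus>\<^bsub>obj N (card J)\<^esub> y') # vs)) =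
      pure K M' N' n (\<phi> (length (us @ (J, y) # vs)) x) (m (us @ (J, y) # vs)) \<oplus>\<^bsub>comp_obj K M' N' n\<^esub>
      pure K M' N' n (\<phi> (length (us @ (J, y') # vs)) x) (m (us @ (J, y') # vs))"
      using D'.pure_right_add[of "\<phi> (length (us @ (J, y) # vs)) x" "m us" J "\<psi> (card J) y" "m vs" n "\<psi> (card J) y'"]
        T'[OF T(1)] T'[OF T(2)] lin_mapsD(2)[OF \<psi>, of y "card J" y'] by (simp add: m_simps)
  next
    fix c x us J y vs assume c: "c \<in> carrier K" and T: "(x, us @ (J, y) # vs) \<in> tensors M N n"
    have "y \<in> carrier (obj N (card J))" using D.tensorsD(3)[OF T, of J y] by auto
    then show "pure K M' N' n (\<phi> (length (us @ (J, c \<odot>\<^bsub>obj N (card J)\<^esub> y) # vs)) x) (m (us @ (J, c \<odot>\<^bsub>obj N (card J)\<^esub> y) # vs)) =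
      c \<odot>\<^bsub>comp_obj K M' N' n\<^esub> pure K M' N' n (\<phi> (length (us @ (J, y) # vs)) x) (m (us @ (J, y) # vs))"
      using D'.pure_right_smult[OF c T'[OF T, unfolded m_simps]] lin_mapsD(3)[OF \<psi> c, of y "card J"]
      by (simp add: m_simps)
  next
    fix x ys \<sigma> assume T: "(x, ys) \<in> tensors M N n" and \<sigma>: "\<sigma> permutes {1..length ys}"
    have "pure K M' N' n (\<phi> (length ys) (act M (length ys) \<sigma> x)) (m ys)
      = pure K M' N' n (act M' (length (m ys)) \<sigma> (\<phi> (length ys) x)) (m ys)"
      using \<phi>_act[OF \<sigma> D.tensorsD(2)[OF T]] by (simp add: m_simps)
    also have "\<dots> = pure K M' N' n (\<phi> (length ys) x) (perm_factors \<sigma> (m ys))"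
      by (rule D'.pure_perm[OF T'[OF T]]) (use \<sigma> m_simps in metis)
    also have "perm_factors \<sigma> (m ys) = m (perm_factors \<sigma> ys)"
      unfolding m_def by (rule perm_factors_map[OF \<sigma>])
    finally show "pure K M' N' n (\<phi> (length ys) (act M (length ys) \<sigma> x)) (m ys) =
      pure K M' N' n (\<phi> (length (perm_factors \<sigma> ys)) x) (m (perm_factors \<sigma> ys))" by simp
  qed
  from D.comp_lift_spec[OF this]
  show "comp_map K M N M' N' \<phi> \<psi> n \<in> lin_maps K (comp_obj K M N n) (comp_obj K M' N' n)"
    and "(x, ys) \<in> tensors M N n \<Longrightarrow> comp_map K M N M' N' \<phi> \<psi> n (pure K M N n x ys) =
      pure K M' N' n (\<phi> (length ys) x) (map (\<lambda>(J, y). (J, \<psi> (card J) y)) ys)"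
    by (simp_all add: comp_map_def m_def)
  show "(x, ys) \<in> tensors M N n \<Longrightarrow>
      (\<phi> (length ys) x, map (\<lambda>(J, y). (J, \<psi> (card J) y)) ys) \<in> tensors M' N' n"
    using T' by (simp add: m_def)
qed

lemma decomp_singleton: "decomp n [J] \<longleftrightarrow> J = {1..n}"
  by (auto simp: decomp_def)

text \<open>Only a list with exactly one factor admits a nonzero left entry, and its index set is
  then all of \<open>{1..n}\<close>. So the case distinction is multilinear and takes values in
  \<open>obj X n\<close>.\<close>

lemma left_unitor:
  assumes "cring K" and mod_X: "\<And>n. module K (obj X n)"
  shows "left_unitor K X n \<in> lin_maps K (comp_obj K (unit_mod K) X n) (obj X n)"
    and "(a, ys) \<in> tensors (unit_mod K) X n \<Longrightarrow> left_unitor K X n (pure K (unit_mod K) X n a ys) =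
      (if length ys = 1 then unscal a \<odot>\<^bsub>obj X n\<^esub> snd (hd ys) else \<zero>\<^bsub>obj X n\<^esub>)"
proof -
  interpret D: comp_data K "unit_mod K" X by (rule comp_data_unit) fact+
  interpret X: module K "obj X n" by fact
  define g where "g a ys = (if length ys = 1 then unscal a \<odot>\<^bsub>obj X n\<^esub> snd (hd ys) else \<zero>\<^bsub>obj X n\<^esub>)"
    for a :: "'a elt" and ys :: "(nat set \<times> 'a elt) list"
  have one: "unscal a \<in> carrier K \<and> (\<exists>y\<in>carrier (obj X n). ys = [({1..n}, y)])"
    if T: "(a, ys) \<in> tensors (unit_mod K) X n" and len: "length ys = 1" for a ys
  proof -
    obtain J y where ys: "ys = [(J, y)]" using len by (cases ys) (auto simp: length_Suc_conv)
    have "J = {1..n}" using D.tensorsD(1)[OF T] by (simp add: ys decomp_singleton)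
    then show ?thesis using D.tensorsD(2)[OF T] D.tensorsD(3)[OF T, of J y] ys by auto
  qed
  have "\<exists>f\<in>lin_maps K (comp_obj K (unit_mod K) X n) (obj X n). \<forall>(x, ys)\<in>tensors (unit_mod K) X n.
      f (pure K (unit_mod K) X n x ys) = g x ys"
  proof (rule D.comp_lift[OF mod_X])
    fix x ys assume T: "(x, ys) \<in> tensors (unit_mod K) X n"
    show "g x ys \<in> carrier (obj X n)" using one[OF T] by (auto simp: g_def)
    fix \<sigma> assume \<sigma>: "\<sigma> permutes {1..length ys}"
    have "perm_factors \<sigma> ys = ys" if "length ys = 1"
      using mset_perm_factors[OF \<sigma>] that by (cases ys) auto
    then show "g (act (unit_mod K) (length ys) \<sigma> x) ys = g x (perm_factors \<sigma> ys)" by (auto simp: g_def)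
  next
    fix x x' ys assume T: "(x, ys) \<in> tensors (unit_mod K) X n" "(x', ys) \<in> tensors (unit_mod K) X n"
    show "g (x \<oplus>\<^bsub>obj (unit_mod K) (length ys)\<^esub> x') ys = g x ys \<oplus>\<^bsub>obj X n\<^esub> g x' ys"
      using one[OF T(1)] one[OF T(2)] by (auto simp: g_def X.smult_l_distr)
  next
    fix c x ys assume c: "c \<in> carrier K" and T: "(x, ys) \<in> tensors (unit_mod K) X n"
    show "g (c \<odot>\<^bsub>obj (unit_mod K) (length ys)\<^esub> x) ys = c \<odot>\<^bsub>obj X n\<^esub> g x ys"
      using one[OF T] c by (auto simp: g_def X.smult_assoc1)
  next
    fix x us J y y' vs
    assume T: "(x, us @ (J, y) # vs) \<in> tensors (unit_mod K) X n" "(x, us @ (J, y') # vs) \<in> tensors (unit_mod K) X n"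
    show "g x (us @ (J, y \<oplus>\<^bsub>obj X (card J)\<^esub> y') # vs) =
      g x (us @ (J, y) # vs) \<oplus>\<^bsub>obj X n\<^esub> g x (us @ (J, y') # vs)"
      using one[OF T(1)] one[OF T(2)] by (auto simp: g_def X.smult_r_distr)
  next
    fix c x us J y vs
    assume c: "c \<in> carrier K" and T: "(x, us @ (J, y) # vs) \<in> tensors (unit_mod K) X n"
    show "g x (us @ (J, c \<odot>\<^bsub>obj X (card J)\<^esub> y) # vs) = c \<odot>\<^bsub>obj X n\<^esub> g x (us @ (J, y) # vs)"
      using one[OF T] c by (auto simp: g_def X.smult_assoc1[symmetric] D.K.m_comm)
  qed
  from D.comp_lift_spec[OF this[unfolded g_def], folded left_unitor_def]
  show "left_unitor K X n \<in> lin_maps K (comp_obj K (unit_mod K) X n) (obj X n)"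
    and "(a, ys) \<in> tensors (unit_mod K) X n \<Longrightarrow> left_unitor K X n (pure K (unit_mod K) X n a ys) =
      (if length ys = 1 then unscal a \<odot>\<^bsub>obj X n\<^esub> snd (hd ys) else \<zero>\<^bsub>obj X n\<^esub>)"
    by auto
qed

lemma left_unitor_inv:
  assumes "cring K" and mod_X: "\<And>n. module K (obj X n)"
  shows "left_unitor_inv K X n \<in> lin_maps K (obj X n) (comp_obj K (unit_mod K) X n)"
    and "y \<in> carrier (obj X n) \<Longrightarrow> (Scal \<one>\<^bsub>K\<^esub>, [({1..n}, y)]) \<in> tensors (unit_mod K) X n"
proof -
  interpret D: comp_data K "unit_mod K" X by (rule comp_data_unit) fact+
  have T: "(Scal \<one>\<^bsub>K\<^esub>, [] @ ({1..n}, y) # []) \<in> tensors (unit_mod K) X n" if "y \<in> carrier (obj X n)" for y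
    using that by (simp add: tensors_def decomp_singleton)
  then show "y \<in> carrier (obj X n) \<Longrightarrow> (Scal \<one>\<^bsub>K\<^esub>, [({1..n}, y)]) \<in> tensors (unit_mod K) X n" by simp
  show "left_unitor_inv K X n \<in> lin_maps K (obj X n) (comp_obj K (unit_mod K) X n)"
  proof (rule lin_mapsI)
    show "left_unitor_inv K X n y \<in> carrier (comp_obj K (unit_mod K) X n)" if "y \<in> carrier (obj X n)" for y
      using D.pure_closed[OF T[OF that]] by (simp add: left_unitor_inv_def)
    show "left_unitor_inv K X n (y \<oplus>\<^bsub>obj X n\<^esub> y') =
      left_unitor_inv K X n y \<oplus>\<^bsub>comp_obj K (unit_mod K) X n\<^esub> left_unitor_inv K X n y'"
      if "y \<in> carrier (obj X n)" "y' \<in> carrier (obj X n)" for y y'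
      using D.pure_right_add[OF T[OF that(1)] T[OF that(2)]] by (simp add: left_unitor_inv_def)
    show "left_unitor_inv K X n (a \<odot>\<^bsub>obj X n\<^esub> y) = a \<odot>\<^bsub>comp_obj K (unit_mod K) X n\<^esub> left_unitor_inv K X n y"
      if "a \<in> carrier K" "y \<in> carrier (obj X n)" for a y
      using D.pure_right_smult[OF that(1) T[OF that(2)]] by (simp add: left_unitor_inv_def)
  qed
qed

lemma com_operad_simps [simp]:
  "und (com_operad K) = com_mod K" "op_unit (com_operad K) n x = x"
  "op_aug (com_operad K) n x = (if n = 1 then x else Scal \<zero>\<^bsub>K\<^esub>)"
  by (simp_all add: com_operad_def)

text \<open>The value is computed block by block: either all blocks produce the restrictions of one
  chain \<open>c'\<close>, or a single zero factor annihilates the tensor.\<close>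

lemma comp_map_basis:
  assumes "com_comp K X d e" "com_comp K X' d' e'"
    and \<psi>: "\<And>n. \<psi> n \<in> lin_maps K (obj X n) (obj X' n)"
  shows "comp_map K (com_mod K) X (com_mod K) X' (\<lambda>_ x. x) \<psi> n \<in>
      lin_maps K (comp_obj K (com_mod K) X n) (comp_obj K (com_mod K) X' n)"
    and "c \<in> partition_chains n (Suc d) \<Longrightarrow> c' \<in> partition_chains n (Suc d') \<Longrightarrow> c' ! 1 = c ! 1 \<Longrightarrow>
      (\<And>J. J \<in> c ! 1 \<Longrightarrow> \<psi> (card J) (e (card J) (restr J c)) = e' (card J) (restr J c')) \<Longrightarrow>
      comp_map K (com_mod K) X (com_mod K) X' (\<lambda>_ x. x) \<psi> n (comp_basis K X e n c) = comp_basis K X' e' n c'"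
    and "c \<in> partition_chains n (Suc d) \<Longrightarrow> J \<in> c ! 1 \<Longrightarrow>
      \<psi> (card J) (e (card J) (restr J c)) = \<zero>\<^bsub>obj X' (card J)\<^esub> \<Longrightarrow>
      comp_map K (com_mod K) X (com_mod K) X' (\<lambda>_ x. x) \<psi> n (comp_basis K X e n c) =
        \<zero>\<^bsub>comp_obj K (com_mod K) X' n\<^esub>"
proof -
  interpret C: com_comp K X d e by fact
  interpret C': com_comp K X' d' e' by fact
  let ?m = "map (\<lambda>(J, y). (J, \<psi> (card J) y))"
  have "(\<lambda>x. x) \<in> lin_maps K (obj (com_mod K) n) (obj (com_mod K) n)" for n by (rule lin_maps_id)
  note cm = comp_map[OF C.comp_data_axioms C'.comp_data_axioms this \<psi>, simplified act_com_mod]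
  show "comp_map K (com_mod K) X (com_mod K) X' (\<lambda>_ x. x) \<psi> n \<in>
      lin_maps K (comp_obj K (com_mod K) X n) (comp_obj K (com_mod K) X' n)"
    by (rule cm(1)) simp
  assume c: "c \<in> partition_chains n (Suc d)"
  define ys where "ys = map (\<lambda>J. (J, e (card J) (restr J c))) (enum_set (c ! 1))"
  note B = C.basis_chain[OF c, folded ys_def]
  have eq: "comp_map K (com_mod K) X (com_mod K) X' (\<lambda>_ x. x) \<psi> n (comp_basis K X e n c) =
      C'.pureC n (Scal \<one>\<^bsub>K\<^esub>) (?m ys)"
    unfolding B(2) by (rule cm(2)[OF _ B(1)]) simp
  have T: "(Scal \<one>\<^bsub>K\<^esub>, ?m ys) \<in> C'.tensorsC n" by (rule cm(3)[OF _ B(1)]) simp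
  have m: "map fst (?m ys) = map fst ys" by auto
  {
    assume c': "c' \<in> partition_chains n (Suc d')" "c' ! 1 = c ! 1"
      "\<And>J. J \<in> c ! 1 \<Longrightarrow> \<psi> (card J) (e (card J) (restr J c)) = e' (card J) (restr J c')"
    show "comp_map K (com_mod K) X (com_mod K) X' (\<lambda>_ x. x) \<psi> n (comp_basis K X e n c) = comp_basis K X' e' n c'"
      unfolding eq
    proof (rule C'.chain_tensor(2)[OF c'(1)])
      show "distinct (map fst (?m ys))" unfolding m by (rule B(3))
      show "fst ` set (?m ys) = c' ! 1" unfolding c'(2) B(4)[symmetric] by force
      show "y = e' (card J) (restr J c')" if "(J, y) \<in> set (?m ys)" for J y
        using that c'(3) B(5) by auto
    qed
  }
  assume J: "J \<in> c ! 1" "\<psi> (card J) (e (card J) (restr J c)) = \<zero>\<^bsub>obj X' (card J)\<^esub>"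
  then have "(J, \<zero>\<^bsub>obj X' (card J)\<^esub>) \<in> set (?m ys)" using B(5) by (force simp: image_iff)
  then obtain us vs where "?m ys = us @ (J, \<zero>\<^bsub>obj X' (card J)\<^esub>) # vs" by (meson split_list)
  then show "comp_map K (com_mod K) X (com_mod K) X' (\<lambda>_ x. x) \<psi> n (comp_basis K X e n c) =
        \<zero>\<^bsub>comp_obj K (com_mod K) X' n\<^esub>"
    unfolding eq using C'.pure_right_zero[of "Scal \<one>\<^bsub>K\<^esub>" us J "\<zero>\<^bsub>obj X' (card J)\<^esub>" vs n] T by simp
qed

text \<open>After removal of the top only the condition on the new first entry can fail; the others
  are inherited.\<close>

lemma tl_chain_iff:
  assumes c: "c \<in> partition_chains n (Suc d)"
  shows "tl c \<in> partition_chains n d \<longleftrightarrow> c ! 1 = {{1..n}}"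
proof
  note D = partition_chainsD[OF c]
  have nth: "tl c ! i = c ! Suc i" if "i \<le> d" for i using that D(1) by (simp add: nth_tl)
  { assume "tl c \<in> partition_chains n d"
    then show "c ! 1 = {{1..n}}" using partition_chainsD(4)[of "tl c" n d] nth[of 0] by simp }
  assume top: "c ! 1 = {{1..n}}"
  show "tl c \<in> partition_chains n d"
  proof (rule partition_chainsI)
    show "length (tl c) = Suc d" using D(1) by simp
    show "partition_on {1..n} l" if "l \<in> set (tl c)" for l 
      using D(2)[of l] that by (cases c) auto
    show "refines {1..n} (tl c ! Suc i) (tl c ! i)" if "i < d" for i
      using D(3)[of "Suc i"] that nth[of i] nth[of "Suc i"] by simp
    show "tl c ! 0 = {{1..n}}" using nth[of 0] top by simp
    show "tl c ! d = (\<lambda>i. {i}) ` {1..n}" using nth[of d] D(5) by simp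
  qed
qed

text \<open>The enumeration of \<open>{1..n}\<close> is the identity, so restricting to the whole
  set amounts to the zeroth face.\<close>

lemma restr_top:
  assumes c: "c \<in> partition_chains n (Suc d)" shows "restr {1..n} c = tl c"
  unfolding restr_def
proof (rule map_idI)
  fix l assume "l \<in> set (tl c)"
  then have "l \<in> set c" by (cases c) auto
  then have "l \<subseteq> Pow {1..n}" using partition_onD1[OF partition_chainsD(2)[OF c]] by blast
  then show "restr_part {1..n} l = l" by (rule restr_part_interval)
qed

context com_comp
begin

text \<open>The augmentation kills left entries of arity other than 1, so only chains whose second
  partition is a single block survive. For these, the one remaining factor is the basis element of
  the shortened chain.\<close>

lemma aug_first:
  shows "aug_first K (com_operad K) X n \<in> lin_maps K (objC n) (obj X n)"
    and "c \<in> partition_chains n (Suc d) \<Longrightarrow> aug_first K (com_operad K) X n (comp_basis K X e n c) =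
      (if tl c \<in> partition_chains n d then e n (tl c) else \<zero>\<^bsub>obj X n\<^esub>)"
proof -
  interpret I: comp_data K "unit_mod K" X by (rule comp_data_unit[OF cring mod_X])
  have aug: "op_aug (com_operad K) n \<in> lin_maps K (obj (com_mod K) n) (obj (unit_mod K) n)" for n
    by (rule lin_mapsI) auto
  note cm = comp_map[OF comp_data_axioms I.comp_data_axioms aug lin_maps_id, simplified act_com_mod act_unit_mod, OF HOL.refl]
  note lu = left_unitor[OF cring mod_X]
  show "aug_first K (com_operad K) X n \<in> lin_maps K (objC n) (obj X n)"
    unfolding aug_first_def com_operad_simps(1) by (rule lin_maps_comp[OF cm(1) lu(1)])
  assume c: "c \<in> partition_chains n (Suc d)"
  interpret X: module K "obj X n" by (rule mod_X)
  define ys where "ys = map (\<lambda>J. (J, e (card J) (restr J c))) (enum_set (c ! 1))"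
  note B = basis_chain[OF c, folded ys_def]
  have m: "map (\<lambda>(J, y). (J, y)) ys = ys" by simp
  have "aug_first K (com_operad K) X n (comp_basis K X e n c) =
      (if length ys = 1 then \<one>\<^bsub>K\<^esub> \<odot>\<^bsub>obj X n\<^esub> snd (hd ys) else \<zero>\<^bsub>obj X n\<^esub>)"
    using cm(2)[OF B(1)] lu(2)[OF cm(3)[OF B(1)]] unfolding m
    by (simp add: aug_first_def B(2))
  also have "\<dots> = (if tl c \<in> partition_chains n d then e n (tl c) else \<zero>\<^bsub>obj X n\<^esub>)"
  proof (cases "c ! 1 = {{1..n}}")
    case True
    have "card (c ! 1) = length ys" using B(3,4) distinct_card[OF B(3)] by simp
    then have "length ys = 1" by (simp only: True card_1_singleton_iff) simp
    then obtain z where z: "ys = [z]" by (auto simp: length_Suc_conv)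
    have "({1..n}, e (card {1..n}) (restr {1..n} c)) \<in> set ys" using B(5) True by blast
    then have "snd z = e n (tl c)" using z restr_top[OF c] by auto
    moreover have tl: "tl c \<in> partition_chains n d" using True tl_chain_iff[OF c] by simp
    ultimately show ?thesis using z e_closed[OF tl] by simp
  next
    case False
    have "length ys \<noteq> 1"
    proof
      assume "length ys = 1"
      then obtain J y where z: "ys = [(J, y)]" by (cases ys) (auto simp: length_Suc_conv)
      then have "c ! 1 = {J}" using B(4) by simp
      then have "{1..n} = J" using partition_onD1[OF partition_chainsD(6)[OF c, of 1]] by simp
      then show False using False \<open>c ! 1 = {J}\<close> by simp
    qed
    then show ?thesis using False tl_chain_iff[OF c] by simp
  qed
  finally show "aug_first K (com_operad K) X n (comp_basis K X e n c) =
      (if tl c \<in> partition_chains n d then e n (tl c) else \<zero>\<^bsub>obj X n\<^esub>)" .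
qed

lemma top_Cons_chain:
  assumes c: "c \<in> partition_chains n d" shows "{{1..n}} # c \<in> partition_chains n (Suc d)"
proof (rule partition_chainsI)
  note D = partition_chainsD[OF c]
  have top: "partition_on {1..n} {{1..n}}" using D(6)[of 0] D(4) by simp
  show "length ({{1..n}} # c) = Suc (Suc d)" using D(1) by simp
  show "partition_on {1..n} l" if "l \<in> set ({{1..n}} # c)" for l using that D(2) top by auto
  show "refines {1..n} (({{1..n}} # c) ! Suc i) (({{1..n}} # c) ! i)" if "i < Suc d" for i
    using that D(3)[of "i - 1"] D(4) refines_refl[OF top] by (cases i) auto
qed (use partition_chainsD(5)[OF c] in auto)

text \<open>Inserting the unit gives a tensor with the single index set \<open>{1..n}\<close>, which
  belongs to the chain with its top repeated.\<close>

lemma unit_first: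
  shows "unit_first K (com_operad K) X n \<in> lin_maps K (obj X n) (objC n)"
    and "c \<in> partition_chains n d \<Longrightarrow> unit_first K (com_operad K) X n (e n c) =
      comp_basis K X e n ({{1..n}} # c)"
proof -
  interpret I: comp_data K "unit_mod K" X by (rule comp_data_unit[OF cring mod_X])
  have unit: "op_unit (com_operad K) n \<in> lin_maps K (obj (unit_mod K) n) (obj (com_mod K) n)" for n
    by (rule lin_mapsI) (auto split: if_splits)
  note cm = comp_map[OF I.comp_data_axioms comp_data_axioms unit lin_maps_id, simplified act_com_mod act_unit_mod, OF HOL.refl]
  note li = left_unitor_inv[OF cring mod_X]
  show "unit_first K (com_operad K) X n \<in> lin_maps K (obj X n) (objC n)"
    unfolding unit_first_def com_operad_simps(1) by (rule lin_maps_comp[OF li(1) cm(1)])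
  assume c: "c \<in> partition_chains n d"
  have "unit_first K (com_operad K) X n (e n c) = pureC n (Scal \<one>\<^bsub>K\<^esub>) [({1..n}, e n c)]"
    using cm(2)[OF li(2)[OF e_closed[OF c]]] by (simp add: unit_first_def left_unitor_inv_def)
  also have "\<dots> = comp_basis K X e n ({{1..n}} # c)"
  proof (rule chain_tensor(2)[OF top_Cons_chain[OF c]])
    show "y = e (card J) (restr J ({{1..n}} # c))" if "(J, y) \<in> set [({1..n}, e n c)]" for J y
      using that restr_top[OF top_Cons_chain[OF c]] by simp
  qed (use partition_chainsD(4)[OF c] in auto)
  finally show "unit_first K (com_operad K) X n (e n c) = comp_basis K X e n ({{1..n}} # c)" .
qed

end

section \<open>Simplicial operations on chains of partitions\<close>

definition chain_del :: "nat \<Rightarrow> 'a list \<Rightarrow> 'a list" where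
  "chain_del i c = take i c @ drop (Suc i) c"

definition chain_dup :: "nat \<Rightarrow> 'a list \<Rightarrow> 'a list" where
  "chain_dup j c = take (Suc j) c @ drop j c"

definition chain_act :: "(nat \<Rightarrow> nat) \<Rightarrow> nat set set list \<Rightarrow> nat set set list" where
  "chain_act w = map (\<lambda>l. (\<lambda>B. w ` B) ` l)"

text \<open>\<open>restr\<close> drops the head, whence the shift by one; operations on later
  entries are carried out on each block.\<close>

lemma restr_del: "c \<noteq> [] \<Longrightarrow> restr J (chain_del (Suc i) c) = chain_del i (restr J c)"
  by (cases c) (simp_all add: restr_def chain_del_def take_map drop_map)

lemma restr_dup: "c \<noteq> [] \<Longrightarrow> restr J (chain_dup (Suc i) c) = chain_dup i (restr J c)"
  by (cases c) (simp_all add: restr_def chain_dup_def take_map drop_map)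

lemma chain_del_nth:
  "Suc k < length c \<Longrightarrow> chain_del i c ! k = (if k < i then c ! k else c ! Suc k)"
  by (auto simp: chain_del_def nth_append)

lemma chain_dup_nth:
  assumes "j < length c"
  shows "chain_dup j c ! k = (if k \<le> j then c ! k else c ! (k - 1))"
proof -
  have "length (take (Suc j) c) = Suc j" using assms by simp
  then show ?thesis using assms by (simp add: chain_dup_def nth_append less_Suc_eq_le)
qed

lemma length_chain_del: "i < length c \<Longrightarrow> length (chain_del i c) = length c - 1"
  by (simp add: chain_del_def)

lemma length_chain_dup: "j < length c \<Longrightarrow> length (chain_dup j c) = Suc (length c)"
  by (simp add: chain_dup_def)

text \<open>Away from both ends, transitivity of refinement bridges the gap.\<close>

lemma chain_del_inner:
  assumes c: "c \<in> partition_chains n (Suc d)" and i: "0 < i" "i \<le> d"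
  shows "chain_del i c \<in> partition_chains n d"
proof (rule partition_chainsI)
  note D = partition_chainsD[OF c]
  have nth: "chain_del i c ! k = (if k < i then c ! k else c ! Suc k)" if "k \<le> d" for k
    using that D(1) by (simp add: chain_del_nth)
  show "length (chain_del i c) = Suc d" using i D(1) by (simp add: length_chain_del)
  show "partition_on {1..n} l" if "l \<in> set (chain_del i c)" for l
    using D(2)[of l] that by (auto simp: chain_del_def dest: in_set_takeD in_set_dropD)
  show "refines {1..n} (chain_del i c ! Suc k) (chain_del i c ! k)" if "k < d" for k
    using that partition_chains_refines[OF c, of "Suc k" k] partition_chains_refines[OF c, of "Suc (Suc k)" k]
      partition_chains_refines[OF c, of "Suc (Suc k)" "Suc k"] by (simp add: nth)
  show "chain_del i c ! 0 = {{1..n}}" using nth[of 0] i D(4) by simp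
  show "chain_del i c ! d = (\<lambda>i. {i}) ` {1..n}" using nth[of d] i D(5) by simp
qed

lemma chain_dup_chain:
  assumes c: "c \<in> partition_chains n d" and j: "j \<le> d"
  shows "chain_dup j c \<in> partition_chains n (Suc d)"
proof (rule partition_chainsI)
  note D = partition_chainsD[OF c]
  have nth: "chain_dup j c ! k = (if k \<le> j then c ! k else c ! (k - 1))" if "k \<le> Suc d" for k
    using that D(1) j by (simp add: chain_dup_nth)
  show "length (chain_dup j c) = Suc (Suc d)" using j D(1) by (simp add: length_chain_dup)
  show "partition_on {1..n} l" if "l \<in> set (chain_dup j c)" for l
    using D(2)[of l] that by (auto simp: chain_dup_def dest: in_set_takeD in_set_dropD)
  show "refines {1..n} (chain_dup j c ! Suc k) (chain_dup j c ! k)" if "k < Suc d" for k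
    using that j partition_chains_refines[OF c, of "Suc k" k] partition_chains_refines[OF c, of k k]
      partition_chains_refines[OF c, of k "k - 1"] by (simp add: nth)
  show "chain_dup j c ! 0 = {{1..n}}" using nth[of 0] D(4) by simp
  show "chain_dup j c ! Suc d = (\<lambda>i. {i}) ` {1..n}" using nth[of "Suc d"] j D(5) by simp
qed

text \<open>When the first two entries are spared, only the ending in singletons can be lost, and
  this is visible on the blocks. The gluing criterion passes from the blockwise test to the global
  one.\<close>

lemma chain_del_iff:
  assumes c: "c \<in> partition_chains n (Suc (Suc d))" and i: "i \<le> d"
  shows "chain_del (Suc (Suc i)) c \<in> partition_chains n (Suc d) \<longleftrightarrow>
      (\<forall>J\<in>c ! 1. chain_del (Suc i) (restr J c) \<in> partition_chains (card J) d)"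
    and "chain_del (Suc (Suc i)) c ! 1 = c ! 1"
proof -
  note D = partition_chainsD[OF c]
  let ?c = "chain_del (Suc (Suc i)) c"
  have ne: "c \<noteq> []" using D(1) by auto
  have nth: "?c ! k = (if k < Suc (Suc i) then c ! k else c ! Suc k)" if "k \<le> Suc d" for k
    using that D(1) by (simp add: chain_del_nth)
  show 1: "?c ! 1 = c ! 1" using nth[of 1] by simp
  show "?c \<in> partition_chains n (Suc d) \<longleftrightarrow>
      (\<forall>J\<in>c ! 1. chain_del (Suc i) (restr J c) \<in> partition_chains (card J) d)"
    unfolding restr_del[OF ne, symmetric]
  proof
    assume "?c \<in> partition_chains n (Suc d)"
    then show "\<forall>J\<in>c ! 1. restr J ?c \<in> partition_chains (card J) d"
      using restr_chain[of ?c n d] 1 by simp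
  next
    assume loc: "\<forall>J\<in>c ! 1. restr J ?c \<in> partition_chains (card J) d"
    show "?c \<in> partition_chains n (Suc d)"
    proof (rule chain_glue(1))
      show "length ?c = Suc (Suc d)" using D(1) i by (simp add: length_chain_del)
      show "?c ! 0 = {{1..n}}" using nth[of 0] D(4) by simp
      show "1 \<le> n" by (rule partition_chains_pos[OF c])
      show "partition_on {1..n} (c ! 1)" by (rule D(6)) simp
      show "\<exists>J\<in>c ! 1. B \<subseteq> J" if k: "k \<le> d" "B \<in> ?c ! Suc k" for k B
      proof -
        \<comment> \<open>Below its top, the shortened chain consists of entries of \<open>c\<close>
          after the first, all of which refine \<open>c ! 1\<close>.\<close>
        have "\<exists>m\<in>{1..Suc (Suc d)}. ?c ! Suc k = c ! m"
          using nth[of "Suc k"] k(1) by (auto intro: bexI[of _ "Suc k"] bexI[of _ "Suc (Suc k)"])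
        then obtain m where m: "m \<in> {1..Suc (Suc d)}" "B \<in> c ! m" using k(2) by auto
        then have "refines {1..n} (c ! m) (c ! 1)" using partition_chains_refines[OF c, of m 1] by simp
        then show ?thesis using m(2) unfolding refines_def by blast
      qed
    qed (use loc in blast)
  qed
qed

lemma partition_on_image:
  assumes "partition_on A P" "inj_on w A" shows "partition_on (w ` A) ((`) w ` P)"
  unfolding partition_on_def
proof (intro conjI)
  show "\<Union>((`) w ` P) = w ` A" using partition_onD1[OF assms(1)] by auto
  show "disjoint ((`) w ` P)"
    using disjoint_image[OF _ partition_onD2[OF assms(1)], of w] assms(2) partition_onD1[OF assms(1)] by simp
  show "{} \<notin> (`) w ` P" using partition_onD3[OF assms(1)] by auto
qed

lemma chain_act_nth: "i < length c \<Longrightarrow> chain_act w c ! i = (`) w ` (c ! i)"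
  by (simp add: chain_act_def)

lemma chain_act_chain:
  assumes w: "w permutes {1..n}" and c: "c \<in> partition_chains n d"
  shows "chain_act w c \<in> partition_chains n d"
proof (rule partition_chainsI)
  note D = partition_chainsD[OF c]
  have im: "w ` {1..n} = {1..n}" by (rule permutes_image[OF w])
  have P: "partition_on {1..n} ((`) w ` l)" if "partition_on {1..n} l" for l
    using partition_on_image[OF that permutes_inj_on[OF w]] im by simp
  have nth: "chain_act w c ! i = (`) w ` (c ! i)" if "i \<le> d" for i
    using that D(1) by (simp add: chain_act_nth)
  show "length (chain_act w c) = Suc d" using D(1) by (simp add: chain_act_def)
  show "partition_on {1..n} l" if "l \<in> set (chain_act w c)" for l
    using that P D(2) unfolding chain_act_def by fastforce
  show "refines {1..n} (chain_act w c ! Suc i) (chain_act w c ! i)" if i: "i < d" for i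
  proof -
    have "\<exists>Y\<in>(`) w ` (c ! i). X \<subseteq> Y" if X: "X \<in> (`) w ` (c ! Suc i)" for X
    proof -
      obtain X' where X': "X' \<in> c ! Suc i" "X = w ` X'" using X by blast
      then obtain Y where "Y \<in> c ! i" "X' \<subseteq> Y" using D(3)[OF i] unfolding refines_def by blast
      then show ?thesis using X'(2) by blast
    qed
    then show ?thesis
      using P[OF D(6)[of i]] P[OF D(6)[of "Suc i"]] i nth[of i] nth[of "Suc i"] unfolding refines_def by simp
  qed
  show "chain_act w c ! 0 = {{1..n}}" using nth[of 0] D(4) im by simp
  have "(`) w ` (\<lambda>i. {i}) ` {1..n} = (\<lambda>i. {i}) ` w ` {1..n}" by (simp add: image_image)
  then show "chain_act w c ! d = (\<lambda>i. {i}) ` {1..n}" using nth[of d] D(5) im by simp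
qed

text \<open>The standardisation appearing here is the one by which the action on a composite acts on
  each factor.\<close>

lemma restr_act:
  assumes w: "w permutes {1..n}" and c: "c \<in> partition_chains n (Suc d)" and J: "J \<in> c ! 1"
  shows "restr (w ` J) (chain_act w c) = chain_act (std_perm w J) (restr J c)"
proof -
  note D = partition_chainsD[OF c]
  have JA: "J \<subseteq> {1..n}" using partition_on_block(1)[OF D(6) J] by simp
  then have fin: "finite J" by (rule finite_subset) simp
  have "restr_part (w ` J) ((`) w ` l) = (`) (std_perm w J) ` restr_part J l" if l: "l \<in> set (tl c)" for l
  proof (rule restr_part_act[OF fin])
    obtain i where "i < length (tl c)" "l = tl c ! i" using l by (metis in_set_conv_nth)
    then have i: "i \<le> d" "l = c ! Suc i" using D(1) by (simp_all add: nth_tl)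
    have P: "partition_on {1..n} l" using D(6)[of "Suc i"] i by simp
    show "inj_on w (\<Union>l \<union> J)" by (rule inj_on_subset[OF permutes_inj[OF w]]) simp
    show "B \<subseteq> J" if "B \<in> l" "B \<inter> J \<noteq> {}" for B
      using block_sub[OF partition_chains_refines[OF c, of "Suc i" 1] J] i that by simp
    show "{} \<notin> l" by (rule partition_onD3[OF P])
  qed
  then show ?thesis by (simp add: restr_def chain_act_def map_tl[symmetric])
qed

section \<open>The action of permutations\<close>

context com_comp
begin

text \<open>Standardisation preserves the module of each factor, so linearity of the action on
  \<open>X\<close> makes the prescribed values multilinear. On basis elements
  \<open>restr_act\<close> recognises the moved factors as restrictions of the translated
  chain.\<close>

lemma comp_act:
  assumes lin: "\<And>m \<sigma>. \<sigma> permutes {1..m} \<Longrightarrow> act X m \<sigma> \<in> lin_maps K (obj X m) (obj X m)"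
    and act_e: "\<And>m \<sigma> c. \<sigma> permutes {1..m} \<Longrightarrow> c \<in> partition_chains m d \<Longrightarrow>
      act X m \<sigma> (e m c) = e m (chain_act \<sigma> c)"
    and w: "w permutes {1..n}"
  shows "act (comp K (com_mod K) X) n w \<in> lin_maps K (objC n) (objC n)"
    and "c \<in> partition_chains n (Suc d) \<Longrightarrow>
      act (comp K (com_mod K) X) n w (comp_basis K X e n c) = comp_basis K X e n (chain_act w c)"
proof -
  define m where "m = map (\<lambda>(J, y). (w ` J, act X (card J) (std_perm w J) y))"
  have m_simps: "m (us @ (J, y) # vs) = m us @ (w ` J, act X (card J) (std_perm w J) y) # m vs"
    "length (m ys) = length ys" for us J y vs ys by (simp_all add: m_def)
  have inj: "inj w" by (rule permutes_inj[OF w])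
  \<comment> \<open>As \<open>w\<close> preserves cardinality, a moved factor remains in the same
    component of \<open>X\<close>.\<close>
  have blk: "finite J" "card (w ` J) = card J" "std_perm w J permutes {1..card J}"
    if T: "(x, ys) \<in> tensorsC n" "(J, y) \<in> set ys" for x ys J y
  proof -
    have "J \<subseteq> {1..n}" using tensorsD(1)[OF T(1)] T(2) by (force simp: decomp_iff)
    then show "finite J" by (rule finite_subset) simp
    then show "card (w ` J) = card J" "std_perm w J permutes {1..card J}"
      using std_perm(2)[of J w] inj by (auto intro: card_image inj_on_subset)
  qed
  have T': "(x, m ys) \<in> tensorsC n" if T: "(x, ys) \<in> tensorsC n" for x ys
  proof -
    have fst: "map fst (m ys) = map ((`) w) (map fst ys)" by (auto simp: m_def)
    have "decomp n (map ((`) w) (map fst ys))"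
      unfolding decomp_iff
    proof (intro conjI allI impI)
      fix i j assume "i < length (map ((`) w) (map fst ys))" "j < length (map ((`) w) (map fst ys))" "i \<noteq> j"
      then show "map ((`) w) (map fst ys) ! i \<inter> map ((`) w) (map fst ys) ! j = {}"
        using tensorsD(1)[OF T] by (simp add: decomp_iff image_Int[OF inj, symmetric])
    next
      have "\<Union>(set (map ((`) w) (map fst ys))) = w ` \<Union>(set (map fst ys))" by auto
      then show "\<Union>(set (map ((`) w) (map fst ys))) = {1..n}"
        using tensorsD(1)[OF T] permutes_image[OF w] by (simp only: decomp_iff)
    qed
    moreover have "z \<in> carrier (obj X (card L))" if L: "(L, z) \<in> set (m ys)" for L z
    proof -
      obtain J y where y: "(J, y) \<in> set ys" "L = w ` J" "z = act X (card J) (std_perm w J) y"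
        using L by (auto simp: m_def)
      then show ?thesis
        using lin_mapsD(1)[OF lin[OF blk(3)[OF T y(1)]] tensorsD(3)[OF T y(1)]] blk(2)[OF T y(1)] by simp
    qed
    ultimately show ?thesis
      using tensorsD(2)[OF T] unfolding tensors_def mem_Collect_eq case_prod_conv fst m_simps by blast
  qed
  have "\<exists>f\<in>lin_maps K (objC n) (objC n). \<forall>(x, ys)\<in>tensorsC n. f (pureC n x ys) = pureC n x (m ys)"
  proof (rule comp_lift[OF comp_obj_module])
    fix x ys assume T: "(x, ys) \<in> tensorsC n"
    show "pureC n x (m ys) \<in> carrier (objC n)" by (rule pure_closed[OF T'[OF T]])
  next
    fix x x' ys assume T: "(x, ys) \<in> tensorsC n" "(x', ys) \<in> tensorsC n"
    show "pureC n (x \<oplus>\<^bsub>obj (com_mod K) (length ys)\<^esub> x') (m ys) =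
        pureC n x (m ys) \<oplus>\<^bsub>objC n\<^esub> pureC n x' (m ys)"
      using pure_left_add[OF T'[OF T(1)] T'[OF T(2)]] by (simp only: m_simps)
  next
    fix a x ys assume a: "a \<in> carrier K" and T: "(x, ys) \<in> tensorsC n"
    show "pureC n (a \<odot>\<^bsub>obj (com_mod K) (length ys)\<^esub> x) (m ys) = a \<odot>\<^bsub>objC n\<^esub> pureC n x (m ys)"
      using pure_left_smult[OF a T'[OF T]] by (simp only: m_simps)
  next
    fix x us J y y' vs assume T: "(x, us @ (J, y) # vs) \<in> tensorsC n" "(x, us @ (J, y') # vs) \<in> tensorsC n"
    have y: "y \<in> carrier (obj X (card J))" "y' \<in> carrier (obj X (card J))"
      using tensorsD(3)[OF T(1), of J y] tensorsD(3)[OF T(2), of J y'] by auto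
    have J: "card (w ` J) = card J" "std_perm w J permutes {1..card J}" using blk[OF T(1), of J y] by auto
    show "pureC n x (m (us @ (J, y \<oplus>\<^bsub>obj X (card J)\<^esub> y') # vs)) =
        pureC n x (m (us @ (J, y) # vs)) \<oplus>\<^bsub>objC n\<^esub> pureC n x (m (us @ (J, y') # vs))"
      using pure_right_add[OF T'[OF T(1), unfolded m_simps] T'[OF T(2), unfolded m_simps]]
        lin_mapsD(2)[OF lin[OF J(2)] y] by (simp add: m_simps J(1))
  next
    fix a x us J y vs assume a: "a \<in> carrier K" and T: "(x, us @ (J, y) # vs) \<in> tensorsC n"
    have y: "y \<in> carrier (obj X (card J))" using tensorsD(3)[OF T, of J y] by auto
    have J: "card (w ` J) = card J" "std_perm w J permutes {1..card J}" using blk[OF T, of J y] by auto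
    show "pureC n x (m (us @ (J, a \<odot>\<^bsub>obj X (card J)\<^esub> y) # vs)) = a \<odot>\<^bsub>objC n\<^esub> pureC n x (m (us @ (J, y) # vs))"
      using pure_right_smult[OF a T'[OF T, unfolded m_simps]] lin_mapsD(3)[OF lin[OF J(2)] a y]
      by (simp add: m_simps J(1))
  next
    fix x ys \<sigma> assume T: "(x, ys) \<in> tensorsC n" and \<sigma>: "\<sigma> permutes {1..length ys}"
    have "perm_factors \<sigma> (m ys) = m (perm_factors \<sigma> ys)"
      unfolding m_def by (rule perm_factors_map[OF \<sigma>])
    then show "pureC n (act (com_mod K) (length ys) \<sigma> x) (m ys) = pureC n x (m (perm_factors \<sigma> ys))"
      using pure_perm[OF T'[OF T], of \<sigma>] \<sigma> by (simp only: m_simps)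
  qed
  note spec = comp_lift_spec[OF this]
  have act: "act (comp K (com_mod K) X) n w =
      comp_lift K (com_mod K) X n (objC n) (\<lambda>x ys. pureC n x (m ys))"
    by (simp add: comp_def m_def)
  show "act (comp K (com_mod K) X) n w \<in> lin_maps K (objC n) (objC n)"
    unfolding act by (rule spec(1))
  assume c: "c \<in> partition_chains n (Suc d)"
  define ys where "ys = map (\<lambda>J. (J, e (card J) (restr J c))) (enum_set (c ! 1))"
  note B = basis_chain[OF c, folded ys_def]
  have "act (comp K (com_mod K) X) n w (comp_basis K X e n c) = pureC n (Scal \<one>\<^bsub>K\<^esub>) (m ys)"
    unfolding act B(2) by (rule spec(2)[OF B(1)])
  also have "\<dots> = comp_basis K X e n (chain_act w c)"
  proof (rule chain_tensor(2)[OF chain_act_chain[OF w c]])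
    have fst: "map fst (m ys) = map ((`) w) (map fst ys)" by (auto simp: m_def)
    have "inj ((`) w)" using inj by (simp add: inj_image_eq_iff inj_def)
    then show "distinct (map fst (m ys))" unfolding fst distinct_map[of "(`) w"]
      using B(3) by (auto intro: inj_on_subset)
    have "fst ` set (m ys) = (`) w ` fst ` set ys" using fst by (metis set_map)
    then show "fst ` set (m ys) = chain_act w c ! 1"
      using B(4) partition_chainsD(1)[OF c] by (simp add: chain_act_nth)
    show "z = e (card L) (restr L (chain_act w c))" if L: "(L, z) \<in> set (m ys)" for L z
    proof -
      obtain J y where y: "(J, y) \<in> set ys" "L = w ` J" "z = act X (card J) (std_perm w J) y"
        using L by (auto simp: m_def)
      then have J: "J \<in> c ! 1" "y = e (card J) (restr J c)" using B(5) by auto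
      show ?thesis
        using act_e[OF blk(3)[OF B(1) y(1)] restr_chain[OF c J(1)]] restr_act[OF w c J(1)]
          blk(2)[OF B(1) y(1)] y J by simp
    qed
  qed
  finally show "act (comp K (com_mod K) X) n w (comp_basis K X e n c) = comp_basis K X e n (chain_act w c)" .
qed

end

section \<open>The product of the first two factors\<close>

text \<open>Disjointness in a form that splits over concatenation, as flattened decompositions
  require.\<close>

lemma decomp_sorted_wrt: "decomp n Js \<longleftrightarrow> sorted_wrt disjnt Js \<and> \<Union>(set Js) = {1..n}"
proof -
  have "sorted_wrt disjnt Js \<longleftrightarrow> (\<forall>i<length Js. \<forall>j<i. Js ! i \<inter> Js ! j = {})"
  proof
    assume *: "sorted_wrt disjnt Js"
    have "Js ! j \<inter> Js ! i = {}" if "i < length Js" "j < i" for i j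
      using sorted_wrt_nth_less[OF * that(2,1)] by (simp add: disjnt_def)
    then show "\<forall>i<length Js. \<forall>j<i. Js ! i \<inter> Js ! j = {}" by blast
  next
    assume *: "\<forall>i<length Js. \<forall>j<i. Js ! i \<inter> Js ! j = {}"
    have "Js ! i \<inter> Js ! j = {}" if "i < j" "j < length Js" for i j
      using * that by (metis Int_commute)
    then show "sorted_wrt disjnt Js"
      unfolding sorted_wrt_iff_nth_less disjnt_def by blast
  qed
  then show ?thesis by (simp add: decomp_def)
qed

lemma length_intervals [simp]: "length (intervals k ms) = length ms"
  by (induction ms arbitrary: k) auto

lemma Union_intervals: "\<Union>(set (intervals k ms)) = {k + 1..k + sum_list ms}"
proof (induction ms arbitrary: k)
  case (Cons m ms)
  have "{k + 1..k + m} \<union> {k + m + 1..k + m + sum_list ms} = {k + 1..k + (m + sum_list ms)}" by auto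
  then show ?case using Cons[of "k + m"] by (simp only: intervals.simps list.simps Union_insert sum_list.Cons)
qed simp

lemma sorted_wrt_intervals: "sorted_wrt disjnt (intervals k ms)"
proof (induction ms arbitrary: k)
  case (Cons m ms)
  have "disjnt {k + 1..k + m} J" if "J \<in> set (intervals (k + m) ms)" for J
  proof -
    have "J \<subseteq> {k + m + 1..k + m + sum_list ms}" using Union_intervals[of "k + m" ms] that by blast
    then show ?thesis by (force simp: disjnt_def)
  qed
  then show ?case using Cons by simp
qed simp

lemma decomp_intervals: "decomp (sum_list ms) (intervals 0 ms)"
  using sorted_wrt_intervals[of 0 ms] Union_intervals[of 0 ms] by (simp add: decomp_sorted_wrt)

lemma card_intervals: "i < length ms \<Longrightarrow> card (intervals k ms ! i) = ms ! i"
  by (induction ms arbitrary: k i) (auto simp: nth_Cons split: nat.splits)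

text \<open>The multiplication is \<open>coeff\<close> applied to the scalars themselves. Its values
  must also lie in the zero module when \<open>s = 0\<close>, which is a separate case.\<close>

lemma op_mult_pure:
  assumes "cring K" and T: "(x, ys) \<in> tensors (com_mod K) (com_mod K) s"
  shows "op_mult (com_operad K) s (pure K (com_mod K) (com_mod K) s x ys) =
    Scal (foldr (\<lambda>(J, y) b. unscal y \<otimes>\<^bsub>K\<^esub> b) ys (unscal x))"
proof -
  interpret K: cring K by fact
  have mod: "module K (obj (com_mod K) n)" for n
    by (simp add: ground_mod_module zero_mod_module assms(1))
  interpret D: com_data K "com_mod K" by (rule com_data.intro[OF assms(1) mod])
  have carr: "unscal y \<in> carrier K" if "y \<in> carrier (obj (com_mod K) n)" for y n
    using that by (cases "n = 0") auto
  have add: "unscal (y \<oplus>\<^bsub>obj (com_mod K) n\<^esub> y') = unscal y \<oplus>\<^bsub>K\<^esub> unscal y'"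
    if "y \<in> carrier (obj (com_mod K) n)" "y' \<in> carrier (obj (com_mod K) n)" for y y' n
    using that by (cases "n = 0") auto
  have smult: "unscal (a \<odot>\<^bsub>obj (com_mod K) n\<^esub> y) = a \<otimes>\<^bsub>K\<^esub> unscal y"
    if "a \<in> carrier K" "y \<in> carrier (obj (com_mod K) n)" for a y n
    using that by (cases "n = 0") auto
  have "\<exists>\<theta>\<in>lin_maps K (D.objC s) (ground_mod K). \<forall>(x, ys)\<in>D.tensorsC s. \<theta> (D.pureC s x ys) =
      Scal (if True then D.coeff (\<lambda>J. unscal) ys (unscal x) else \<zero>\<^bsub>K\<^esub>)"
    by (rule D.coeff_lift[where Q = "\<lambda>_. True"]) (rule carr add smult, assumption+)+
  then obtain \<theta> where \<theta>: "\<theta> \<in> lin_maps K (D.objC s) (ground_mod K)"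
    "\<And>x ys. (x, ys) \<in> D.tensorsC s \<Longrightarrow> \<theta> (D.pureC s x ys) = Scal (D.coeff (\<lambda>J. unscal) ys (unscal x))"
    by auto
  have "\<exists>f\<in>lin_maps K (D.objC s) (obj (com_mod K) s). \<forall>(x, ys)\<in>D.tensorsC s.
      f (D.pureC s x ys) = Scal (D.coeff (\<lambda>J. unscal) ys (unscal x))"
  proof (cases "s = 0")
    case False
    then show ?thesis using \<theta> by (intro bexI[of _ \<theta>]) auto
  next
    \<comment> \<open>In arity 0 all index sets are empty, so every factor comes from arity 0 and
      vanishes; if there are no factors, the left entry vanishes instead.\<close>
    case True
    have "D.coeff (\<lambda>J. unscal) ys (unscal x) = \<zero>\<^bsub>K\<^esub>" if T: "(x, ys) \<in> D.tensorsC s" for x ys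
    proof (cases ys)
      case Nil
      then show ?thesis using D.scal_left(3)[OF T] by simp
    next
      case (Cons z zs)
      obtain J y where z: "z = (J, y)" by (cases z)
      then have "J = {}" using D.tensorsD(1)[OF T] Cons True by (simp add: decomp_iff)
      then have "y = Scal \<zero>\<^bsub>K\<^esub>" using D.tensorsD(3)[OF T, of J y] Cons z by simp
      then have y: "(J, y) \<in> set ys" "unscal y = \<zero>\<^bsub>K\<^esub>" using Cons z by simp_all
      show ?thesis
        by (rule D.coeff_eq_zero[where v = "\<lambda>J. unscal", OF y carr[OF D.tensorsD(3)[OF T]] carr[OF D.tensorsD(2)[OF T]]])
    qed
    then show ?thesis using True
      by (intro bexI[of _ "\<lambda>_. Scal \<zero>\<^bsub>K\<^esub>"]) (auto simp: lin_maps_def)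
  qed
  from D.comp_lift_spec(2)[OF this T] show ?thesis
    by (simp only: com_operad_def operad.simps D.coeff_def)
qed

context com_comp
begin

abbreviation "comX \<equiv> comp K (com_mod K) X"
abbreviation "comX_basis \<equiv> comp_basis K X e"

text \<open>The entries \<open>(J, p, qs)\<close> are those in the specification of
  \<open>mult_first\<close>: \<open>pure_inner\<close> forms its argument, \<open>flat\<close> the
  factors of its value, \<open>weight\<close> the scalar produced by the operad multiplication, and
  \<open>two_level\<close> collects its conditions on the list.\<close>

definition pure_inner :: "(nat set \<times> 'k elt \<times> (nat set \<times> 'k elt) list) list \<Rightarrow> (nat set \<times> 'k elt) list" where
  "pure_inner zs = map (\<lambda>(J, p, qs). (J, pureC (card J) p qs)) zs"

definition flat :: "(nat set \<times> 'k elt \<times> (nat set \<times> 'k elt) list) list \<Rightarrow> (nat set \<times> 'k elt) list" where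
  "flat zs = concat (map (\<lambda>(J, p, qs). map (\<lambda>(L, q). (emb J ` L, q)) qs) zs)"

definition weight :: "(nat set \<times> 'k elt \<times> (nat set \<times> 'k elt) list) list \<Rightarrow> 'k \<Rightarrow> 'k" where
  "weight zs b = foldr (\<lambda>(J, p, qs) b. unscal p \<otimes>\<^bsub>K\<^esub> b) zs b"

definition two_level :: "nat \<Rightarrow> (nat set \<times> 'k elt \<times> (nat set \<times> 'k elt) list) list \<Rightarrow> bool" where
  "two_level n zs \<longleftrightarrow> decomp n (map fst zs) \<and> (\<forall>(J, p, qs)\<in>set zs. (p, qs) \<in> tensorsC (card J))"

lemma pure_inner_simps [simp]:
  "pure_inner [] = []"
  "pure_inner ((J, p, qs) # zs) = (J, pureC (card J) p qs) # pure_inner zs"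
  "pure_inner (us @ vs) = pure_inner us @ pure_inner vs"
  by (simp_all add: pure_inner_def)

lemma flat_simps [simp]:
  "flat [] = []"
  "flat ((J, p, qs) # zs) = map (\<lambda>(L, q). (emb J ` L, q)) qs @ flat zs"
  "flat (us @ vs) = flat us @ flat vs"
  by (simp_all add: flat_def)

lemma weight_simps [simp]:
  "weight [] b = b" "weight ((J, p, qs) # zs) b = unscal p \<otimes>\<^bsub>K\<^esub> weight zs b"
  "weight (us @ vs) b = weight us (weight vs b)"
  by (simp_all add: weight_def)

lemma two_levelD:
  assumes "two_level n zs" "(J, p, qs) \<in> set zs"
  shows "(p, qs) \<in> tensorsC (card J)" and "finite J" and "unscal p \<in> carrier K"
proof -
  show T: "(p, qs) \<in> tensorsC (card J)" using assms by (auto simp: two_level_def)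
  have "J \<subseteq> {1..n}" using assms by (force simp: two_level_def decomp_iff)
  then show "finite J" by (rule finite_subset) simp
  show "unscal p \<in> carrier K" by (rule scal_left(1)[OF T])
qed

lemma weight_closed:
  "(\<And>J p qs. (J, p, qs) \<in> set zs \<Longrightarrow> unscal p \<in> carrier K) \<Longrightarrow> b \<in> carrier K \<Longrightarrow> weight zs b \<in> carrier K"
proof (induction zs)
  case (Cons z zs)
  obtain J p qs where z: "z = (J, p, qs)" by (cases z)
  have "weight zs b \<in> carrier K" by (rule Cons.IH) (use Cons.prems in auto)
  moreover have "unscal p \<in> carrier K" by (rule Cons.prems(1)[of J p qs]) (simp add: z)
  ultimately show ?case using z by simp
qed simp

lemma weight_smult:
  "(\<And>J p qs. (J, p, qs) \<in> set zs \<Longrightarrow> unscal p \<in> carrier K) \<Longrightarrow> a \<in> carrier K \<Longrightarrow> b \<in> carrier K \<Longrightarrow>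
    weight zs (a \<otimes>\<^bsub>K\<^esub> b) = a \<otimes>\<^bsub>K\<^esub> weight zs b"
proof (induction zs)
  case (Cons z zs)
  obtain J p qs where z: "z = (J, p, qs)" by (cases z)
  have "weight zs b \<in> carrier K" by (rule weight_closed) (use Cons.prems in auto)
  moreover have "weight zs (a \<otimes>\<^bsub>K\<^esub> b) = a \<otimes>\<^bsub>K\<^esub> weight zs b" by (rule Cons.IH) (use Cons.prems in auto)
  moreover have "unscal p \<in> carrier K" using Cons.prems(1) z by auto
  ultimately show ?case using z Cons.prems(2) by (simp add: K.m_lcomm)
qed simp

lemma weight_extract:
  assumes "\<And>J p qs. (J, p, qs) \<in> set us \<union> set vs \<Longrightarrow> unscal p \<in> carrier K" "unscal p \<in> carrier K" "b \<in> carrier K"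
  shows "weight (us @ (J, p, qs) # vs) b = unscal p \<otimes>\<^bsub>K\<^esub> weight (us @ vs) b"
  using assms by (auto intro!: weight_smult weight_closed)

lemma weight_one: "(\<And>J p qs. (J, p, qs) \<in> set zs \<Longrightarrow> p = Scal \<one>\<^bsub>K\<^esub>) \<Longrightarrow> weight zs \<one>\<^bsub>K\<^esub> = \<one>\<^bsub>K\<^esub>"
proof (induction zs)
  case (Cons z zs)
  obtain J p qs where z: "z = (J, p, qs)" by (cases z)
  have "weight zs \<one>\<^bsub>K\<^esub> = \<one>\<^bsub>K\<^esub>" by (rule Cons.IH) (use Cons.prems in auto)
  moreover have "p = Scal \<one>\<^bsub>K\<^esub>" by (rule Cons.prems[of J p qs]) (simp add: z)
  ultimately show ?case using z by simp
qed simp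

lemma com_comp_comX: "com_comp K comX (Suc d) comX_basis"
  by (rule com_comp_Suc)

lemma pure_inner_tensor:
  assumes zs: "two_level n zs" and x: "x \<in> carrier (obj (com_mod K) (length zs))"
  shows "(x, pure_inner zs) \<in> tensors (com_mod K) comX n"
proof -
  have "map fst (pure_inner zs) = map fst zs" by (auto simp: pure_inner_def)
  then have "decomp n (map fst (pure_inner zs))" using zs by (simp add: two_level_def)
  moreover have "y \<in> carrier (obj comX (card J))" if "(J, y) \<in> set (pure_inner zs)" for J y
    using that two_levelD(1)[OF zs] pure_closed by (fastforce simp: pure_inner_def)
  moreover have "length (pure_inner zs) = length zs" by (simp add: pure_inner_def)
  ultimately show ?thesis
    using x unfolding tensors_def mem_Collect_eq case_prod_conv by auto
qed

text \<open>Within one \<open>J\<close>, the enumeration transports a decomposition of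
  \<open>{1..card J}\<close> to one of \<open>J\<close>; pieces from different entries are disjoint
  because their \<open>J\<close> are.\<close>

lemma flat_disjoint:
  assumes "sorted_wrt disjnt (map fst zs)"
    and "\<And>J p qs. (J, p, qs) \<in> set zs \<Longrightarrow> decomp (card J) (map fst qs) \<and> finite J"
  shows "sorted_wrt disjnt (map fst (flat zs)) \<and> \<Union>(set (map fst (flat zs))) = \<Union>(set (map fst zs))"
  using assms
proof (induction zs)
  case (Cons z zs)
  obtain J p qs where z: "z = (J, p, qs)" by (cases z)
  have qs: "decomp (card J) (map fst qs)" "finite J" using Cons.prems(2)[of J p qs] z by auto
  let ?Q = "map (\<lambda>(L, q). (emb J ` L, q)) qs"
  have fst: "map fst ?Q = map ((`) (emb J)) (map fst qs)" by auto
  have "\<Union>(set (map fst ?Q)) = emb J ` \<Union>(set (map fst qs))" unfolding fst by auto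
  also have "\<dots> = emb J ` {1..card J}" using qs(1) by (simp only: decomp_iff)
  also have "\<dots> = J" by (rule emb_image[OF qs(2)])
  finally have U: "\<Union>(set (map fst ?Q)) = J" .
  have sub: "L \<subseteq> {1..card J}" if "L \<in> set (map fst qs)" for L using qs(1) that unfolding decomp_iff by blast
  have S: "sorted_wrt disjnt (map fst ?Q)"
    unfolding fst sorted_wrt_map[of _ "(`) (emb J)"]
  proof (rule sorted_wrt_mono_rel)
    show "sorted_wrt disjnt (map fst qs)" using qs(1) by (simp only: decomp_sorted_wrt)
    show "disjnt (emb J ` L) (emb J ` L')" if "L \<in> set (map fst qs)" "L' \<in> set (map fst qs)" "disjnt L L'" for L L'
      using inj_on_image_Int[OF bij_betw_imp_inj_on[OF bij_emb[OF qs(2)]] sub[OF that(1)] sub[OF that(2)]] that(3)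
      by (simp add: disjnt_def)
  qed
  have IH: "sorted_wrt disjnt (map fst (flat zs))" "\<Union>(set (map fst (flat zs))) = \<Union>(set (map fst zs))"
    using Cons.IH Cons.prems z by auto
  have "disjnt L L'" if L: "L \<in> set (map fst ?Q)" "L' \<in> set (map fst (flat zs))" for L L'
  proof -
    have "L \<subseteq> J" using U L(1) by blast
    moreover have "L' \<subseteq> \<Union>(set (map fst zs))" using IH(2) L(2) by blast
    moreover have "disjnt J (\<Union>(set (map fst zs)))" using Cons.prems(1) z by (auto simp: disjnt_iff)
    ultimately show ?thesis unfolding disjnt_def by blast
  qed
  then have "sorted_wrt disjnt (map fst (flat (z # zs)))" using S IH(1) z by (simp add: sorted_wrt_append)
  moreover have "\<Union>(set (map fst (flat (z # zs)))) = \<Union>(set (map fst ?Q)) \<union> \<Union>(set (map fst (flat zs)))"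
    using z by simp
  ultimately show ?case unfolding U IH(2) using z by simp
qed simp

lemma flat_decomp:
  assumes "two_level n zs" shows "decomp n (map fst (flat zs))"
proof -
  have "sorted_wrt disjnt (map fst zs)" "\<Union>(set (map fst zs)) = {1..n}"
    using assms unfolding two_level_def decomp_sorted_wrt[of n] by blast+
  moreover have "decomp (card J) (map fst qs) \<and> finite J" if "(J, p, qs) \<in> set zs" for J p qs
    using two_levelD(2)[OF assms that] tensorsD(1)[OF two_levelD(1)[OF assms that]] by simp
  ultimately show ?thesis
    using flat_disjoint[of zs] unfolding decomp_sorted_wrt[of n] by simp
qed

lemma flat_tensor:
  assumes zs: "two_level n zs" and x: "x \<in> carrier (obj (com_mod K) (length zs))"
  shows "(Scal (weight zs (unscal x)), flat zs) \<in> tensorsC n"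
proof -
  have q: "q \<in> carrier (obj X (card L))" if Lq: "(L, q) \<in> set (flat zs)" for L q
  proof -
    obtain J p qs L' where L': "(J, p, qs) \<in> set zs" "(L', q) \<in> set qs" "L = emb J ` L'"
      using Lq by (auto simp: flat_def)
    note T = two_levelD[OF zs L'(1)]
    have "L' \<subseteq> {1..card J}" using tensorsD(1)[OF T(1)] L'(2) by (force simp: decomp_iff)
    then show ?thesis using tensorsD(3)[OF T(1) L'(2)] card_emb_image[OF T(2)] L'(3) by simp
  qed
  have ux: "unscal x \<in> carrier K" using x by (auto split: if_splits)
  have cl: "weight us (unscal x) \<in> carrier K" if "set us \<subseteq> set zs" for us
    by (rule weight_closed) (use two_levelD(3)[OF zs] ux that in blast)+
  \<comment> \<open>If no factors remain, the scalar has to vanish: either \<open>x\<close> itself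
    lies in arity 0, or the first \<open>p\<close> does.\<close>
  have "weight zs (unscal x) = \<zero>\<^bsub>K\<^esub>" if "flat zs = []"
  proof (cases zs)
    case Nil
    then show ?thesis using x by simp
  next
    case (Cons z us)
    obtain J p qs where z: "z = (J, p, qs)" by (cases z)
    have "qs = []" using that Cons z by simp
    then have "p = Scal \<zero>\<^bsub>K\<^esub>" using scal_left(3)[OF two_levelD(1)[OF zs, of J p qs]] Cons z by simp
    moreover have "weight us (unscal x) \<in> carrier K" using cl[of us] Cons by auto
    ultimately show ?thesis using Cons z by simp
  qed
  then have "Scal (weight zs (unscal x)) \<in> carrier (obj (com_mod K) (length (flat zs)))"
    using cl[of zs] by auto
  then show ?thesis using flat_decomp[OF zs] q by (auto simp: tensors_def)
qed

text \<open>The interval assigned to \<open>p\<close> has as many elements as \<open>qs\<close>, so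
  \<open>p\<close> has the arity demanded there and the product formula applies.\<close>

lemma op_mult_inner:
  assumes zs: "two_level n zs" and x: "x \<in> carrier (obj (com_mod K) (length zs))"
  defines "ms \<equiv> map (\<lambda>(J, p, qs). length qs) zs"
  shows "op_mult (com_operad K) (sum_list ms) (pure K (com_mod K) (com_mod K) (sum_list ms) x
    (zip (intervals 0 ms) (map (\<lambda>(J, p, qs). p) zs))) = Scal (weight zs (unscal x))"
proof -
  let ?ys = "zip (intervals 0 ms) (map (\<lambda>(J, p, qs). p) zs)"
  have len: "length ms = length zs" by (simp add: ms_def)
  have "map fst ?ys = intervals 0 ms" by (simp add: len)
  then have "decomp (sum_list ms) (map fst ?ys)" by (simp add: decomp_intervals)
  moreover have "y \<in> carrier (obj (com_mod K) (card J))" if Jy: "(J, y) \<in> set ?ys" for J y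
  proof -
    obtain i where i: "i < length zs" "J = intervals 0 ms ! i" "y = map (\<lambda>(J, p, qs). p) zs ! i"
      using Jy by (auto simp: set_zip len)
    obtain J' p qs where z: "zs ! i = (J', p, qs)" by (cases "zs ! i")
    then have "(J', p, qs) \<in> set zs" using i(1) by (metis nth_mem)
    then have "p \<in> carrier (obj (com_mod K) (length qs))" by (rule tensorsD(2)[OF two_levelD(1)[OF zs]])
    moreover have "card J = length qs" using i z card_intervals[of i ms 0] len by (simp add: ms_def)
    moreover have "y = p" using i z by simp
    ultimately show ?thesis by simp
  qed
  moreover have "length ?ys = length zs" by (simp add: len)
  ultimately have "(x, ?ys) \<in> tensors (com_mod K) (com_mod K) (sum_list ms)"
    using x unfolding tensors_def mem_Collect_eq case_prod_conv by auto
  moreover have "foldr (\<lambda>(J, y) b. unscal y \<otimes>\<^bsub>K\<^esub> b) (zip Is (map (\<lambda>(J, p, qs). p) zs)) b = weight zs b"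
    if "length Is = length zs" for Is :: "nat set list" and zs b
    using that by (induction Is zs rule: list_induct2) auto
  ultimately show ?thesis using op_mult_pure[OF cring] len by simp
qed

text \<open>The chain is glued from chosen chains on the blocks, not recovered from the tensor: over the zero
  ring \<open>e\<close> is not injective, so the tensor does not determine its chain.\<close>

lemma flat_chain:
  assumes zs: "two_level n zs" and ne: "zs \<noteq> []"
    and G: "\<And>J p qs. (J, p, qs) \<in> set zs \<Longrightarrow> p = Scal \<one>\<^bsub>K\<^esub> \<and> qs \<noteq> [] \<and>
      (\<forall>(L, q)\<in>set qs. \<exists>b\<in>partition_chains (card L) d. q = e (card L) b)"
  shows "\<exists>c\<in>partition_chains n (Suc (Suc d)).
    pure K (com_mod K) comX n (Scal \<one>\<^bsub>K\<^esub>) (pure_inner zs) = comp_basis K comX comX_basis n c \<and>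
    pureC n (Scal \<one>\<^bsub>K\<^esub>) (flat zs) = comX_basis n (chain_del 1 c)"
proof -
  interpret C: com_comp K comX "Suc d" comX_basis by (rule com_comp_comX)
  define good where "good qs b \<longleftrightarrow> distinct (map fst qs) \<and> fst ` set qs = b ! 1 \<and>
    (\<forall>(L, q)\<in>set qs. q = e (card L) (restr L b))" for qs and b :: "nat set set list"
  have ex: "\<exists>b\<in>partition_chains (card J) (Suc d). good qs b" if "(J, p, qs) \<in> set zs" for J p qs
    unfolding good_def
  proof (rule tensor_chain[OF two_levelD(1)[OF zs that]])
    show "qs \<noteq> []" using G[OF that] by blast
    show "\<exists>b\<in>partition_chains (card L) d. q = e (card L) b" if "(L, q) \<in> set qs" for L q
      using G[OF \<open>(J, p, qs) \<in> set zs\<close>] that by blast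
  qed
  define g where "g J = (SOME b. b \<in> partition_chains (card J) (Suc d) \<and> (\<exists>p qs. (J, p, qs) \<in> set zs \<and> good qs b))"
    for J
  have fst: "fst ` set (pure_inner zs) = fst ` set zs" "map fst (pure_inner zs) = map fst zs"
    by (auto simp: pure_inner_def image_image split_def)
  have g: "g J \<in> partition_chains (card J) (Suc d) \<and> (\<exists>p qs. (J, p, qs) \<in> set zs \<and> good qs (g J))"
    if J: "J \<in> fst ` set zs" for J
    unfolding g_def
  proof (rule someI_ex)
    obtain p qs where m: "(J, p, qs) \<in> set zs" using J by force
    then show "\<exists>b. b \<in> partition_chains (card J) (Suc d) \<and> (\<exists>p qs. (J, p, qs) \<in> set zs \<and> good qs b)"
      using ex[OF m] by blast
  qed
  have x: "Scal \<one>\<^bsub>K\<^esub> \<in> carrier (obj (com_mod K) (length zs))" using ne by simp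
  have T: "(Scal \<one>\<^bsub>K\<^esub>, pure_inner zs) \<in> C.tensorsC n" by (rule pure_inner_tensor[OF zs x])
  have "\<exists>c\<in>partition_chains n (Suc (Suc d)). distinct (map fst (pure_inner zs)) \<and>
      fst ` set (pure_inner zs) = c ! 1 \<and> (\<forall>J\<in>fst ` set (pure_inner zs). restr J c = g J)"
    by (rule C.tensor_chain_glue[OF T]) (use ne g fst in \<open>auto simp: pure_inner_def\<close>)
  then obtain c where c: "c \<in> partition_chains n (Suc (Suc d))" "distinct (map fst zs)" "fst ` set zs = c ! 1"
    "\<And>J. J \<in> fst ` set zs \<Longrightarrow> restr J c = g J"
    unfolding fst by (elim bexE conjE) simp
  note D = partition_chainsD[OF c(1)]
  have good: "good qs (restr J c)" and mem: "J \<in> c ! 1" if m: "(J, p, qs) \<in> set zs" for J p qs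
  proof -
    have J: "J \<in> fst ` set zs" using m by force
    then show "J \<in> c ! 1" using c(3) by simp
    obtain p' qs' where m': "(J, p', qs') \<in> set zs" "good qs' (g J)" using g[OF J] by blast
    have "(p', qs') = (p, qs)" by (rule eq_key_imp_eq_value[OF c(2) m'(1) m])
    then show "good qs (restr J c)" using m'(2) c(4)[OF J] by simp
  qed
  have "C.pureC n (Scal \<one>\<^bsub>K\<^esub>) (pure_inner zs) = comp_basis K comX comX_basis n c"
  proof (rule C.chain_tensor(2)[OF c(1)])
    show "distinct (map fst (pure_inner zs))" using c(2) fst(2) by simp
    show "fst ` set (pure_inner zs) = c ! 1" using c(3) fst(1) by simp
    show "y = comX_basis (card J) (restr J c)" if "(J, y) \<in> set (pure_inner zs)" for J y
    proof -
      obtain p qs where m: "(J, p, qs) \<in> set zs" "y = pureC (card J) p qs"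
        using \<open>(J, y) \<in> set (pure_inner zs)\<close> by (auto simp: pure_inner_def)
      have "pureC (card J) (Scal \<one>\<^bsub>K\<^esub>) qs = comX_basis (card J) (restr J c)"
        by (rule chain_tensor(2)[OF restr_chain[OF c(1) mem[OF m(1)]]])
          (use good[OF m(1)] in \<open>auto simp: good_def\<close>)
      then show ?thesis using m G[OF m(1)] by simp
    qed
  qed
  moreover have "pureC n (Scal \<one>\<^bsub>K\<^esub>) (flat zs) = comX_basis n (chain_del 1 c)"
  proof (rule chain_tensor(2))
    show "chain_del 1 c \<in> partition_chains n (Suc d)" by (rule chain_del_inner[OF c(1)]) auto
    \<comment> \<open>Once the second partition is deleted, the flattened index sets have to be the
      blocks of the third.\<close>
    have nth: "chain_del 1 c ! 1 = c ! 2" using D(1) by (simp add: chain_del_nth numeral_2_eq_2)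
    have fl: "\<exists>J p qs L'. (J, p, qs) \<in> set zs \<and> (L', q) \<in> set qs \<and> L = emb J ` L'"
      if "(L, q) \<in> set (flat zs)" for L q
      using that by (auto simp: flat_def)
    have fl': "(emb J ` L', q) \<in> set (flat zs)" if m: "(J, p, qs) \<in> set zs" "(L', q) \<in> set qs" for J p qs L' q
    proof -
      obtain us vs where "zs = us @ (J, p, qs) # vs" using split_list[OF m(1)] by blast
      moreover have "(emb J ` L', q) \<in> (\<lambda>(L, q). (emb J ` L, q)) ` set qs"
        by (rule image_eqI[OF _ m(2)]) simp
      ultimately show ?thesis by simp
    qed
    have r2: "restr J c ! 1 = restr_part J (c ! 2)" for J
      using D(1) by (simp add: restr_def nth_tl numeral_2_eq_2)
    have sub: "L' \<subseteq> {1..card J} \<and> finite J" if "(J, p, qs) \<in> set zs" "(L', q) \<in> set qs" for J p qs L' q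
    proof -
      have "L' \<in> set (map fst qs)" using that(2) by force
      then show ?thesis
        using tensorsD(1)[OF two_levelD(1)[OF zs that(1)]] two_levelD(2)[OF zs that(1)] unfolding decomp_iff by blast
    qed
    \<comment> \<open>An empty index set would carry a chain on the empty set, and there is none;
      hence the flattened members are distinct.\<close>
    have "{} \<notin> set (map fst (flat zs))"
    proof
      assume "{} \<in> set (map fst (flat zs))"
      then obtain q where "({}, q) \<in> set (flat zs)" by force
      from fl[OF this] obtain J p qs L' where m: "(J, p, qs) \<in> set zs" "(L', q) \<in> set qs" "{} = emb J ` L'"
        by blast
      then have "L' = {}" by simp
      moreover have "\<exists>b\<in>partition_chains (card L') d. q = e (card L') b" using G[OF m(1)] m(2) by auto
      ultimately show False using partition_chains_empty[of d] by simp
    qed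
    then show "distinct (map fst (flat zs))" by (rule distinct_blocks[OF flat_decomp[OF zs]])
    show "fst ` set (flat zs) = chain_del 1 c ! 1"
    proof -
      have "fst ` set (flat zs) = (\<Union>J\<in>c ! 1. (`) (emb J) ` restr_part J (c ! 2))"
      proof (intro equalityI subsetI)
        fix L assume "L \<in> fst ` set (flat zs)"
        then obtain q where "(L, q) \<in> set (flat zs)" by force
        from fl[OF this] obtain J p qs L' where m: "(J, p, qs) \<in> set zs" "(L', q) \<in> set qs" "L = emb J ` L'"
          by blast
        have "L' \<in> fst ` set qs" using m(2) by force
        then have "L' \<in> restr_part J (c ! 2)" using good[OF m(1)] r2[of J] unfolding good_def by simp
        then show "L \<in> (\<Union>J\<in>c ! 1. (`) (emb J) ` restr_part J (c ! 2))" using mem[OF m(1)] m(3) by blast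
      next
        fix L assume "L \<in> (\<Union>J\<in>c ! 1. (`) (emb J) ` restr_part J (c ! 2))"
        then obtain J L' where L: "J \<in> c ! 1" "L' \<in> restr_part J (c ! 2)" "L = emb J ` L'" by blast
        then have "J \<in> fst ` set zs" using c(3) by simp
        then obtain p qs where m: "(J, p, qs) \<in> set zs" by force
        have "L' \<in> fst ` set qs" using good[OF m] L(2) r2[of J] unfolding good_def by simp
        then obtain q where "(L', q) \<in> set qs" by force
        then have "(L, q) \<in> set (flat zs)" using fl'[OF m] L(3) by simp
        then show "L \<in> fst ` set (flat zs)" by force
      qed
      also have "\<dots> = c ! 2"
      proof (rule restr_part_glue[symmetric])
        show "finite J" if "J \<in> c ! 1" for J
          by (rule partition_on_block_finite[OF D(6) that]) simp
        have "refines {1..n} (c ! 2) (c ! 1)" by (rule partition_chains_refines[OF c(1)]) auto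
        then show "\<exists>J\<in>c ! 1. B \<subseteq> J" if "B \<in> c ! 2" for B using that unfolding refines_def by blast
      qed
      finally show ?thesis unfolding nth .
    qed
    show "q = e (card L) (restr L (chain_del 1 c))" if Lq: "(L, q) \<in> set (flat zs)" for L q
    proof -
      obtain J p qs L' where m: "(J, p, qs) \<in> set zs" "(L', q) \<in> set qs" "L = emb J ` L'"
        using fl[OF Lq] by blast
      note s = sub[OF m(1,2)]
      \<comment> \<open>Two successive restrictions skip the first two partitions; deleting the
        second and restricting once skips the same two.\<close>
      have "tl (chain_del 1 c) = tl (tl c)"
        using D(1) by (cases c) (auto simp: chain_del_def drop_Suc)
      then have "restr L (chain_del 1 c) = restr L' (restr J c)"
        using restr_part_emb[of J L'] s by (simp add: restr_def m(3) map_tl[symmetric])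
      moreover have "card L = card L'" using card_emb_image[of J L'] s m(3) by simp
      moreover have "q = e (card L') (restr L' (restr J c))"
        using good[OF m(1)] m(2) by (auto simp: good_def)
      ultimately show ?thesis by simp
    qed
  qed
  ultimately show ?thesis using c(1) by blast
qed

end

context com_comp
begin

text \<open>For \<open>F\<close> given on the basis, both sides are multilinear in the elements \<open>p\<close> and \<open>q\<close> occurring in
  \<open>zs\<close>, so these may be replaced one by one by basis elements.\<close>

lemma mult_lift_flat:
  assumes F: "F \<in> lin_maps K (comp_obj K (com_mod K) comX n) (objC n)"
    and F_basis: "\<And>c. c \<in> partition_chains n (Suc (Suc d)) \<Longrightarrow>
      F (comp_basis K comX comX_basis n c) = comX_basis n (chain_del 1 c)"
  shows "two_level n zs \<and> zs \<noteq> [] \<longrightarrow> F (pure K (com_mod K) comX n (Scal \<one>\<^bsub>K\<^esub>) (pure_inner zs)) =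
    pureC n (Scal (weight zs \<one>\<^bsub>K\<^esub>)) (flat zs)"
proof (rule list_replace_induct[where P = "\<lambda>zs. two_level n zs \<and> zs \<noteq> [] \<longrightarrow>
    F (pure K (com_mod K) comX n (Scal \<one>\<^bsub>K\<^esub>) (pure_inner zs)) = pureC n (Scal (weight zs \<one>\<^bsub>K\<^esub>)) (flat zs)"
    and G = "{(J, p, qs). p = Scal \<one>\<^bsub>K\<^esub> \<and> qs \<noteq> [] \<and>
      (\<forall>(L, q)\<in>set qs. \<exists>b\<in>partition_chains (card L) d. q = e (card L) b)}"])
  interpret C: com_comp K comX "Suc d" comX_basis by (rule com_comp_comX)
  have F0: "F \<zero>\<^bsub>C.objC n\<^esub> = \<zero>\<^bsub>objC n\<^esub>" by (rule lin_maps_zero[OF C.comp_obj_module comp_obj_module F])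
  let ?G = "{(J, p, qs). p = Scal \<one>\<^bsub>K\<^esub> \<and> qs \<noteq> [] \<and>
      (\<forall>(L, q)\<in>set qs. \<exists>b\<in>partition_chains (card L) d. q = e (card L) b)}"
  {
    fix us vs :: "(nat set \<times> 'k elt \<times> (nat set \<times> 'k elt) list) list"
      and z :: "nat set \<times> 'k elt \<times> (nat set \<times> 'k elt) list"
    assume IH: "\<And>z'. z' \<in> ?G \<Longrightarrow> two_level n (us @ z' # vs) \<and> us @ z' # vs \<noteq> [] \<longrightarrow>
      F (C.pureC n (Scal \<one>\<^bsub>K\<^esub>) (pure_inner (us @ z' # vs))) =
      pureC n (Scal (weight (us @ z' # vs) \<one>\<^bsub>K\<^esub>)) (flat (us @ z' # vs))"
    obtain J p qs where z: "z = (J, p, qs)" by (cases z)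
    show "two_level n (us @ z # vs) \<and> us @ z # vs \<noteq> [] \<longrightarrow>
      F (C.pureC n (Scal \<one>\<^bsub>K\<^esub>) (pure_inner (us @ z # vs))) =
      pureC n (Scal (weight (us @ z # vs) \<one>\<^bsub>K\<^esub>)) (flat (us @ z # vs))"
    proof
      assume "two_level n (us @ z # vs) \<and> us @ z # vs \<noteq> []"
      then have V: "two_level n (us @ (J, p, qs) # vs)" by (simp add: z)
      have T: "(p, qs) \<in> tensorsC (card J)" and finJ: "finite J"
        using two_levelD(1,2)[OF V, of J p qs] by auto
      have V': "two_level n (us @ (J, p', qs') # vs)" if "(p', qs') \<in> tensorsC (card J)" for p' qs'
        using V that by (auto simp: two_level_def)
      have wt: "weight (us @ (J, p', qs') # vs) \<one>\<^bsub>K\<^esub> = unscal p' \<otimes>\<^bsub>K\<^esub> weight (us @ vs) \<one>\<^bsub>K\<^esub>"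
        and w_closed: "weight (us @ vs) \<one>\<^bsub>K\<^esub> \<in> carrier K"
        if "(p', qs') \<in> tensorsC (card J)" for p' qs'
      proof -
        have u: "unscal p'' \<in> carrier K" if "(J'', p'', qs'') \<in> set us \<union> set vs" for J'' p'' qs''
          by (rule two_levelD(3)[OF V, of J'' p'' qs'']) (use that in auto)
        show "weight (us @ (J, p', qs') # vs) \<one>\<^bsub>K\<^esub> = unscal p' \<otimes>\<^bsub>K\<^esub> weight (us @ vs) \<one>\<^bsub>K\<^esub>"
          by (rule weight_extract[OF u scal_left(1)[OF that]]) auto
        show "weight (us @ vs) \<one>\<^bsub>K\<^esub> \<in> carrier K"
          by (rule weight_closed) (use u in auto)
      qed
      define w where "w = weight (us @ vs) \<one>\<^bsub>K\<^esub>"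
      \<comment> \<open>Only the entry at \<open>J\<close> varies: \<open>H\<close> marks its place
        in the argument, \<open>fl\<close> its place in the value.\<close>
      define H where "H y = pure_inner us @ (J, y) # pure_inner vs" for y
      define fl where "fl qs = flat us @ map (\<lambda>(L, q). (emb J ` L, q)) qs @ flat vs" for qs
      have w: "w \<in> carrier K" using w_closed[OF T] by (simp add: w_def)
      have HT: "(Scal \<one>\<^bsub>K\<^esub>, H (pureC (card J) p' qs')) \<in> C.tensorsC n"
        if "(p', qs') \<in> tensorsC (card J)" for p' qs'
        using pure_inner_tensor[OF V'[OF that], of "Scal \<one>\<^bsub>K\<^esub>"] by (simp add: H_def)
      have FT: "(Scal (unscal p' \<otimes>\<^bsub>K\<^esub> w), fl qs') \<in> tensorsC n" if "(p', qs') \<in> tensorsC (card J)" for p' qs'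
        using flat_tensor[OF V'[OF that], of "Scal \<one>\<^bsub>K\<^esub>"] wt[OF that] by (simp add: fl_def w_def)
      have HT0: "C.pureC n (Scal \<one>\<^bsub>K\<^esub>) (H \<zero>\<^bsub>objC (card J)\<^esub>) = \<zero>\<^bsub>C.objC n\<^esub>"
        using C.pure_right_zero[OF HT[OF T, unfolded H_def]] by (simp add: H_def)
      have "F (C.pureC n (Scal \<one>\<^bsub>K\<^esub>) (H (pureC (card J) p qs))) = pureC n (Scal (unscal p \<otimes>\<^bsub>K\<^esub> w)) (fl qs)"
      proof (cases "qs = []")
        \<comment> \<open>Without inner factors \<open>p\<close> lies in arity 0, so both sides
          vanish.\<close>
        case True
        then have "p = Scal \<zero>\<^bsub>K\<^esub>" using scal_left(3)[OF T] by simp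
        then show ?thesis
          using HT0 F0 pure_scal_zero[OF T] pure_scal_zero[OF FT[OF T]] w by simp
      next
        case False
        have T1: "(Scal \<one>\<^bsub>K\<^esub>, qs) \<in> tensorsC (card J)" by (rule tensors_one[OF T False]) simp
        have FT1: "(Scal w, fl qs') \<in> tensorsC n" if "(Scal \<one>\<^bsub>K\<^esub>, qs') \<in> tensorsC (card J)" for qs'
          using FT[OF that] w by simp
        \<comment> \<open>Transport along \<open>emb J\<close> preserves cardinality, so
          \<open>q\<close> belongs to the same module before and after flattening and linearity in
          \<open>q\<close> can be compared on both sides.\<close>
        have card: "card (emb J ` L) = card L"
          if "(Scal \<one>\<^bsub>K\<^esub>, as @ (L, q) # bs) \<in> tensorsC (card J)" for as L q bs
        proof (rule card_emb_image[OF finJ])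
          show "L \<subseteq> {1..card J}" using tensorsD(1)[OF that] by (auto simp: decomp_iff)
        qed
        have fl: "fl (as @ (L, q) # bs) = (flat us @ map (\<lambda>(L, q). (emb J ` L, q)) as) @
            (emb J ` L, q) # map (\<lambda>(L, q). (emb J ` L, q)) bs @ flat vs" for as L q bs
          by (simp add: fl_def)
        let ?h = "\<lambda>qs. C.pureC n (Scal \<one>\<^bsub>K\<^esub>) (H (pureC (card J) (Scal \<one>\<^bsub>K\<^esub>) qs))"
        let ?l = "\<lambda>qs. F (?h qs)" and ?r = "\<lambda>qs. pureC n (Scal w) (fl qs)"
        have "qs \<noteq> [] \<longrightarrow> ?l qs = ?r qs"
        proof (rule tensors_basis_induct[OF basis T1, where P = "\<lambda>qs. qs \<noteq> [] \<longrightarrow>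
            ?l qs = ?r qs"])
          fix as L q bs assume A: "(Scal \<one>\<^bsub>K\<^esub>, as @ (L, q) # bs) \<in> tensorsC (card J)"
          have "?r ((as @ (L, \<zero>\<^bsub>obj X (card L)\<^esub>) # bs)) = \<zero>\<^bsub>objC n\<^esub>"
            using pure_right_zero[OF FT1[OF A, unfolded fl]] card[OF A] by (simp add: fl)
          then show "as @ (L, \<zero>\<^bsub>obj X (card L)\<^esub>) # bs \<noteq> [] \<longrightarrow>
            ?l (as @ (L, \<zero>\<^bsub>obj X (card L)\<^esub>) # bs) =
            ?r ((as @ (L, \<zero>\<^bsub>obj X (card L)\<^esub>) # bs))"
            using pure_right_zero[OF A] HT0 F0 by simp
        next
          fix as L q q' bs
          assume A: "(Scal \<one>\<^bsub>K\<^esub>, as @ (L, q) # bs) \<in> tensorsC (card J)"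
            "(Scal \<one>\<^bsub>K\<^esub>, as @ (L, q') # bs) \<in> tensorsC (card J)"
            and E: "as @ (L, q) # bs \<noteq> [] \<longrightarrow> ?l (as @ (L, q) # bs) = ?r (as @ (L, q) # bs)"
            "as @ (L, q') # bs \<noteq> [] \<longrightarrow> ?l (as @ (L, q') # bs) = ?r (as @ (L, q') # bs)"
          have "?r ((as @ (L, q \<oplus>\<^bsub>obj X (card L)\<^esub> q') # bs)) = ?r (as @ (L, q) # bs) \<oplus>\<^bsub>objC n\<^esub> ?r (as @ (L, q') # bs)"
            using pure_right_add[OF FT1[OF A(1), unfolded fl] FT1[OF A(2), unfolded fl]] card[OF A(1)]
            by (simp only: fl)
          moreover have "?h (as @ (L, q \<oplus>\<^bsub>obj X (card L)\<^esub> q') # bs) =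
              ?h (as @ (L, q) # bs) \<oplus>\<^bsub>C.objC n\<^esub>
              ?h (as @ (L, q') # bs)"
            unfolding pure_right_add[OF A]
            using C.pure_right_add[OF HT[OF A(1), unfolded H_def] HT[OF A(2), unfolded H_def]]
            by (simp add: H_def)
          ultimately show "as @ (L, q \<oplus>\<^bsub>obj X (card L)\<^esub> q') # bs \<noteq> [] \<longrightarrow>
            ?l (as @ (L, q \<oplus>\<^bsub>obj X (card L)\<^esub> q') # bs) =
            ?r ((as @ (L, q \<oplus>\<^bsub>obj X (card L)\<^esub> q') # bs))"
            using lin_mapsD(2)[OF F C.pure_closed[OF HT[OF A(1)]] C.pure_closed[OF HT[OF A(2)]]] E by simp
        next
          fix as L a q bs
          assume a: "a \<in> carrier K" and A: "(Scal \<one>\<^bsub>K\<^esub>, as @ (L, q) # bs) \<in> tensorsC (card J)"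
            and E: "as @ (L, q) # bs \<noteq> [] \<longrightarrow> ?l (as @ (L, q) # bs) = ?r (as @ (L, q) # bs)"
          have "?r ((as @ (L, a \<odot>\<^bsub>obj X (card L)\<^esub> q) # bs)) =
              a \<odot>\<^bsub>objC n\<^esub> ?r (as @ (L, q) # bs)"
            using pure_right_smult[OF a FT1[OF A, unfolded fl]] card[OF A] by (simp only: fl)
          moreover have "?h (as @ (L, a \<odot>\<^bsub>obj X (card L)\<^esub> q) # bs) =
              a \<odot>\<^bsub>C.objC n\<^esub> ?h (as @ (L, q) # bs)"
            unfolding pure_right_smult[OF a A]
            using C.pure_right_smult[OF a HT[OF A, unfolded H_def]] by (simp add: H_def)
          ultimately show "as @ (L, a \<odot>\<^bsub>obj X (card L)\<^esub> q) # bs \<noteq> [] \<longrightarrow>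
            ?l (as @ (L, a \<odot>\<^bsub>obj X (card L)\<^esub> q) # bs) =
            ?r ((as @ (L, a \<odot>\<^bsub>obj X (card L)\<^esub> q) # bs))"
            using lin_mapsD(3)[OF F a C.pure_closed[OF HT[OF A]]] E by simp
        next
          fix qs' assume A: "(Scal \<one>\<^bsub>K\<^esub>, qs') \<in> tensorsC (card J)"
            and b: "\<And>L q. (L, q) \<in> set qs' \<Longrightarrow> \<exists>b\<in>partition_chains (card L) d. q = e (card L) b"
          show "qs' \<noteq> [] \<longrightarrow> ?l qs' = ?r qs'"
          proof
            assume "qs' \<noteq> []"
            then have "(J, Scal \<one>\<^bsub>K\<^esub>, qs') \<in> ?G" using b by auto
            from IH[OF this] show "?l qs' = ?r qs'"
              using V'[OF A] wt[OF A] w by (simp add: H_def fl_def w_def)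
          qed
        qed
        then have E: "?l qs = ?r qs"
          using False by blast
        have p: "unscal p \<in> carrier K" by (rule scal_left(1)[OF T])
        \<comment> \<open>The scalar of \<open>p\<close> leaves first the inner tensor and then the
          outer one, which reduces to the left entry one.\<close>
        have "C.pureC n (Scal \<one>\<^bsub>K\<^esub>) (H (pureC (card J) p qs)) =
            unscal p \<odot>\<^bsub>C.objC n\<^esub> C.pureC n (Scal \<one>\<^bsub>K\<^esub>) (H (pureC (card J) (Scal \<one>\<^bsub>K\<^esub>) qs))"
          unfolding pure_scal_one[OF T False]
          using C.pure_right_smult[OF p HT[OF T1, unfolded H_def]] by (simp add: H_def)
        then have "F (C.pureC n (Scal \<one>\<^bsub>K\<^esub>) (H (pureC (card J) p qs))) = unscal p \<odot>\<^bsub>objC n\<^esub> pureC n (Scal w) (fl qs)"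
          using lin_mapsD(3)[OF F p C.pure_closed[OF HT[OF T1]]] E by simp
        then show ?thesis using pure_scal[OF FT1[OF T1] p] by simp
      qed
      then show "F (C.pureC n (Scal \<one>\<^bsub>K\<^esub>) (pure_inner (us @ z # vs))) =
          pureC n (Scal (weight (us @ z # vs) \<one>\<^bsub>K\<^esub>)) (flat (us @ z # vs))"
        unfolding z wt[OF T] by (simp add: H_def fl_def w_def)
    qed
  next
    fix zs :: "(nat set \<times> 'k elt \<times> (nat set \<times> 'k elt) list) list" assume G: "set zs \<subseteq> ?G"
    show "two_level n zs \<and> zs \<noteq> [] \<longrightarrow> F (C.pureC n (Scal \<one>\<^bsub>K\<^esub>) (pure_inner zs)) =
      pureC n (Scal (weight zs \<one>\<^bsub>K\<^esub>)) (flat zs)"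
    proof (intro impI, elim conjE)
      assume zs: "two_level n zs" "zs \<noteq> []"
      have "weight zs \<one>\<^bsub>K\<^esub> = \<one>\<^bsub>K\<^esub>" by (rule weight_one) (use G in blast)
      moreover have "\<exists>c\<in>partition_chains n (Suc (Suc d)).
        C.pureC n (Scal \<one>\<^bsub>K\<^esub>) (pure_inner zs) = comp_basis K comX comX_basis n c \<and>
        pureC n (Scal \<one>\<^bsub>K\<^esub>) (flat zs) = comX_basis n (chain_del 1 c)"
        by (rule flat_chain[OF zs]) (use G in auto)
      ultimately show "F (C.pureC n (Scal \<one>\<^bsub>K\<^esub>) (pure_inner zs)) = pureC n (Scal (weight zs \<one>\<^bsub>K\<^esub>)) (flat zs)"
        using F_basis by auto
    qed
  }
qed

text \<open>A map with the required values has to be exhibited before the choice says anything. The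
  map \<open>F\<close>, given on the basis by deleting the second partition, has them by
  \<open>mult_lift_flat\<close>. Conversely, each basis element is among the tensors on which the
  values are prescribed, so the chosen map agrees with \<open>F\<close> there.\<close>

lemma mult_first:
  shows "mult_first K (com_operad K) X n \<in> lin_maps K (comp_obj K (com_mod K) comX n) (objC n)"
    and "c \<in> partition_chains n (Suc (Suc d)) \<Longrightarrow>
      mult_first K (com_operad K) X n (comp_basis K comX comX_basis n c) = comX_basis n (chain_del 1 c)"
proof -
  interpret C: com_comp K comX "Suc d" comX_basis by (rule com_comp_comX)
  have B: "comX_basis n (chain_del 1 c) \<in> carrier (objC n)" if "c \<in> partition_chains n (Suc (Suc d))" for c
    by (rule C.e_closed[unfolded obj_comp]) (rule chain_del_inner[OF that], auto)
  have "\<exists>F\<in>lin_maps K (C.objC n) (objC n). \<forall>c\<in>partition_chains n (Suc (Suc d)).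
      F (comp_basis K comX comX_basis n c) = comX_basis n (chain_del 1 c)"
    by (rule free_basis_lift[OF C.comp_obj_module comp_obj_module C.comp_basis B])
  then obtain F where F: "F \<in> lin_maps K (C.objC n) (objC n)"
    "\<And>c. c \<in> partition_chains n (Suc (Suc d)) \<Longrightarrow>
      F (comp_basis K comX comX_basis n c) = comX_basis n (chain_del 1 c)" by blast
  have main: "F (C.pureC n x (pure_inner zs)) = pureC n (Scal (weight zs (unscal x))) (flat zs)"
    if zs: "two_level n zs" and x: "x \<in> carrier (obj (com_mod K) (length zs))" for x zs
  proof (cases "zs = []")
    case True
    have T: "(x, []) \<in> C.tensorsC n" "(x, []) \<in> tensorsC n"
      using pure_inner_tensor[OF zs x] flat_tensor[OF zs x] x True by auto
    have "x = Scal \<zero>\<^bsub>K\<^esub>" using scal_left(3)[OF T(2)] by simp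
    then show ?thesis
      using True C.pure_scal_zero[OF T(1)] pure_scal_zero[OF T(2)]
        lin_maps_zero[OF C.comp_obj_module comp_obj_module F(1)] by simp
  next
    case False
    have x1: "Scal \<one>\<^bsub>K\<^esub> \<in> carrier (obj (com_mod K) (length zs))" using False by simp
    have ux: "unscal x \<in> carrier K" using x False by auto
    note T = pure_inner_tensor[OF zs x] and T1 = pure_inner_tensor[OF zs x1] and FT1 = flat_tensor[OF zs x1]
    have ne: "pure_inner zs \<noteq> []" using False by (simp add: pure_inner_def)
    have "F (C.pureC n x (pure_inner zs)) = unscal x \<odot>\<^bsub>objC n\<^esub> F (C.pureC n (Scal \<one>\<^bsub>K\<^esub>) (pure_inner zs))"
      unfolding C.pure_scal_one[OF T ne] by (rule lin_mapsD(3)[OF F(1) ux C.pure_closed[OF T1]])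
    also have "\<dots> = unscal x \<odot>\<^bsub>objC n\<^esub> pureC n (Scal (weight zs \<one>\<^bsub>K\<^esub>)) (flat zs)"
      using mult_lift_flat[OF F, of zs] zs False by simp
    also have "\<dots> = pureC n (Scal (unscal x \<otimes>\<^bsub>K\<^esub> weight zs \<one>\<^bsub>K\<^esub>)) (flat zs)"
      using pure_scal[OF FT1 ux] by simp
    also have "unscal x \<otimes>\<^bsub>K\<^esub> weight zs \<one>\<^bsub>K\<^esub> = weight zs (unscal x \<otimes>\<^bsub>K\<^esub> \<one>\<^bsub>K\<^esub>)"
      by (rule weight_smult[symmetric]) (use two_levelD(3)[OF zs] ux in auto)
    finally show ?thesis using ux by simp
  qed
  \<comment> \<open>\<open>Q\<close> is the specification of \<open>mult_first\<close> with the
    operad multiplication evaluated to \<open>weight\<close>.\<close>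
  define Q where "Q f \<longleftrightarrow> f \<in> lin_maps K (C.objC n) (objC n) \<and>
    (\<forall>x zs. x \<in> carrier (obj (com_mod K) (length zs)) \<and> two_level n zs \<longrightarrow>
      f (C.pureC n x (pure_inner zs)) = pureC n (Scal (weight zs (unscal x))) (flat zs))" for f
  have "mult_first K (com_operad K) X n = (SOME f. Q f)"
  proof -
    have "(x \<in> carrier (obj (com_mod K) (length zs)) \<and> decomp n (map fst zs) \<and>
        (\<forall>(J, p, qs)\<in>set zs. (p, qs) \<in> tensorsC (card J)) \<longrightarrow>
        (let ms = map (\<lambda>(J, p, qs). length qs) zs; s = sum_list ms in
         f (C.pureC n x (map (\<lambda>(J, p, qs). (J, pureC (card J) p qs)) zs)) =
         pureC n (op_mult (com_operad K) s (pure K (com_mod K) (com_mod K) s x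
              (zip (intervals 0 ms) (map (\<lambda>(J, p, qs). p) zs))))
           (concat (map (\<lambda>(J, p, qs). map (\<lambda>(L, q). (emb J ` L, q)) qs) zs)))) \<longleftrightarrow>
      (x \<in> carrier (obj (com_mod K) (length zs)) \<and> two_level n zs \<longrightarrow>
      f (C.pureC n x (pure_inner zs)) = pureC n (Scal (weight zs (unscal x))) (flat zs))" for f x zs
      unfolding two_level_def[symmetric] pure_inner_def[symmetric] flat_def[symmetric] Let_def
      using op_mult_inner[of n zs x] by auto
    then show ?thesis unfolding mult_first_def Q_def com_operad_simps(1) obj_comp by simp
  qed
  moreover have "Q F" unfolding Q_def using F(1) main by blast
  ultimately have Qf: "Q (mult_first K (com_operad K) X n)" by (simp add: someI)
  then show "mult_first K (com_operad K) X n \<in> lin_maps K (comp_obj K (com_mod K) comX n) (objC n)"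
    by (simp add: Q_def)
  assume c: "c \<in> partition_chains n (Suc (Suc d))"
  \<comment> \<open>The basis element of \<open>c\<close> is presented as a two-level tensor: blocks
    of \<open>c ! 1\<close> outside, blocks of the second entries of the restricted chains inside,
    and all left entries one.\<close>
  define Ls where "Ls J = map (\<lambda>L. (L, e (card L) (restr L (restr J c)))) (enum_set (restr J c ! 1))" for J
  define zs where "zs = map (\<lambda>J. (J, Scal \<one>\<^bsub>K\<^esub>, Ls J)) (enum_set (c ! 1))"
  have pin: "C.pureC n (Scal \<one>\<^bsub>K\<^esub>) (pure_inner zs) = comp_basis K comX comX_basis n c"
    by (simp add: comp_basis_def zs_def Ls_def pure_inner_def o_def)
  have "finite (c ! 1)" by (rule finite_elements[OF _ partition_chainsD(6)[OF c]]) auto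
  then have en: "distinct (enum_set (c ! 1))" "set (enum_set (c ! 1)) = c ! 1" using enum_set by auto
  have "(Scal \<one>\<^bsub>K\<^esub>, Ls J) \<in> tensorsC (card J)" if "J \<in> c ! 1" for J
    using basis_chain(1)[OF restr_chain[OF c that]] by (simp add: Ls_def)
  moreover have "map fst zs = enum_set (c ! 1)" by (simp add: zs_def o_def)
  ultimately have "two_level n zs"
    using decomp_enum[OF partition_chainsD(6)[OF c, of 1] en] en(2) by (auto simp: two_level_def zs_def)
  moreover have "zs \<noteq> []"
  proof
    assume "zs = []"
    then have "c ! 1 = {}" using en(2) by (simp add: zs_def)
    then show False using partition_onD1[OF partition_chainsD(6)[OF c, of 1]] partition_chains_pos[OF c] by simp
  qed
  then have "Scal \<one>\<^bsub>K\<^esub> \<in> carrier (obj (com_mod K) (length zs))" by simp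
  ultimately have "mult_first K (com_operad K) X n (C.pureC n (Scal \<one>\<^bsub>K\<^esub>) (pure_inner zs)) =
      F (C.pureC n (Scal \<one>\<^bsub>K\<^esub>) (pure_inner zs))"
    using Qf main unfolding Q_def by metis
  then show "mult_first K (com_operad K) X n (comp_basis K comX comX_basis n c) = comX_basis n (chain_del 1 c)"
    using F(2)[OF c] pin by simp
qed

end

section \<open>The bar construction of the commutative operad\<close>

text \<open>The base case may be constant, as the only chain of dimension 0 lives in arity
  1.\<close>

primrec bar_basis :: "('k, 'm) ring_scheme \<Rightarrow> nat \<Rightarrow> nat \<Rightarrow> nat set set list \<Rightarrow> 'k elt" where
  "bar_basis K 0 = (\<lambda>n c. Scal \<one>\<^bsub>K\<^esub>)"
| "bar_basis K (Suc d) = comp_basis K (comp_power K (com_operad K) d) (bar_basis K d)"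

text \<open>In arity 1 the only chain gives the generator of the ground ring; in every other arity
  the module is zero and there are no chains.\<close>

lemma unit_mod_basis:
  assumes "cring K"
  shows "free_basis K (obj (unit_mod K) n) (partition_chains n 0) (\<lambda>c. Scal \<one>\<^bsub>K\<^esub>)"
proof -
  interpret K: cring K by fact
  have mod: "module K (obj (unit_mod K) n)"
    by (simp add: ground_mod_module zero_mod_module assms)
  show ?thesis
  proof (cases "n = 1")
    case True
    have "carrier (ground_mod K) \<subseteq> H" if H: "submodule H K (ground_mod K)" "Scal \<one>\<^bsub>K\<^esub> \<in> H" for H
    proof
      fix x assume "x \<in> carrier (ground_mod K)"
      then obtain a where "a \<in> carrier K" "x = a \<odot>\<^bsub>ground_mod K\<^esub> Scal \<one>\<^bsub>K\<^esub>" by auto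
      then show "x \<in> H" using submodule.smult_closed[OF H(1) _ H(2)] by simp
    qed
    moreover have "partition_chains n 0 = {[{{1}}]}" using True partition_chains_0 by blast
    ultimately show ?thesis
      using True lin_maps_id[of K "ground_mod K"] by (auto simp: free_basis_def)
  next
    case False
    have "carrier (zero_mod K) \<subseteq> H" if "submodule H K (zero_mod K)" for H
      using submodule.axioms(1)[OF that] by (auto simp: subgroup_def)
    moreover have "partition_chains n 0 = {}" using False partition_chains_0 by blast
    ultimately show ?thesis using False by (simp add: free_basis_def)
  qed
qed

lemma com_comp_bar:
  assumes "cring K" shows "com_comp K (comp_power K (com_operad K) d) d (bar_basis K d)"
proof (induction d)
  case 0
  show ?case
  proof (rule com_comp.intro[OF com_data.intro com_comp_axioms.intro])
    show "module K (obj (comp_power K (com_operad K) 0) n)" for n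
      by (simp add: ground_mod_module zero_mod_module assms)
    show "free_basis K (obj (comp_power K (com_operad K) 0) n) (partition_chains n 0) (bar_basis K 0 n)" for n
      using unit_mod_basis[OF assms] by simp
  qed (rule assms)
next
  case (Suc d)
  then interpret com_comp K "comp_power K (com_operad K) d" d "bar_basis K d" .
  show ?case using com_comp_Suc by simp
qed

lemma bar_act:
  assumes "cring K"
  shows "w permutes {1..n} \<Longrightarrow> act (comp_power K (com_operad K) d) n w \<in>
      lin_maps K (obj (comp_power K (com_operad K) d) n) (obj (comp_power K (com_operad K) d) n) \<and>
    (\<forall>c\<in>partition_chains n d. act (comp_power K (com_operad K) d) n w (bar_basis K d n c) =
      bar_basis K d n (chain_act w c))"
proof (induction d arbitrary: n w)
  case 0
  then show ?case using lin_maps_id by (simp add: lin_maps_def)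
next
  case (Suc d)
  interpret com_comp K "comp_power K (com_operad K) d" d "bar_basis K d" by (rule com_comp_bar[OF assms])
  show ?case
    using comp_act[OF conjunct1[OF Suc.IH] bspec[OF conjunct2[OF Suc.IH]] Suc.prems] by simp
qed

text \<open>Face 0 is the augmentation and, above dimension 1, face 1 is the product. Higher faces
  act on the blocks by induction: one block whose face is no chain supplies a zero factor, in
  agreement with \<open>chain_del_iff\<close>.\<close>

lemma bar_face:
  assumes "cring K"
  shows "i \<le> Suc d \<Longrightarrow> bar_face K (com_operad K) (Suc d) i n \<in>
      lin_maps K (obj (comp_power K (com_operad K) (Suc d)) n) (obj (comp_power K (com_operad K) d) n) \<and>
    (\<forall>c\<in>partition_chains n (Suc d). bar_face K (com_operad K) (Suc d) i n (bar_basis K (Suc d) n c) =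
      (if chain_del i c \<in> partition_chains n d then bar_basis K d n (chain_del i c)
       else \<zero>\<^bsub>obj (comp_power K (com_operad K) d) n\<^esub>))"
proof (induction d arbitrary: i n)
  case 0
  interpret com_comp K "comp_power K (com_operad K) 0" 0 "bar_basis K 0" by (rule com_comp_bar[OF assms])
  have f: "bar_face K (com_operad K) (Suc 0) i n = aug_first K (com_operad K) (comp_power K (com_operad K) 0) n"
    using 0 by (cases i) auto
  \<comment> \<open>In dimension 1 both faces are the augmentation, so both deletions must succeed
    together: each does exactly when \<open>n = 1\<close>, and the constant basis of dimension 0
    does not distinguish the results.\<close>
  have iff: "chain_del i c \<in> partition_chains n 0 \<longleftrightarrow> tl c \<in> partition_chains n 0"
    if c: "c \<in> partition_chains n (Suc 0)" for c
  proof (cases i)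
    case 0
    then show ?thesis by (simp add: chain_del_def drop_Suc)
  next
    case (Suc i')
    note D = partition_chainsD[OF c]
    obtain a b where ab: "c = [a, b]" using D(1) by (auto simp: length_Suc_conv)
    have "a = {{1..n}}" "b = (\<lambda>i. {i}) ` {1..n}" using D(4,5) ab by auto
    then have "[a] \<in> partition_chains n 0 \<longleftrightarrow> n = 1" "[b] \<in> partition_chains n 0 \<longleftrightarrow> n = 1"
      by (auto simp: partition_chains_0)
    then show ?thesis using Suc \<open>i \<le> Suc 0\<close> ab by (simp add: chain_del_def)
  qed
  show ?case
    unfolding f using aug_first iff by simp
next
  case (Suc d)
  interpret C: com_comp K "comp_power K (com_operad K) d" d "bar_basis K d" by (rule com_comp_bar[OF assms])
  interpret C1: com_comp K "comp_power K (com_operad K) (Suc d)" "Suc d" "bar_basis K (Suc d)"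
    by (rule com_comp_bar[OF assms])
  consider "i = 0" | "i = 1" | i' where "i = Suc (Suc i')" "i' \<le> d"
    using Suc.prems by (metis One_nat_def Suc_le_mono not0_implies_Suc)
  then show ?case
  proof cases
    case 1
    then show ?thesis using C1.aug_first by (simp add: chain_del_def drop_Suc)
  next
    case 2
    have "chain_del 1 c \<in> partition_chains n (Suc d)" if "c \<in> partition_chains n (Suc (Suc d))" for c
      by (rule chain_del_inner[OF that]) auto
    then show ?thesis using 2 C.mult_first by simp
  next
    case 3
    let ?f = "bar_face K (com_operad K) (Suc d) (Suc i')"
    have IH: "?f n \<in> lin_maps K (obj (comp_power K (com_operad K) (Suc d)) n) (obj (comp_power K (com_operad K) d) n)"
      "\<And>c. c \<in> partition_chains n (Suc d) \<Longrightarrow> ?f n (bar_basis K (Suc d) n c) =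
      (if chain_del (Suc i') c \<in> partition_chains n d then bar_basis K d n (chain_del (Suc i') c)
       else \<zero>\<^bsub>obj (comp_power K (com_operad K) d) n\<^esub>)" for n
      using Suc.IH[of "Suc i'" n] 3(2) by blast+
    note cm = comp_map_basis[OF C1.com_comp_axioms C.com_comp_axioms IH(1)]
    have f: "bar_face K (com_operad K) (Suc (Suc d)) i = comp_map K (com_mod K) (comp_power K (com_operad K) (Suc d))
        (com_mod K) (comp_power K (com_operad K) d) (\<lambda>_ x. x) ?f"
      by (simp add: 3(1))
    have "bar_face K (com_operad K) (Suc (Suc d)) i n (bar_basis K (Suc (Suc d)) n c) =
      (if chain_del i c \<in> partition_chains n (Suc d) then bar_basis K (Suc d) n (chain_del i c)
       else \<zero>\<^bsub>obj (comp_power K (com_operad K) (Suc d)) n\<^esub>)"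
      if c: "c \<in> partition_chains n (Suc (Suc d))" for c
    proof -
      note del = chain_del_iff[OF c 3(2), folded 3(1)]
      have ne: "c \<noteq> []" using partition_chainsD(1)[OF c] by auto
      show ?thesis
      proof (cases "chain_del i c \<in> partition_chains n (Suc d)")
        case True
        have "?f (card J) (bar_basis K (Suc d) (card J) (restr J c)) = bar_basis K d (card J) (restr J (chain_del i c))"
          if J: "J \<in> c ! 1" for J
        proof -
          have "chain_del (Suc i') (restr J c) \<in> partition_chains (card J) d" using True del(1) J by blast
          then show ?thesis using IH(2)[OF restr_chain[OF c J]] restr_del[OF ne, of J "Suc i'"] by (simp only: 3(1) if_True)
        qed
        from cm(2)[OF c True del(2) this] show ?thesis
          unfolding f bar_basis.simps(2)[of K "Suc d"] using True by simp
      next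
        case False
        then obtain J where J: "J \<in> c ! 1" "chain_del (Suc i') (restr J c) \<notin> partition_chains (card J) d"
          using del(1) by blast
        have "?f (card J) (bar_basis K (Suc d) (card J) (restr J c)) = \<zero>\<^bsub>obj (comp_power K (com_operad K) d) (card J)\<^esub>"
          using IH(2)[OF restr_chain[OF c J(1)]] J(2) by (simp only: if_False)
        from cm(3)[OF c J(1) this] show ?thesis
          unfolding f bar_basis.simps(2)[of K "Suc d"] using False by simp
      qed
    qed
    moreover have "bar_face K (com_operad K) (Suc (Suc d)) i n \<in>
        lin_maps K (obj (comp_power K (com_operad K) (Suc (Suc d))) n) (obj (comp_power K (com_operad K) (Suc d)) n)"
      unfolding f using cm(1)[of n] by simp
    ultimately show ?thesis by blast
  qed
qed

text \<open>Degeneracy 0 inserts the unit in front and repeats the top; the others act on the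
  blocks, where duplication commutes with restriction.\<close>

lemma bar_degen:
  assumes "cring K"
  shows "j \<le> d \<Longrightarrow> bar_degen K (com_operad K) d j n \<in>
      lin_maps K (obj (comp_power K (com_operad K) d) n) (obj (comp_power K (com_operad K) (Suc d)) n) \<and>
    (\<forall>c\<in>partition_chains n d. bar_degen K (com_operad K) d j n (bar_basis K d n c) =
      bar_basis K (Suc d) n (chain_dup j c))"
proof (induction d arbitrary: j n)
  case 0
  interpret com_comp K "comp_power K (com_operad K) 0" 0 "bar_basis K 0" by (rule com_comp_bar[OF assms])
  have "chain_dup 0 c = {{1..n}} # c" if "c \<in> partition_chains n 0" for c
    using partition_chainsD(1,4)[OF that] by (cases c) (auto simp: chain_dup_def)
  then show ?case using 0 unit_first by simp
next
  case (Suc d)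
  interpret C: com_comp K "comp_power K (com_operad K) d" d "bar_basis K d" by (rule com_comp_bar[OF assms])
  interpret C1: com_comp K "comp_power K (com_operad K) (Suc d)" "Suc d" "bar_basis K (Suc d)"
    by (rule com_comp_bar[OF assms])
  show ?case
  proof (cases j)
    case 0
    have "chain_dup 0 c = {{1..n}} # c" if "c \<in> partition_chains n (Suc d)" for c
      using partition_chainsD(1,4)[OF that] by (cases c) (auto simp: chain_dup_def)
    then show ?thesis using 0 C1.unit_first by simp
  next
    case j: (Suc j')
    let ?f = "bar_degen K (com_operad K) d j'"
    have IH: "?f n \<in> lin_maps K (obj (comp_power K (com_operad K) d) n) (obj (comp_power K (com_operad K) (Suc d)) n)"
      "\<And>c. c \<in> partition_chains n d \<Longrightarrow> ?f n (bar_basis K d n c) = bar_basis K (Suc d) n (chain_dup j' c)" for n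
      using Suc.IH[of j' n] Suc.prems j by auto
    note cm = comp_map_basis[OF C.com_comp_axioms C1.com_comp_axioms IH(1)]
    have f: "bar_degen K (com_operad K) (Suc d) j = comp_map K (com_mod K) (comp_power K (com_operad K) d)
        (com_mod K) (comp_power K (com_operad K) (Suc d)) (\<lambda>_ x. x) ?f"
      by (simp add: j)
    have "bar_degen K (com_operad K) (Suc d) j n (bar_basis K (Suc d) n c) = bar_basis K (Suc (Suc d)) n (chain_dup j c)"
      if c: "c \<in> partition_chains n (Suc d)" for c
    proof -
      have len: "length c = Suc (Suc d)" by (rule partition_chainsD(1)[OF c])
      then have ne: "c \<noteq> []" by auto
      have dup: "chain_dup j c \<in> partition_chains n (Suc (Suc d))" by (rule chain_dup_chain[OF c Suc.prems])
      have nth: "chain_dup j c ! 1 = c ! 1" using Suc.prems len j by (simp add: chain_dup_nth)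
      have "?f (card J) (bar_basis K d (card J) (restr J c)) = bar_basis K (Suc d) (card J) (restr J (chain_dup j c))"
        if J: "J \<in> c ! 1" for J
        using IH(2)[OF restr_chain[OF c J]] restr_dup[OF ne, of J j'] by (simp only: j)
      from cm(2)[OF c dup nth this] show ?thesis
        unfolding f bar_basis.simps(2)[of K "Suc d"] by simp
    qed
    moreover have "bar_degen K (com_operad K) (Suc d) j n \<in>
        lin_maps K (obj (comp_power K (com_operad K) (Suc d)) n) (obj (comp_power K (com_operad K) (Suc (Suc d))) n)"
      unfolding f using cm(1)[of n] by simp
    ultimately show ?thesis by blast
  qed
qed

theorem mainTheorem11:
  fixes K :: "('k, 'm) ring_scheme" and r :: nat
  assumes "cring K" and "r \<ge> 1"
  shows "chain_cpx_iso K r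
    (normalized K (bar K (com_operad K) r))
    (normalized K (reduced_chains K (partition_sset r)))"
proof -
  let ?X = "\<lambda>d. obj (comp_power K (com_operad K) d) r"
  let ?S = "partition_sset r"
  define \<phi> where "\<phi> d = coord_fun K (?X d) (partition_chains r d) (bar_basis K d r)" for d
  have X: "module K (?X d)" "free_basis K (?X d) (partition_chains r d) (bar_basis K d r)" for d
  proof -
    interpret com_comp K "comp_power K (com_operad K) d" d "bar_basis K d" by (rule com_comp_bar[OF assms(1)])
    show "module K (?X d)" "free_basis K (?X d) (partition_chains r d) (bar_basis K d r)"
      by (rule mod_X, rule basis)
  qed
  have S: "simplices ?S d = insert None (Some ` partition_chains r d)" "base ?S d = None" for d
    by (simp_all add: partition_sset_def)
  \<comment> \<open>A single criterion serves faces, degeneracies and permutations: agreement on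
    basis elements, with the base point counting as zero.\<close>
  have push: "\<phi> m (f x) = push K (base ?S m) h (\<phi> d x)"
    if f: "f \<in> lin_maps K (?X d) (?X m)"
      and fe: "\<And>c. c \<in> partition_chains r d \<Longrightarrow>
        f (bar_basis K d r c) = (case h (Some c) of None \<Rightarrow> \<zero>\<^bsub>?X m\<^esub> | Some c' \<Rightarrow> bar_basis K m r c')"
      and h: "\<And>c c'. c \<in> partition_chains r d \<Longrightarrow> h (Some c) = Some c' \<Longrightarrow> c' \<in> partition_chains r m"
      and x: "x \<in> carrier (?X d)" for f h d m x
    unfolding \<phi>_def by (rule coord_fun_push[OF X X f fe h S S x])
  show ?thesis
  proof (rule normalized_iso[where \<phi> = \<phi>])
    fix d
    show "module K (smod (bar K (com_operad K) r) d)" using X(1) by (simp add: bar_def)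
    show "module K (smod (reduced_chains K ?S) d)"
      using reduced_mod_module[OF assms(1)] by (simp add: reduced_chains_def)
    show "\<phi> d \<in> lin_isos K (smod (bar K (com_operad K) r) d) (smod (reduced_chains K ?S) d)"
      using coord_fun_iso[OF X S] by (simp add: bar_def reduced_chains_def \<phi>_def)
    fix i x assume "x \<in> carrier (smod (bar K (com_operad K) r) (Suc d))" and i: "i \<le> Suc d"
    then have x: "x \<in> carrier (?X (Suc d))" by (simp add: bar_def)
    note bf = bar_face[OF assms(1) i, of r]
    have "\<phi> d (bar_face K (com_operad K) (Suc d) i r x) = push K (base ?S d) (face ?S (Suc d) i) (\<phi> (Suc d) x)"
      by (rule push[OF conjunct1[OF bf] _ _ x])
        (use bf in \<open>auto simp: partition_sset_def chain_del_def Let_def split: if_splits\<close>)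
    then show "sface (bar K (com_operad K) r) (Suc d) i x \<in> carrier (smod (bar K (com_operad K) r) d) \<and>
        \<phi> d (sface (bar K (com_operad K) r) (Suc d) i x) =
        sface (reduced_chains K ?S) (Suc d) i (\<phi> (Suc d) x)"
      using lin_mapsD(1)[OF conjunct1[OF bf] x] by (simp add: bar_def reduced_chains_def)
  next
    fix d j x assume "x \<in> carrier (smod (bar K (com_operad K) r) d)" and j: "j \<le> d"
    then have x: "x \<in> carrier (?X d)" by (simp add: bar_def)
    note bd = bar_degen[OF assms(1) j, of r]
    have "\<phi> (Suc d) (bar_degen K (com_operad K) d j r x) = push K (base ?S (Suc d)) (degen ?S d j) (\<phi> d x)"
      by (rule push[OF conjunct1[OF bd] _ _ x])
        (use bd chain_dup_chain[OF _ j, of _ r] in \<open>auto simp: partition_sset_def chain_dup_def\<close>)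
    then show "sdegen (bar K (com_operad K) r) d j x \<in> carrier (smod (bar K (com_operad K) r) (Suc d)) \<and>
        \<phi> (Suc d) (sdegen (bar K (com_operad K) r) d j x) = sdegen (reduced_chains K ?S) d j (\<phi> d x)"
      using lin_mapsD(1)[OF conjunct1[OF bd] x] by (simp add: bar_def reduced_chains_def)
  next
    fix d w x assume w: "w permutes {1..r}" and "x \<in> carrier (smod (bar K (com_operad K) r) d)"
    then have x: "x \<in> carrier (?X d)" by (simp add: bar_def)
    note ba = bar_act[OF assms(1) w, of d]
    have "\<phi> d (act (comp_power K (com_operad K) d) r w x) = push K (base ?S d) (pact ?S d w) (\<phi> d x)"
      by (rule push[OF conjunct1[OF ba] _ _ x])
        (use ba chain_act_chain[OF w, of _ d] in \<open>auto simp: partition_sset_def chain_act_def\<close>)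
    then show "sact (bar K (com_operad K) r) d w x \<in> carrier (smod (bar K (com_operad K) r) d) \<and>
        \<phi> d (sact (bar K (com_operad K) r) d w x) = sact (reduced_chains K ?S) d w (\<phi> d x)"
      using lin_mapsD(1)[OF conjunct1[OF ba] x] by (simp add: bar_def reduced_chains_def)
  qed
qed

end
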